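(* Let $\Sigma$ be a closed orientable surface of genus at least $2$. The space $\mathrm{Rep}_\#(\pi_1(\Sigma),\mathrm{Homeo}_+(\mathbb{R}))$ of representations without global fixed points is connected.
   Context: $\mathrm{Homeo}_+(\mathbb{R})$ is the group of orientation preserving homeomorphisms of $\mathbb{R}$, with the compact-open topology (uniform convergence on compact sets). For a countable discrete group $G$, $\mathrm{Rep}(G,\mathrm{Homeo}_+(\mathbb{R}))$ is the set of group homomorphisms $G\to\mathrm{Homeo}_+(\mathbb{R})$ with the topology of pointwise convergence: $\rho_n\to\rho$ iff $\rho_n(g)\to\rho(g)$ in the compact-open topology for every $g\in G$. A global fixed point of $\rho$ is a point $x\in\mathbb{R}$ with $\rho(g)(x)=x$ for all $g\in G$. $\mathrm{Rep}_\#(G,\mathrm{Homeo}_+(\mathbb{R}))$ is the subset of representations without global fixed points, with the subspace topology. *)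

theory Defs
  imports "HOL-Analysis.Analysis" "HOL-Algebra.Group"
begin

subsection \<open>Closed orientable surfaces\<close>

definition polygon_side :: "nat \<Rightarrow> nat \<Rightarrow> real \<Rightarrow> complex" where
  "polygon_side g k s = cis (2 * pi * (real k + s) / real (4 * g))"

text \<open>
  The \<open>4g\<close>-gon is modelled by the closed unit disc, its \<open>k\<close>-th side (\<open>0 \<le> k < 4g\<close>, counterclockwise)
  being the arc parametrised by \<open>polygon_side g k\<close> on \<open>{0..1}\<close>. Sides are glued in pairs according
  to the boundary word \<open>a\<^sub>1 b\<^sub>1 a\<^sub>1\<inverse> b\<^sub>1\<inverse> \<dots> a\<^sub>g b\<^sub>g a\<^sub>g\<inverse> b\<^sub>g\<inverse>\<close>;
  the letter \<open>x\<inverse>\<close> denotes the side \<open>x\<close> traversed backwards, whence \<open>1 - s\<close>.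
\<close>
inductive side_pairing :: "nat \<Rightarrow> complex \<Rightarrow> complex \<Rightarrow> bool" for g :: nat where
  a_sides: "j < g \<Longrightarrow> s \<in> {0..1} \<Longrightarrow>
    side_pairing g (polygon_side g (4 * j) s) (polygon_side g (4 * j + 2) (1 - s))"
| b_sides: "j < g \<Longrightarrow> s \<in> {0..1} \<Longrightarrow>
    side_pairing g (polygon_side g (4 * j + 1) s) (polygon_side g (4 * j + 3) (1 - s))"

text \<open>
  The space \<open>S\<close> (with its subspace topology) is a closed orientable surface of genus \<open>g \<ge> 1\<close>: it is
  homeomorphic to the quotient of the \<open>4g\<close>-gon by the equivalence relation generated by the side
  pairing. The homeomorphism is expressed by a quotient map whose fibres are the equivalence classes.
\<close>
definition closed_orientable_surface :: "nat \<Rightarrow> 'a::topological_space set \<Rightarrow> bool" where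
  "closed_orientable_surface g S \<longleftrightarrow> 1 \<le> g \<and>
     (\<exists>q. quotient_map (top_of_set (cball 0 1)) (top_of_set S) q \<and>
          (\<forall>z\<in>cball 0 1. \<forall>w\<in>cball 0 1. q z = q w \<longleftrightarrow> equivclp (side_pairing g) z w))"


subsection \<open>The fundamental group\<close>

definition loops_at :: "'a::topological_space set \<Rightarrow> 'a \<Rightarrow> (real \<Rightarrow> 'a) set" where
  "loops_at S x0 = {p. path p \<and> path_image p \<subseteq> S \<and> pathstart p = x0 \<and> pathfinish p = x0}"

definition path_class :: "'a::topological_space set \<Rightarrow> (real \<Rightarrow> 'a) \<Rightarrow> (real \<Rightarrow> 'a) set" where
  "path_class S p = {q. homotopic_paths S p q}"

definition fundamental_group :: "'a::topological_space set \<Rightarrow> 'a \<Rightarrow> (real \<Rightarrow> 'a) set monoid" where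
  "fundamental_group S x0 =
     \<lparr>carrier = path_class S ` loops_at S x0,
      mult = (\<lambda>A B. \<Union>p\<in>A. \<Union>q\<in>B. path_class S (p +++ q)),
      one = path_class S (\<lambda>_. x0)\<rparr>"

lemma path_class_eq:
  "homotopic_paths S p q \<Longrightarrow> path_class S p = path_class S q"
  unfolding path_class_def
  by (auto intro: homotopic_paths_trans homotopic_paths_sym)

lemma path_class_self: "p \<in> loops_at S x0 \<Longrightarrow> p \<in> path_class S p"
  by (simp add: path_class_def loops_at_def homotopic_paths_refl)

lemma loops_at_join: "p \<in> loops_at S x0 \<Longrightarrow> q \<in> loops_at S x0 \<Longrightarrow> p +++ q \<in> loops_at S x0"
  unfolding loops_at_def using path_image_join_subset by (fastforce simp: path_image_join)

lemma loops_at_const: "x0 \<in> S \<Longrightarrow> (\<lambda>_. x0) \<in> loops_at S x0"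
  by (auto simp: loops_at_def path_def path_image_def pathstart_def pathfinish_def)

lemma mult_path_class:
  assumes "p \<in> loops_at S x0" "q \<in> loops_at S x0"
  shows "path_class S p \<otimes>\<^bsub>fundamental_group S x0\<^esub> path_class S q = path_class S (p +++ q)"
proof -
  have "path_class S (p' +++ q') = path_class S (p +++ q)"
    if "p' \<in> path_class S p" "q' \<in> path_class S q" for p' q'
  proof -
    have "homotopic_paths S (p +++ q) (p' +++ q')"
      using that assms by (intro homotopic_paths_join) (auto simp: path_class_def loops_at_def)
    then show ?thesis by (metis path_class_eq)
  qed
  then show ?thesis
    using path_class_self[OF assms(1)] path_class_self[OF assms(2)]
    unfolding fundamental_group_def monoid.simps by blast
qed

lemma homotopic_const_left:
  assumes p: "p \<in> loops_at S x0"
  shows "homotopic_paths S ((\<lambda>_. x0) +++ p) p"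
proof (rule homotopic_paths_sym, rule homotopic_paths_reparametrize)
  show "path p" "path_image p \<subseteq> S" using p by (auto simp: loops_at_def)
  show "continuous_on {0..1} (\<lambda>t::real. max 0 (2 * t - 1))" by (intro continuous_intros)
  show "((\<lambda>_. x0) +++ p) t = p (max 0 (2 * t - 1))" for t
    using p by (cases "t \<le> 1/2") (auto simp: joinpaths_def loops_at_def pathstart_def max_absorb1)
qed auto

lemma homotopic_reverse_left:
  assumes p: "p \<in> loops_at S x0"
  shows "homotopic_paths S (reversepath p +++ p) (\<lambda>_. x0)"
proof -
  have cp: "continuous_on {0..1} p" and im: "p ` {0..1} \<subseteq> S" and p01: "p 0 = x0" "p 1 = x0"
    using p by (auto simp: loops_at_def path_def path_image_def pathstart_def pathfinish_def)
  define f where "f = (\<lambda>y::real \<times> real. max (fst y) (\<bar>2 * snd y - 1\<bar>))"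
  have cf: "continuous_on ({0..1} \<times> {0..1}) f"
    unfolding f_def by (intro continuous_intros)
  have f01: "f ` ({0..1} \<times> {0..1}) \<subseteq> {0..1}" unfolding f_def by (auto simp: abs_if)
  have cpf: "continuous_on ({0..1} \<times> {0..1}) (p \<circ> f)"
    by (rule continuous_on_compose[OF cf continuous_on_subset[OF cp f01]])
  have impf: "(p \<circ> f) ` ({0..1} \<times> {0..1}) \<subseteq> S"
    unfolding image_comp[symmetric] using f01 im by (meson image_mono order_trans)
  have f0: "f (0, t) = \<bar>2 * t - 1\<bar>" for t by (simp add: f_def)
  have f1: "f (1, t) = 1" if "t \<in> {0..1}" for t using that by (simp add: f_def abs_if)
  have ft: "f (t, 0) = 1" "f (t, 1) = 1" if "t \<in> {0..1}" for t using that by (simp_all add: f_def)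
  have a1: "(p \<circ> f) (0, t) = (reversepath p +++ p) t" for t
    by (cases "t \<le> 1/2")
       (simp_all add: f0 joinpaths_def reversepath_def abs_of_nonneg abs_of_nonpos)
  show ?thesis
    unfolding homotopic_paths
    using cpf impf a1 f1 ft p01
    by (intro exI[of _ "p \<circ> f"])
       (auto simp: pathstart_def pathfinish_def Pi_iff image_subset_iff joinpaths_def reversepath_def)
qed

lemma group_fundamental_group:
  assumes x0: "x0 \<in> S"
  shows "group (fundamental_group S x0)"
proof (rule groupI)
  note [simp] = mult_path_class loops_at_join loops_at_const[OF x0]
  have C: "carrier (fundamental_group S x0) = path_class S ` loops_at S x0"
    and O: "\<one>\<^bsub>fundamental_group S x0\<^esub> = path_class S (\<lambda>_. x0)"
    by (simp_all add: fundamental_group_def)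
  fix A B D assume A: "A \<in> carrier (fundamental_group S x0)"
  from A obtain p where p: "p \<in> loops_at S x0" "A = path_class S p" by (auto simp: C)
  show "\<one>\<^bsub>fundamental_group S x0\<^esub> \<otimes>\<^bsub>fundamental_group S x0\<^esub> A = A"
    using p by (simp add: O path_class_eq[OF homotopic_const_left])
  have r: "reversepath p \<in> loops_at S x0" using p(1) by (auto simp: loops_at_def)
  show "\<exists>B\<in>carrier (fundamental_group S x0).
      B \<otimes>\<^bsub>fundamental_group S x0\<^esub> A = \<one>\<^bsub>fundamental_group S x0\<^esub>"
    using p r by (intro bexI[of _ "path_class S (reversepath p)"])
      (auto simp: O C path_class_eq[OF homotopic_reverse_left])
  assume "B \<in> carrier (fundamental_group S x0)"
  then obtain q where q: "q \<in> loops_at S x0" "B = path_class S q" by (auto simp: C)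
  show "A \<otimes>\<^bsub>fundamental_group S x0\<^esub> B \<in> carrier (fundamental_group S x0)"
    using p q by (auto simp: C)
  assume "D \<in> carrier (fundamental_group S x0)"
  then obtain r where r: "r \<in> loops_at S x0" "D = path_class S r" by (auto simp: C)
  have "homotopic_paths S (p +++ (q +++ r)) ((p +++ q) +++ r)"
    using p q r by (intro homotopic_paths_assoc) (auto simp: loops_at_def)
  then show "A \<otimes>\<^bsub>fundamental_group S x0\<^esub> B \<otimes>\<^bsub>fundamental_group S x0\<^esub> D =
      A \<otimes>\<^bsub>fundamental_group S x0\<^esub> (B \<otimes>\<^bsub>fundamental_group S x0\<^esub> D)"
    using p q r by (simp add: path_class_eq)
next
  show "\<one>\<^bsub>fundamental_group S x0\<^esub> \<in> carrier (fundamental_group S x0)"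
    using loops_at_const[OF x0] by (simp add: fundamental_group_def)
qed


subsection \<open>The topological group of orientation preserving homeomorphisms of the line\<close>

definition Homeo_plus :: "(real \<Rightarrow> real) monoid" where
  "Homeo_plus =
     \<lparr>carrier = {f. strict_mono f \<and> (\<exists>h. homeomorphism UNIV UNIV f h)}, mult = (\<circ>), one = id\<rparr>"

lemma group_Homeo_plus: "group Homeo_plus"
proof (rule groupI)
  fix f assume "f \<in> carrier Homeo_plus"
  then obtain h where f: "strict_mono f" and h: "homeomorphism UNIV UNIV f h"
    by (auto simp: Homeo_plus_def)
  have fh: "f (h x) = x" "h (f x) = x" for x
    using h by (auto simp: homeomorphism_def)
  have "strict_mono h"
  proof (rule strict_monoI)
    fix x y :: real assume "x < y"
    then have "f (h x) < f (h y)" by (simp add: fh)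
    then show "h x < h y" using strict_mono_less[OF f] by blast
  qed
  then have "h \<in> carrier Homeo_plus"
    using homeomorphism_symD[OF h] by (auto simp: Homeo_plus_def)
  then show "\<exists>g\<in>carrier Homeo_plus. g \<otimes>\<^bsub>Homeo_plus\<^esub> f = \<one>\<^bsub>Homeo_plus\<^esub>"
    by (rule bexI[rotated]) (auto simp: Homeo_plus_def fh)
next
  fix f g assume "f \<in> carrier Homeo_plus" "g \<in> carrier Homeo_plus"
  then show "f \<otimes>\<^bsub>Homeo_plus\<^esub> g \<in> carrier Homeo_plus"
    unfolding Homeo_plus_def
    by (auto simp: strict_mono_def) (blast intro: homeomorphism_compose)
next
  show "\<one>\<^bsub>Homeo_plus\<^esub> \<in> carrier Homeo_plus"
    using homeomorphism_ident[of "UNIV :: real set"]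
    by (auto simp: Homeo_plus_def strict_mono_def id_def)
qed (simp_all add: Homeo_plus_def comp_assoc)

definition compact_open_topology ::
    "('a::topological_space \<Rightarrow> 'b::topological_space) topology" where
  "compact_open_topology =
     topology_generated_by {{f. f ` K \<subseteq> U} | K U. compact K \<and> open U}"

definition Homeo_plus_topology :: "(real \<Rightarrow> real) topology" where
  "Homeo_plus_topology = subtopology compact_open_topology (carrier Homeo_plus)"

lemma topspace_Homeo_plus_topology: "topspace Homeo_plus_topology = carrier Homeo_plus"
proof -
  have "UNIV \<in> {{f :: real \<Rightarrow> real. f ` K \<subseteq> U} | K U. compact K \<and> open U}"
    by (rule CollectI, rule exI[of _ "{}"], rule exI[of _ UNIV]) simp
  then have "topspace (compact_open_topology :: (real \<Rightarrow> real) topology) = UNIV"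
    unfolding compact_open_topology_def topology_generated_by_topspace
    by blast
  then show ?thesis by (simp add: Homeo_plus_topology_def)
qed


subsection \<open>Spaces of representations\<close>

text \<open>
  \<open>hom\<close> leaves the values of a homomorphism outside the carrier arbitrary; they are fixed by
  extensionality, as required for points of \<open>product_topology\<close>. The topology
  of pointwise convergence is the one induced by the product topology.
\<close>
definition Rep :: "('g, 'm) monoid_scheme \<Rightarrow> ('g \<Rightarrow> real \<Rightarrow> real) set" where
  "Rep G = hom G Homeo_plus \<inter> extensional (carrier G)"

definition Rep_topology :: "('g, 'm) monoid_scheme \<Rightarrow> ('g \<Rightarrow> real \<Rightarrow> real) topology" where
  "Rep_topology G = subtopology (product_topology (\<lambda>_. Homeo_plus_topology) (carrier G)) (Rep G)"

definition global_fixed_point ::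
    "('g, 'm) monoid_scheme \<Rightarrow> ('g \<Rightarrow> real \<Rightarrow> real) \<Rightarrow> real \<Rightarrow> bool" where
  "global_fixed_point G \<rho> x \<longleftrightarrow> (\<forall>g\<in>carrier G. \<rho> g x = x)"

definition Rep_sharp :: "('g, 'm) monoid_scheme \<Rightarrow> ('g \<Rightarrow> real \<Rightarrow> real) set" where
  "Rep_sharp G = {\<rho> \<in> Rep G. \<nexists>x. global_fixed_point G \<rho> x}"

definition Rep_sharp_topology :: "('g, 'm) monoid_scheme \<Rightarrow> ('g \<Rightarrow> real \<Rightarrow> real) topology" where
  "Rep_sharp_topology G = subtopology (Rep_topology G) (Rep_sharp G)"

lemma topspace_Rep_topology: "topspace (Rep_topology G) = Rep G"
  by (auto simp: Rep_topology_def Rep_def topspace_Homeo_plus_topology hom_def PiE_def)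

lemma topspace_Rep_sharp_topology: "topspace (Rep_sharp_topology G) = Rep_sharp G"
  by (auto simp: Rep_sharp_topology_def Rep_sharp_def topspace_Rep_topology)

end

theory Submission
  imports Defs
begin

text \<open>
  Let \<open>G\<close> be the fundamental group of the surface, presented by \<open>\<alpha>\<^sub>j, \<beta>\<^sub>j\<close> (\<open>j < g\<close>) with the relation
  \<open>[\<alpha>\<^sub>0, \<beta>\<^sub>0] \<cdots> [\<alpha>\<^sub>g\<^sub>-\<^sub>1, \<beta>\<^sub>g\<^sub>-\<^sub>1] = 1\<close>, so that a representation is a tuple of homeomorphisms of the line
  satisfying this relation. Let \<open>\<tau>\<close> be the representation that sends every generator to \<open>x \<mapsto> x + 1\<close>. The
  space is connected because every open and closed set containing some \<open>\<rho>\<close> also contains \<open>\<tau>\<close>. Indeed,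
  by \<open>truncate_to_translations\<close> there is, for every \<open>N\<close>, a representation \<open>\<sigma>\<^sub>N\<close> without global fixed
  points that agrees with \<open>\<rho>\<close> on generators to the left of \<open>N\<close>, while all generators are \<open>x \<mapsto> x + 1\<close> near
  \<open>+\<infinity>\<close>. Then \<open>\<sigma>\<^sub>N\<close> tends to \<open>\<rho>\<close> as \<open>N\<close> grows; and the conjugates of a fixed \<open>\<sigma>\<^sub>N\<close> by \<open>x \<mapsto> x + t\<close>, which
  form a connected set, tend to \<open>\<tau>\<close> as \<open>t\<close> grows (\<open>connected_Rep_sharp\<close>).

  The truncation works one handle at a time. As \<open>N\<close> is not a global fixed point, one of the two elements
  of some handle \<open>(a, b)\<close> moves \<open>N\<close>. All other handles are interpolated, arbitrarily, between their old
  values and \<open>x \<mapsto> x + 1\<close>; genus at least two provides such a handle, and it moves every point far to the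
  right. The relation then prescribes a new commutator \<open>c'\<close> for the handle \<open>(a, b)\<close>: it equals the old
  \<open>[a, b]\<close> up to some far point and is the identity near \<open>+\<infinity>\<close>. It remains to solve \<open>a' b' = c' b' a'\<close>,
  that is, to find \<open>a'\<close> conjugating \<open>b'\<close> to \<open>c' b'\<close>. If \<open>b\<close> and \<open>c b\<close> push the relevant points to the same
  side, \<open>b'\<close> can be chosen so that \<open>b'\<close> and \<open>c' b'\<close> keep doing so up to a common fixed point \<open>p\<close> beyond
  which \<open>c'\<close> is the identity; the conjugacy \<open>a'\<close> is then forced to extend along orbits up to \<open>p\<close>, and beyond \<open>p\<close>
  the two elements only have to commute (\<open>extend_conjugator\<close>, \<open>extend_handle_up\<close>). After possibly exchanging
  \<open>a\<close> and \<open>b\<close> this hypothesis can always be met (\<open>handle_extends_if_not_fixed\<close>).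

  The presentation of \<open>G\<close> comes from the polygon. Crossing the \<open>k\<close>-th pair of sides gives a loop, and going
  around the single vertex gives the relation. The surface is covered by three open sets, whose pieces contract
  to the centre, to the edge midpoints and to the vertex; cutting a loop according to these pieces
  writes it as a product of crossings (\<open>generators_generate\<close>). Conversely, elements of a group \<open>H\<close> satisfying
  the relation label the edges and corners of the polygon consistently, which defines a locally constant
  \<open>H\<close>-valued cocycle on the three sets, and its holonomy is the required homomorphism (\<open>universal_property\<close>).
\<close>

section \<open>Homeomorphisms of the line\<close>

abbreviation finv :: "('a \<Rightarrow> 'b) \<Rightarrow> 'b \<Rightarrow> 'a" where
  "finv \<equiv> inv_into UNIV"

definition line_homeo :: "(real \<Rightarrow> real) \<Rightarrow> bool" where
  "line_homeo f \<longleftrightarrow> strict_mono f \<and> surj f"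

lemma line_homeoI:
  assumes "\<And>x y. x < y \<Longrightarrow> f x < f y" "\<And>y. \<exists>x. f x = y"
  shows "line_homeo f"
  using assms unfolding line_homeo_def strict_mono_def surj_def by metis

lemma line_homeo_less [simp]: "line_homeo f \<Longrightarrow> f x < f y \<longleftrightarrow> x < y"
  and line_homeo_le [simp]: "line_homeo f \<Longrightarrow> f x \<le> f y \<longleftrightarrow> x \<le> y"
  and line_homeo_eq [simp]: "line_homeo f \<Longrightarrow> f x = f y \<longleftrightarrow> x = y"
  by (auto simp: line_homeo_def strict_mono_less strict_mono_less_eq strict_mono_eq)

lemma line_homeo_surj: "line_homeo f \<Longrightarrow> surj f"
  and line_homeo_bij: "line_homeo f \<Longrightarrow> bij f"
  by (auto simp: line_homeo_def bij_def strict_mono_imp_inj_on)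

lemma inv_left [simp]: "line_homeo f \<Longrightarrow> finv f (f x) = x"
  and inv_right [simp]: "line_homeo f \<Longrightarrow> f (finv f x) = x"
  using line_homeo_bij by (simp_all add: bij_is_inj bij_is_surj surj_f_inv_f)

lemma line_homeo_id [simp]: "line_homeo id" "line_homeo (\<lambda>x. x)"
  by (auto intro!: line_homeoI)

lemma line_homeo_translation [simp]: "line_homeo (\<lambda>x. x + t)"
  by (rule line_homeoI) (auto intro: exI[of _ "y - t" for y])

lemma line_homeo_compose [simp]:
  assumes "line_homeo f" "line_homeo h"
  shows "line_homeo (\<lambda>x. f (h x))" "line_homeo (f \<circ> h)"
proof -
  show "line_homeo (\<lambda>x. f (h x))"
    using assms by (intro line_homeoI) (auto intro: exI[of _ "finv h (finv f y)" for y])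
  then show "line_homeo (f \<circ> h)" by (simp add: o_def)
qed

lemma line_homeo_inv [simp]:
  assumes f: "line_homeo f" shows "line_homeo (finv f)"
proof (rule line_homeoI)
  fix x y :: real assume "x < y"
  then have "f (finv f x) < f (finv f y)" using f by simp
  then show "finv f x < finv f y" using f by (simp del: inv_right)
qed (use f in \<open>auto intro: exI[of _ "f y" for y]\<close>)

lemma inv_le_iff: "line_homeo f \<Longrightarrow> finv f x \<le> y \<longleftrightarrow> x \<le> f y"
  and inv_less_iff: "line_homeo f \<Longrightarrow> finv f x < y \<longleftrightarrow> x < f y"
  and less_inv_iff: "line_homeo f \<Longrightarrow> y < finv f x \<longleftrightarrow> f y < x"
  and le_inv_iff: "line_homeo f \<Longrightarrow> y \<le> finv f x \<longleftrightarrow> f y \<le> x"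
  using line_homeo_le[of f "finv f x" y] line_homeo_le[of f y "finv f x"] line_homeo_less[of f "finv f x" y]
    line_homeo_less[of f y "finv f x"]
  by simp_all

lemma inv_eq_iff: "line_homeo f \<Longrightarrow> finv f x = y \<longleftrightarrow> x = f y"
  using line_homeo_eq[of f "finv f x" y] by simp

lemma continuous_on_line_homeo: "line_homeo f \<Longrightarrow> continuous_on A f"
  by (rule continuous_on_subset[OF continuous_onI_mono[of f UNIV]])
    (auto simp: line_homeo_surj)

lemma carrier_Homeo_plus: "carrier Homeo_plus = {f. line_homeo f}"
proof -
  have "\<exists>h. homeomorphism UNIV UNIV f h" if f: "line_homeo f" for f
    using f continuous_on_line_homeo[OF f] continuous_on_line_homeo[OF line_homeo_inv[OF f]]
    by (intro exI[of _ "finv f"])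
      (auto simp: homeomorphism_def line_homeo_surj line_homeo_bij bij_imp_bij_inv)
  moreover have "surj f" if "homeomorphism UNIV UNIV f h" for f h :: "real \<Rightarrow> real"
    using that by (auto simp: homeomorphism_def)
  ultimately show ?thesis
    by (auto simp: Homeo_plus_def line_homeo_def)
qed

lemma line_homeo_glue:
  assumes "line_homeo f" "line_homeo h" "f m = h m"
  shows "line_homeo (\<lambda>x. if x \<le> m then f x else h x)"
proof (rule line_homeoI)
  fix x y :: real assume xy: "x < y"
  have "f x < h y" if "x \<le> m" "m < y"
  proof -
    have "f x \<le> f m" "h m < h y" using assms(1,2) that by simp_all
    then show ?thesis using assms(3) by linarith
  qed
  then show "(if x \<le> m then f x else h x) < (if y \<le> m then f y else h y)"
    using xy assms by auto
next
  fix y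
  show "\<exists>x. (if x \<le> m then f x else h x) = y"
  proof (cases "y \<le> f m")
    case True
    then show ?thesis using assms by (intro exI[of _ "finv f y"]) (simp add: inv_le_iff)
  next
    case False
    then show ?thesis using assms by (intro exI[of _ "finv h y"]) (simp add: inv_le_iff)
  qed
qed

lemma line_homeo_max:
  assumes "line_homeo f" "line_homeo h"
  shows "line_homeo (\<lambda>x. max (f x) (h x))"
proof (rule line_homeoI)
  fix x y :: real assume "x < y"
  then have "f x < f y" "h x < h y" using assms by simp_all
  then show "max (f x) (h x) < max (f y) (h y)" by linarith
next
  fix y
  consider "finv f y \<le> finv h y" | "finv h y \<le> finv f y" by linarith
  then show "\<exists>x. max (f x) (h x) = y"
  proof cases
    case 1
    then have "h (finv f y) \<le> y" using assms by (simp only: le_inv_iff)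
    then show ?thesis using assms by (intro exI[of _ "finv f y"]) auto
  next
    case 2
    then have "f (finv h y) \<le> y" using assms by (simp only: le_inv_iff)
    then show ?thesis using assms by (intro exI[of _ "finv h y"]) auto
  qed
qed

lemma line_homeo_min:
  assumes "line_homeo f" "line_homeo h"
  shows "line_homeo (\<lambda>x. min (f x) (h x))"
proof (rule line_homeoI)
  fix x y :: real assume "x < y"
  then have "f x < f y" "h x < h y" using assms by simp_all
  then show "min (f x) (h x) < min (f y) (h y)" by linarith
next
  fix y
  consider "finv f y \<le> finv h y" | "finv h y \<le> finv f y" by linarith
  then show "\<exists>x. min (f x) (h x) = y"
  proof cases
    case 1
    then have "f (finv h y) \<ge> y" using assms by (simp only: inv_le_iff)
    then show ?thesis using assms by (intro exI[of _ "finv h y"]) auto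
  next
    case 2
    then have "h (finv f y) \<ge> y" using assms by (simp only: inv_le_iff)
    then show ?thesis using assms by (intro exI[of _ "finv f y"]) auto
  qed
qed

text \<open>
  The last equation tells on which side of the diagonal the graph lies when \<open>x2 = y2\<close>.
\<close>
lemma affine_through:
  fixes x1 x2 y1 y2 :: real
  assumes "x1 < x2" "y1 < y2"
  obtains k where "line_homeo k" "k x1 = y1" "k x2 = y2"
    "\<And>x. k x - x = (x - x2) * ((y2 - y1) / (x2 - x1) - 1) + (y2 - x2)"
proof
  define s where "s = (y2 - y1) / (x2 - x1)"
  have s: "s > 0" using assms by (simp add: s_def)
  have e: "s * (x1 - x2) = y1 - y2" using assms(1) by (simp add: s_def field_simps)
  let ?k = "\<lambda>x. y2 + s * (x - x2)"
  show "line_homeo ?k"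
  proof (rule line_homeoI)
    show "\<exists>x. ?k x = y" for y
      by (rule exI[of _ "x2 + (y - y2) / s"]) (use s in simp)
  qed (use s in simp)
  show "?k x1 = y1" "?k x2 = y2" using e by simp_all
  show "?k x - x = (x - x2) * ((y2 - y1) / (x2 - x1) - 1) + (y2 - x2)" for x
    unfolding s_def[symmetric] by (simp add: algebra_simps)
qed

lemma interpolate_homeo:
  assumes "line_homeo f" "line_homeo h"
  shows "\<exists>k S. line_homeo k \<and> R \<le> S \<and> (\<forall>x\<le>R. k x = f x) \<and> (\<forall>x\<ge>S. k x = h x)"
proof -
  define S where "S = max (R + 1) (finv h (f R + 1))"
  have "R < S" by (simp add: S_def)
  have "h S \<ge> f R + 1" using assms(2) inv_le_iff[of h "f R + 1" S] by (simp add: S_def)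
  then have "f R < h S" by simp
  obtain l where l: "line_homeo l" "l R = f R" "l S = h S"
    using affine_through[OF \<open>R < S\<close> \<open>f R < h S\<close>] by metis
  define k where "k = (\<lambda>x. if x \<le> R then f x else if x \<le> S then l x else h x)"
  have "line_homeo k" unfolding k_def
    by (intro line_homeo_glue) (use assms l \<open>R < S\<close> in auto)
  then show ?thesis using \<open>R < S\<close> l by (intro exI[of _ k] exI[of _ S]) (auto simp: k_def)
qed

text \<open>
  The extension is \<open>M \<circ> k\<close> with \<open>k\<close> affine and fixing \<open>p\<close>: since \<open>M\<close> is increasing, \<open>M \<circ> k\<close> stays on the
  same side of \<open>M\<close> as \<open>k\<close> of the diagonal, and this side is decided at \<open>m\<close>. Beyond \<open>p\<close> any
  homeomorphism \<open>t\<close> fixing \<open>p\<close> may follow.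
\<close>
lemma extend_above_or_below:
  assumes "line_homeo b" "line_homeo M" "line_homeo t"
    and "M p = p" "t p = p" "m < p" "b m < p"
  obtains b' where "line_homeo b'" "\<And>x. x \<le> m \<Longrightarrow> b' x = b x" "\<And>x. p \<le> x \<Longrightarrow> b' x = t x"
    "\<And>x. M m < b m \<Longrightarrow> m \<le> x \<Longrightarrow> x < p \<Longrightarrow> M x < b' x"
    "\<And>x. b m < M m \<Longrightarrow> m \<le> x \<Longrightarrow> x < p \<Longrightarrow> b' x < M x"
proof -
  define k0 where "k0 = finv M (b m)"
  have k0: "M k0 = b m" using assms by (simp add: k0_def)
  have "k0 < p" using assms by (simp add: k0_def inv_less_iff)
  obtain k where k: "line_homeo k" "k m = k0" "k p = p"
    and k': "\<And>x. k x - x = (x - p) * ((p - k0) / (p - m) - 1) + (p - p)"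
    using affine_through[OF \<open>m < p\<close> \<open>k0 < p\<close>] by metis
  define b' where "b' = (\<lambda>x. if x \<le> m then b x else if x \<le> p then M (k x) else t x)"
  have "line_homeo b'" unfolding b'_def
    by (intro line_homeo_glue) (use assms k k0 in auto)
  moreover have "b' x = b x" if "x \<le> m" for x using that by (simp add: b'_def)
  moreover have "b' x = t x" if "p \<le> x" for x
    using that assms k by (auto simp: b'_def)
  moreover have bk: "b' x = M (k x)" if "m \<le> x" "x < p" for x
    using that k k0 by (auto simp: b'_def)
  moreover have "M x < b' x" if "M m < b m" "m \<le> x" "x < p" for x
  proof -
    have "m < k0" using that(1) k0 assms by (metis line_homeo_less)
    then have "(p - k0) / (p - m) < 1" using assms by simp
    then have "k x - x > 0" unfolding k' using that by (simp add: mult_neg_neg)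
    then show ?thesis using bk that assms by simp
  qed
  moreover have "b' x < M x" if "b m < M m" "m \<le> x" "x < p" for x
  proof -
    have "k0 < m" using that(1) k0 assms by (metis line_homeo_less)
    then have "(p - k0) / (p - m) > 1" using assms by simp
    then have "k x - x < 0" unfolding k' using that by (simp add: mult_neg_pos)
    then show ?thesis using bk that assms by simp
  qed
  ultimately show ?thesis using that by blast
qed

section \<open>Extending conjugacies and handles to the right\<close>

text \<open>
  The supremum \<open>s\<close> of an orbit that stays below \<open>x\<close> would satisfy \<open>f s > s\<close>, so that
  \<open>f\<^sup>-\<^sup>1 s < s\<close> is exceeded by a point of the orbit, whose image exceeds \<open>s\<close>.
\<close>
lemma orbit_reaches:
  assumes f: "line_homeo f" and "f p = p" "P < p" "x < p"
    and up: "\<And>x. P \<le> x \<Longrightarrow> x < p \<Longrightarrow> x < f x"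
  shows "\<exists>n. x < (f ^^ n) P"
proof (rule ccontr)
  assume "\<not> ?thesis"
  then have le: "(f ^^ n) P \<le> x" for n by (meson not_le)
  define s where "s = (SUP n. (f ^^ n) P)"
  have bdd: "bdd_above (range (\<lambda>n. (f ^^ n) P))" using le by (auto simp: bdd_above_def)
  have "s \<le> x" unfolding s_def using le by (intro cSUP_least) auto
  have "P \<le> s" unfolding s_def using cSUP_upper[OF _ bdd, of 0] by simp
  then have "s < f s" using up \<open>s \<le> x\<close> \<open>x < p\<close> by simp
  then have "finv f s < s" using f by (simp add: inv_less_iff)
  then obtain n where "finv f s < (f ^^ n) P"
    unfolding s_def using less_cSUP_iff[OF _ bdd] by auto
  then have "s < (f ^^ Suc n) P" using f by (simp add: inv_less_iff)
  then show False unfolding s_def using cSUP_upper[OF _ bdd, of "Suc n"] by simp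
qed

lemma funpow_fixed: "f p = p \<Longrightarrow> (f ^^ n) p = p"
  by (induction n) auto

lemma line_homeo_funpow [simp]: "line_homeo f \<Longrightarrow> line_homeo (f ^^ n)"
  by (induction n) auto

lemma funpow_inv_cancel: "line_homeo f \<Longrightarrow> (finv f ^^ n) ((f ^^ n) x) = x"
  by (induction n arbitrary: x) (auto simp: funpow_swap1)

text \<open>
  A conjugacy from \<open>\<beta>\<close> to \<open>\<delta>\<close> that is known to the left of \<open>P\<close> propagates: the homeomorphisms
  \<open>\<delta>\<^sup>n a \<beta>\<^sup>-\<^sup>n\<close> stabilise on \<open>(-\<infinity>, \<beta>\<^sup>n P]\<close>, and the points \<open>\<beta>\<^sup>n P\<close> and \<open>\<delta>\<^sup>n (a P)\<close> both tend to the common fixed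
  point \<open>p\<close>. Their limit is thus a homeomorphism of \<open>(-\<infinity>, p)\<close>, continued by \<open>t\<close> beyond \<open>p\<close>.
\<close>
lemma extend_conjugator:
  assumes H: "line_homeo a" "line_homeo \<beta>" "line_homeo \<delta>" "line_homeo t"
    and fixp: "\<beta> p = p" "\<delta> p = p" "t p = p" and "P < p" "a P < p"
    and conj: "\<And>y. y \<le> P \<Longrightarrow> \<delta> (a (finv \<beta> y)) = a y"
    and up\<beta>: "\<And>x. P \<le> x \<Longrightarrow> x < p \<Longrightarrow> x < \<beta> x"
    and up\<delta>: "\<And>x. a P \<le> x \<Longrightarrow> x < p \<Longrightarrow> x < \<delta> x"
    and tail: "\<And>x. p \<le> x \<Longrightarrow> t (\<beta> x) = \<delta> (t x)"
  obtains a' where "line_homeo a'" "\<And>x. x \<le> P \<Longrightarrow> a' x = a x" "\<And>x. p \<le> x \<Longrightarrow> a' x = t x"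
    "\<And>x. a' (\<beta> x) = \<delta> (a' x)"
proof -
  define f where "f = (\<lambda>n. \<delta> ^^ n \<circ> a \<circ> finv \<beta> ^^ n)"
  define X where "X = (\<lambda>n. (\<beta> ^^ n) P)"
  have Hf: "line_homeo (f n)" for n unfolding f_def using H by simp
  have Xp: "X n < p" for n
    unfolding X_def using H(2) \<open>P < p\<close> fixp(1)
    by (metis funpow_fixed line_homeo_funpow line_homeo_less)
  \<comment> \<open>the orbit of \<open>P\<close> increases towards \<open>p\<close>\<close>
  have XP: "P \<le> X n" for n
  proof (induction n)
    case (Suc n)
    then show ?case using up\<beta>[of "X n"] Xp[of n] by (simp add: X_def)
  qed (simp add: X_def)
  have X_Suc: "X n \<le> X (Suc n)" for n
    using up\<beta>[of "X n"] XP[of n] Xp[of n] by (simp add: X_def)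
  have X_mono: "X n \<le> X m" if "n \<le> m" for n m using that by (rule lift_Suc_mono_le[of X, OF X_Suc])
  have step: "f (Suc n) x = f n x" if "x \<le> X n" for n x
  proof -
    let ?y = "(finv \<beta> ^^ n) x"
    have "?y \<le> (finv \<beta> ^^ n) (X n)" using that H by simp
    then have "?y \<le> P" using H by (simp add: X_def funpow_inv_cancel)
    then show ?thesis using conj[of ?y] by (simp add: f_def funpow_swap1)
  qed
  have stable: "f m x = f n x" if "n \<le> m" "x \<le> X n" for n m x
    using that(1)
  proof (induction rule: dec_induct)
    case (step m)
    then show ?case using \<open>\<And>n x. x \<le> X n \<Longrightarrow> f (Suc n) x = f n x\<close>[of x m] X_mono[OF step(1)] that(2) by simp
  qed simp
  have reach: "\<exists>n. x < X n" if "x < p" for x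
    unfolding X_def by (rule orbit_reaches[OF H(2) fixp(1) \<open>P < p\<close> that up\<beta>])
  have fX: "f n (X n) = (\<delta> ^^ n) (a P)" for n
    using H by (simp add: f_def X_def funpow_inv_cancel)
  have reach': "\<exists>n. y < f n (X n)" if "y < p" for y
    unfolding fX by (rule orbit_reaches[OF H(3) fixp(2) \<open>a P < p\<close> that up\<delta>])
  have fXp: "f n (X n) < p" for n
    unfolding fX using H(3) \<open>a P < p\<close> fixp(2)
    by (metis funpow_fixed line_homeo_funpow line_homeo_less)
  define a' where "a' = (\<lambda>x. if x < p then f (LEAST n. x \<le> X n) x else t x)"
  have a'_eq: "a' x = f n x" if "x \<le> X n" for x n
  proof -
    let ?k = "LEAST n. x \<le> X n"
    have "?k \<le> n" "x \<le> X ?k" using that by (auto intro: Least_le LeastI)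
    moreover have "x < p" using that Xp[of n] by simp
    ultimately show ?thesis using stable[of ?k n x] by (simp add: a'_def)
  qed
  have tp: "p \<le> t x" if "p \<le> x" for x using that H(4) fixp(3) by (metis line_homeo_le)
  have "line_homeo a'"
  proof (rule line_homeoI)
    fix x y :: real assume xy: "x < y"
    show "a' x < a' y"
    proof (cases "y < p")
      case True
      then obtain n where n: "y < X n" using reach by blast
      then have "a' y = f n y" "a' x = f n x" using a'_eq xy by auto
      then show ?thesis using Hf xy by simp
    next
      case False
      then have y: "a' y = t y" "p \<le> t y" using tp by (auto simp: a'_def)
      show ?thesis
      proof (cases "x < p")
        case True
        then obtain n where n: "x < X n" using reach by blast
        then have "a' x = f n x" "f n x < f n (X n)" using a'_eq Hf by auto
        then show ?thesis using y fXp[of n] by simp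
      next
        case False
        then show ?thesis using y xy H by (simp add: a'_def)
      qed
    qed
  next
    fix y
    show "\<exists>x. a' x = y"
    proof (cases "y < p")
      case True
      then obtain n where n: "y < f n (X n)" using reach' by blast
      then have "finv (f n) y \<le> X n" using Hf by (simp add: inv_le_iff)
      then show ?thesis using a'_eq Hf by (intro exI[of _ "finv (f n) y"]) simp
    next
      case False
      then have "p \<le> finv t y" using H fixp by (metis inv_right line_homeo_le not_le)
      then show ?thesis using H by (intro exI[of _ "finv t y"]) (simp add: a'_def)
    qed
  qed
  moreover have "a' x = a x" if "x \<le> P" for x
    using a'_eq[of x 0] that by (simp add: X_def f_def)
  moreover have "a' x = t x" if "p \<le> x" for x using that by (simp add: a'_def)
  moreover have "a' (\<beta> x) = \<delta> (a' x)" for x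
  proof (cases "x < p")
    case True
    then have "\<beta> x < p" using H fixp by (metis line_homeo_less)
    then obtain n m where "x < X n" "\<beta> x < X m" using reach True by blast
    then have n: "x \<le> X (max n m)" "\<beta> x \<le> X (Suc (max n m))"
      using X_mono[of n "max n m"] X_mono[of m "Suc (max n m)"] by linarith+
    have "a' (\<beta> x) = f (Suc (max n m)) (\<beta> x)" using a'_eq n by blast
    also have "\<dots> = \<delta> (f (max n m) x)" using H by (simp add: f_def funpow_swap1)
    also have "\<dots> = \<delta> (a' x)" using a'_eq n by simp
    finally show ?thesis .
  next
    case False
    then have "p \<le> \<beta> x" using H fixp by (metis line_homeo_le not_le)
    then show ?thesis using False tail[of x] by (simp add: a'_def)
  qed
  ultimately show ?thesis by (rule that)
qed

text \<open>
  The handle \<open>(a, b)\<close> can be changed to the right of \<open>P\<close> so that its commutator becomes \<open>c'\<close>. The equation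
  \<open>a' b' = c' b' a'\<close> expresses that \<open>c'\<close> is the commutator of \<open>a'\<close> and \<open>b'\<close>; the point \<open>p\<close>, which can be taken as far
  to the right as desired, bounds the region in which the new handle is responsible for the absence of
  global fixed points.
\<close>
definition extends_to :: "(real \<Rightarrow> real) \<Rightarrow> (real \<Rightarrow> real) \<Rightarrow> (real \<Rightarrow> real) \<Rightarrow> real \<Rightarrow> real \<Rightarrow> bool" where
  "extends_to a b c' P S \<longleftrightarrow> (\<exists>a' b' p q. line_homeo a' \<and> line_homeo b' \<and> S \<le> p \<and>
    (\<forall>x. a' (b' x) = c' (b' (a' x))) \<and> (\<forall>x\<le>P. a' x = a x \<and> b' x = b x) \<and>
    (\<forall>x. P \<le> x \<longrightarrow> x < p \<longrightarrow> a' x \<noteq> x \<or> b' x \<noteq> x) \<and> (\<forall>x\<ge>q. a' x = x + 1 \<and> b' x = x + 1))"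

lemma extends_toI:
  assumes "line_homeo a'" "line_homeo b'" "S \<le> p" "\<And>x. a' (b' x) = c' (b' (a' x))"
    "\<And>x. x \<le> P \<Longrightarrow> a' x = a x" "\<And>x. x \<le> P \<Longrightarrow> b' x = b x"
    "\<And>x. P \<le> x \<Longrightarrow> x < p \<Longrightarrow> a' x \<noteq> x \<or> b' x \<noteq> x"
    "\<And>x. q \<le> x \<Longrightarrow> a' x = x + 1" "\<And>x. q \<le> x \<Longrightarrow> b' x = x + 1"
  shows "extends_to a b c' P S"
  unfolding extends_to_def using assms by blast

text \<open>
  Above \<open>m\<close> the new \<open>b'\<close> is chosen larger than both the identity and \<open>c'\<^sup>-\<^sup>1\<close>, up to a fixed point \<open>p\<close>. Then
  \<open>b'\<close> and \<open>d' = c' b'\<close> both push points towards \<open>p\<close>, and \<open>a\<close> extends to a conjugacy between them. Values of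
  \<open>b\<close> up to a common bound \<open>m\<close> of \<open>P\<close> and \<open>a P\<close> and of \<open>c\<close> up to \<open>b m\<close> are the ones that enter the old relation
  \<open>a b = c b a\<close> at points left of \<open>P\<close>.
\<close>
lemma extend_handle_up:
  assumes H: "line_homeo a" "line_homeo b" "line_homeo c'"
    and rel: "\<And>x. a (b x) = c (b (a x))"
    and P: "P \<le> m" "a P \<le> m"
    and b_up: "\<And>x. P \<le> x \<Longrightarrow> x \<le> m \<Longrightarrow> x < b x"
    and d_up: "\<And>x. a P \<le> x \<Longrightarrow> x \<le> m \<Longrightarrow> x < c (b x)"
    and c': "\<And>x. x \<le> b m \<Longrightarrow> c' x = c x" "\<And>x. S \<le> x \<Longrightarrow> c' x = x"
  shows "extends_to a b c' P S"
proof -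
  define M where "M = (\<lambda>x. max x (finv c' x))"
  have M: "line_homeo M" unfolding M_def using H by (intro line_homeo_max) auto
  \<comment> \<open>to the right of \<open>p\<close> the new commutator \<open>c'\<close> is the identity, so \<open>b'\<close> and \<open>c' b'\<close> coincide from there on\<close>
  define p where "p = max S (b m + 1)"
  have "m < b m" "m < c (b m)" using P b_up d_up by auto
  then have "M m < b m" using H c'(1)[of "b m"] by (simp add: M_def inv_less_iff)
  have p: "S \<le> p" "b m < p" "m < p" using \<open>m < b m\<close> by (simp_all add: p_def)
  have c'p: "c' x = x" "finv c' x = x" if "p \<le> x" for x
    using c'(2)[of x] p that H by (auto simp: inv_eq_iff)
  then have "M p = p" by (simp add: M_def)
  obtain t q where t: "line_homeo t" "p \<le> q" "\<And>x. x \<le> p \<Longrightarrow> t x = x" "\<And>x. q \<le> x \<Longrightarrow> t x = x + 1"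
    using interpolate_homeo[OF line_homeo_id(2) line_homeo_translation, of p 1] by metis
  have tp: "p \<le> t x" if "p \<le> x" for x using t that by (metis line_homeo_le order_refl)
  obtain b' where b': "line_homeo b'" "\<And>x. x \<le> m \<Longrightarrow> b' x = b x" "\<And>x. p \<le> x \<Longrightarrow> b' x = t x"
    "\<And>x. m \<le> x \<Longrightarrow> x < p \<Longrightarrow> M x < b' x"
    using extend_above_or_below[OF H(2) M t(1) \<open>M p = p\<close> _ \<open>m < p\<close> \<open>b m < p\<close>] t(3)[of p]
      \<open>M m < b m\<close> by (metis order_refl)
  have b'_up: "x < b' x" if "P \<le> x" "x < p" for x
    using that b_up[of x] b'(2)[of x] b'(4)[of x] by (cases "x \<le> m") (auto simp: M_def)
  have d'_up: "x < c' (b' x)" if "a P \<le> x" "x < p" for x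
  proof (cases "x \<le> m")
    case True
    then have "b x \<le> b m" using H by simp
    then show ?thesis using True d_up[of x] b'(2)[of x] c'(1)[of "b x"] that by simp
  next
    case False
    then have "finv c' x < b' x" using b'(4)[of x] that by (simp add: M_def)
    then show ?thesis using H by (simp add: inv_less_iff)
  qed
  have conj: "c' (b' (a (finv b' y))) = a y" if "y \<le> P" for y
  proof -
    define x where "x = finv b' y"
    have y: "y = b' x" using b' by (simp add: x_def)
    have "b' x < b' P" using b'_up[of P] P p that y by linarith
    then have x: "x < P" using b' by simp
    then have "a x < a P" using H by simp
    then have "a x \<le> m" "b' x = b x" using P b'(2)[of x] x by auto
    moreover from this have "b (a x) \<le> b m" using H by simp
    ultimately have "c' (b' (a x)) = a (b' x)"
      using b'(2)[of "a x"] c'(1)[of "b (a x)"] rel[of x] by simp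
    then show ?thesis unfolding y[symmetric] unfolding x_def .
  qed
  obtain a' where a': "line_homeo a'" "\<And>x. x \<le> P \<Longrightarrow> a' x = a x" "\<And>x. p \<le> x \<Longrightarrow> a' x = t x"
    "\<And>x. a' (b' x) = c' (b' (a' x))"
  proof (rule extend_conjugator[of a b' "\<lambda>x. c' (b' x)" t p P])
    show "t (b' x) = c' (b' (t x))" if "p \<le> x" for x
      using that b'(3)[of x] b'(3)[of "t x"] tp[of x] tp[of "t x"] c'p by simp
  qed (use H b' t p P c'p conj b'_up d'_up in auto)
  have moved: "a' x \<noteq> x \<or> b' x \<noteq> x" if "P \<le> x" "x < p" for x
    using b'_up[OF that] by simp
  have tails: "a' x = x + 1" "b' x = x + 1" if "q \<le> x" for x
    using that t(2) t(4)[of x] a'(3)[of x] b'(3)[of x] by simp_all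
  have old: "b' x = b x" if "x \<le> P" for x using that P b'(2)[of x] by simp
  show ?thesis
    by (rule extends_toI[OF a'(1) b'(1) p(1) a'(4) a'(2) old moved tails])
qed

text \<open>
  The mirror case: now \<open>b'\<close> lies below the identity and \<open>c'\<^sup>-\<^sup>1\<close>, and the conjugacy is propagated by the inverses
  of \<open>b'\<close> and \<open>c' b'\<close>, which push points towards \<open>p\<close>.
\<close>
lemma extend_handle_down:
  assumes H: "line_homeo a" "line_homeo b" "line_homeo c'"
    and rel: "\<And>x. a (b x) = c (b (a x))"
    and P: "P \<le> m" "a P \<le> m"
    and b_down: "\<And>x. P \<le> x \<Longrightarrow> x \<le> m \<Longrightarrow> b x < x"
    and d_down: "\<And>x. a P \<le> x \<Longrightarrow> x \<le> m \<Longrightarrow> c (b x) < x"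
    and c': "\<And>x. x \<le> b m \<Longrightarrow> c' x = c x" "\<And>x. S \<le> x \<Longrightarrow> c' x = x"
  shows "extends_to a b c' P S"
proof -
  define M where "M = (\<lambda>x. min x (finv c' x))"
  have M: "line_homeo M" unfolding M_def using H by (intro line_homeo_min) auto
  define p where "p = max S (m + 1)"
  have "b m < m" "c (b m) < m" using P b_down d_down by auto
  then have "b m < M m" using H c'(1)[of "b m"] by (simp add: M_def less_inv_iff)
  have p: "S \<le> p" "b m < p" "m < p" using \<open>b m < m\<close> by (simp_all add: p_def)
  have c'p: "c' x = x" "finv c' x = x" if "p \<le> x" for x
    using c'(2)[of x] p that H by (auto simp: inv_eq_iff)
  then have "M p = p" by (simp add: M_def)
  obtain t q where t: "line_homeo t" "p \<le> q" "\<And>x. x \<le> p \<Longrightarrow> t x = x" "\<And>x. q \<le> x \<Longrightarrow> t x = x + 1"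
    using interpolate_homeo[OF line_homeo_id(2) line_homeo_translation, of p 1] by metis
  have tp: "p \<le> t x" "p \<le> finv t x" if "p \<le> x" for x
    using t that by (metis line_homeo_le order_refl, simp add: le_inv_iff)
  obtain b' where b': "line_homeo b'" "\<And>x. x \<le> m \<Longrightarrow> b' x = b x" "\<And>x. p \<le> x \<Longrightarrow> b' x = t x"
    "\<And>x. m \<le> x \<Longrightarrow> x < p \<Longrightarrow> b' x < M x"
    using extend_above_or_below[OF H(2) M t(1) \<open>M p = p\<close> _ \<open>m < p\<close> \<open>b m < p\<close>] t(3)[of p]
      \<open>b m < M m\<close> by (metis order_refl)
  have b'_down: "b' x < x" if "P \<le> x" "x < p" for x
    using that b_down[of x] b'(2)[of x] b'(4)[of x] by (cases "x \<le> m") (auto simp: M_def)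
  have d'_down: "c' (b' x) < x" if "a P \<le> x" "x < p" for x
  proof (cases "x \<le> m")
    case True
    then have "b x \<le> b m" using H by simp
    then show ?thesis using True d_down[of x] b'(2)[of x] c'(1)[of "b x"] that by simp
  next
    case False
    then have "b' x < finv c' x" using b'(4)[of x] that by (simp add: M_def)
    then show ?thesis using H by (simp add: less_inv_iff)
  qed
  have b'p: "b' p = p" using b'(3)[of p] t(3)[of p] by simp
  have binv: "finv b' x = finv t x" if "p \<le> x" for x
    using that b' t tp(2)[of x] by (simp add: inv_eq_iff)
  have conj: "finv b' (finv c' (a (b' y))) = a y" if "y \<le> P" for y
  proof -
    have "a y \<le> m" "b' y = b y" using H P b'(2)[of y] that order_trans[of "a y" "a P" m] by auto
    moreover from this have "b (a y) \<le> b m" using H by simp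
    ultimately have "c' (b' (a y)) = a (b' y)"
      using b'(2)[of "a y"] c'(1)[of "b (a y)"] rel[of y] by simp
    then show ?thesis using H b' by (metis inv_left)
  qed
  obtain a' where a': "line_homeo a'" "\<And>x. x \<le> P \<Longrightarrow> a' x = a x" "\<And>x. p \<le> x \<Longrightarrow> a' x = t x"
    "\<And>x. a' (finv b' x) = finv b' (finv c' (a' x))"
  proof (rule extend_conjugator[of a "finv b'" "\<lambda>x. finv b' (finv c' x)" t p P])
    show "finv b' (finv c' (a (finv (finv b') y))) = a y" if "y \<le> P" for y
      using conj[OF that] b' by (simp add: inv_inv_eq line_homeo_bij)
    show "t (finv b' x) = finv b' (finv c' (t x))" if "p \<le> x" for x
      using that binv[of x] binv[of "t x"] tp[of x] c'p t by simp
    show "x < finv b' x" if "P \<le> x" "x < p" for x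
      using b'_down[OF that] b' by (simp add: less_inv_iff)
    show "x < finv b' (finv c' x)" if "a P \<le> x" "x < p" for x
      using d'_down[OF that] b' H by (simp add: less_inv_iff)
    show "finv b' p = p" "finv b' (finv c' p) = p"
      using b' b'p c'p by (simp_all add: inv_eq_iff)
  qed (use H b' t p P in auto)
  have rel': "a' (b' x) = c' (b' (a' x))" for x
    using a'(4)[of "b' x"] H b'(1) a'(1) by (simp add: inv_eq_iff)
  have moved: "a' x \<noteq> x \<or> b' x \<noteq> x" if "P \<le> x" "x < p" for x
    using b'_down[OF that] by simp
  have tails: "a' x = x + 1" "b' x = x + 1" if "q \<le> x" for x
    using that t(2) t(4)[of x] a'(3)[of x] b'(3)[of x] by simp_all
  have old: "b' x = b x" if "x \<le> P" for x using that P b'(2)[of x] by simp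
  show ?thesis
    by (rule extends_toI[OF a'(1) b'(1) p(1) rel' a'(2) old moved tails])
qed

text \<open>
  The region kept fixed may have to reach beyond \<open>N\<close>, up to some \<open>P\<close> dictated by the dynamics, and \<open>c'\<close> has to
  agree with the old commutator up to a bound \<open>L\<close> that may be larger still.
\<close>
definition handle_extends :: "(real \<Rightarrow> real) \<Rightarrow> (real \<Rightarrow> real) \<Rightarrow> (real \<Rightarrow> real) \<Rightarrow> real \<Rightarrow> bool" where
  "handle_extends a b c N \<longleftrightarrow> (\<exists>P\<ge>N. \<exists>L. \<forall>c' S. line_homeo c' \<longrightarrow>
    (\<forall>x\<le>L. c' x = c x) \<longrightarrow> (\<forall>x\<ge>S. c' x = x) \<longrightarrow> extends_to a b c' P S)"

text \<open>
  Exchanging the two elements of a handle inverts its commutator.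
\<close>
lemma extends_to_swap:
  assumes c': "line_homeo c'" and "extends_to b a (finv c') P S"
  shows "extends_to a b c' P S"
proof -
  obtain b' a' p q where E: "line_homeo b'" "line_homeo a'" "S \<le> p"
    and rel: "\<forall>x. b' (a' x) = finv c' (a' (b' x))" and old: "\<forall>x\<le>P. b' x = b x \<and> a' x = a x"
    and "\<forall>x. P \<le> x \<longrightarrow> x < p \<longrightarrow> b' x \<noteq> x \<or> a' x \<noteq> x" "\<forall>x\<ge>q. b' x = x + 1 \<and> a' x = x + 1"
    using assms(2) unfolding extends_to_def by (elim exE conjE) (rule that)
  moreover have "a' (b' x) = c' (b' (a' x))" for x
    using rel[rule_format, of x] c' by (simp add: inv_eq_iff)
  ultimately show ?thesis
    by (intro extends_toI[of a' b' S p c' P a b q]) blast+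
qed

lemma handle_extends_swap:
  assumes c: "line_homeo c" and "handle_extends b a (finv c) N"
  shows "handle_extends a b c N"
proof -
  obtain P L where PL: "N \<le> P" and ext: "\<forall>c' S. line_homeo c' \<longrightarrow> (\<forall>x\<le>L. c' x = finv c x) \<longrightarrow>
      (\<forall>x\<ge>S. c' x = x) \<longrightarrow> extends_to b a c' P S"
    using assms(2) unfolding handle_extends_def by (elim exE conjE) (rule that)
  show ?thesis
    unfolding handle_extends_def
  proof (rule exI[of _ P], rule conjI[OF PL], rule exI[of _ "finv c L"], intro allI impI)
    fix c' S assume c': "line_homeo c'" "\<forall>x\<le>finv c L. c' x = c x" "\<forall>x\<ge>S. c' x = x"
    have "finv c' x = finv c x" if "x \<le> L" for x
    proof -
      have "finv c x \<le> finv c L" using c that by simp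
      then have "c' (finv c x) = x" using c' c by simp
      then show ?thesis using c' by (simp add: inv_eq_iff)
    qed
    moreover have "finv c' x = x" if "S \<le> x" for x using c' that by (simp add: inv_eq_iff)
    ultimately show "extends_to a b c' P S"
      using ext c'(1) by (simp add: extends_to_swap)
  qed
qed

lemma handle_extends_dominated:
  assumes H: "line_homeo a" "line_homeo b"
    and rel: "\<And>x. a (b x) = c (b (a x))"
    and "N \<le> P" "P \<le> m" "a P \<le> m"
    and dom: "(\<forall>x\<in>{P..m}. x < b x) \<and> (\<forall>x\<in>{a P..m}. x < c (b x)) \<or>
      (\<forall>x\<in>{P..m}. b x < x) \<and> (\<forall>x\<in>{a P..m}. c (b x) < x)"
  shows "handle_extends a b c N"
  unfolding handle_extends_def
proof (rule exI[of _ P], rule conjI[OF \<open>N \<le> P\<close>], rule exI[of _ "b m"], intro allI impI)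
  fix c' S assume c': "line_homeo c'" "\<forall>x\<le>b m. c' x = c x" "\<forall>x\<ge>S. c' x = x"
  show "extends_to a b c' P S"
    using dom
  proof
    assume "(\<forall>x\<in>{P..m}. x < b x) \<and> (\<forall>x\<in>{a P..m}. x < c (b x))"
    then show ?thesis using c'(2,3)
      by (intro extend_handle_up[OF H c'(1) rel \<open>P \<le> m\<close> \<open>a P \<le> m\<close>]) simp_all
  next
    assume "(\<forall>x\<in>{P..m}. b x < x) \<and> (\<forall>x\<in>{a P..m}. c (b x) < x)"
    then show ?thesis using c'(2,3)
      by (intro extend_handle_down[OF H c'(1) rel \<open>P \<le> m\<close> \<open>a P \<le> m\<close>]) simp_all
  qed
qed

text \<open>
  If \<open>b\<close> fixes \<open>q\<close> then \<open>b\<close> maps the displacement \<open>q \<mapsto> a q\<close> to a displacement of \<open>q\<close> by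
  \<open>b a b\<^sup>-\<^sup>1 = c\<^sup>-\<^sup>1 a\<close> in the same direction. So \<open>a\<close> can serve as the base and \<open>b\<close> as the conjugator, with
  \<open>P = m = q\<close>.
\<close>
lemma handle_extends_at_fixed_point:
  assumes H: "line_homeo a" "line_homeo b" "line_homeo c"
    and rel: "\<And>x. a (b x) = c (b (a x))"
    and "N \<le> q" "b q = q" "a q \<noteq> q"
  shows "handle_extends a b c N"
proof (rule handle_extends_swap[OF H(3)], rule handle_extends_dominated[OF H(2,1)])
  show "b (a x) = finv c (a (b x))" for x unfolding rel using H by simp
  have e: "finv c (a q) = b (a q)" using rel[of q] H \<open>b q = q\<close> by (simp add: inv_eq_iff)
  have "a q < q \<and> b (a q) < b q \<or> q < a q \<and> b q < b (a q)" using H \<open>b q = q\<close> \<open>a q \<noteq> q\<close> by (meson line_homeo_less linorder_less_linear)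
  then show "(\<forall>x\<in>{q..q}. x < a x) \<and> (\<forall>x\<in>{b q..q}. x < finv c (a x)) \<or>
      (\<forall>x\<in>{q..q}. a x < x) \<and> (\<forall>x\<in>{b q..q}. finv c (a x) < x)"
    using \<open>b q = q\<close> e by auto
qed (use \<open>N \<le> q\<close> \<open>b q = q\<close> in auto)

lemma fixed_point_free_sign:
  assumes b: "line_homeo b" and nofix: "\<And>y. x \<le> y \<Longrightarrow> y \<le> m \<Longrightarrow> b y \<noteq> y"
  shows "(\<forall>y\<in>{x..m}. y < b y) \<or> (\<forall>y\<in>{x..m}. b y < y)"
proof -
  define f where "f = (\<lambda>y. b y - y)"
  have "connected (f ` {x..m})" unfolding f_def
    by (intro connected_continuous_image continuous_intros continuous_on_line_homeo b) auto
  moreover have "0 \<notin> f ` {x..m}" using nofix by (auto simp: f_def)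
  ultimately have "\<not> (f y < 0 \<and> 0 < f z)" if "y \<in> {x..m}" "z \<in> {x..m}" for y z
    using that connectedD_interval[of "f ` {x..m}" "f y" "f z" 0] by auto
  moreover have "f y \<noteq> 0" if "y \<in> {x..m}" for y using nofix[of y] that by (auto simp: f_def)
  ultimately have "(\<forall>y\<in>{x..m}. 0 < f y) \<or> (\<forall>y\<in>{x..m}. f y < 0)"
    by (meson linorder_neqE_linordered_idom)
  then show ?thesis by (simp add: f_def)
qed

text \<open>
  Unless the previous lemma applies, every fixed point of \<open>b\<close> to the right of \<open>N\<close> is fixed by \<open>a\<close>. No such
  point lies in \<open>[x, max (a x) (a\<^sup>-\<^sup>1 x)]\<close>, since \<open>b\<close> moves \<open>x\<close>, while a fixed point of \<open>a\<close> to the right of \<open>x\<close>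
  is also to the right of \<open>a x\<close> and \<open>a\<^sup>-\<^sup>1 x\<close>. So \<open>b\<close> has constant sign there, and hence so has \<open>a b a\<^sup>-\<^sup>1\<close>
  on the image under \<open>a\<close>.
\<close>
lemma handle_extends_if_moved:
  assumes H: "line_homeo a" "line_homeo b" "line_homeo c"
    and rel: "\<And>x. a (b x) = c (b (a x))"
    and "N \<le> x" "b x \<noteq> x"
  shows "handle_extends a b c N"
proof (cases "\<exists>q\<ge>N. b q = q \<and> a q \<noteq> q")
  case True
  then show ?thesis using handle_extends_at_fixed_point[OF H rel] by blast
next
  case False
  define m where "m = max x (a x)"
  have nofix: "b y \<noteq> y" if "x \<le> y" "y \<le> max m (finv a m)" for y
  proof
    assume "b y = y"
    then have "a y = y" "x < y" using False that \<open>N \<le> x\<close> \<open>b x \<noteq> x\<close> by (auto simp: less_le)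
    moreover have "a x < a y" using \<open>x < y\<close> H by simp
    moreover have "finv a m = max (finv a x) x"
      using H by (cases "x \<le> a x") (simp_all add: m_def max_def inv_le_iff)
    then have "y \<le> max x (max (a x) (finv a x))" using that by (auto simp: m_def)
    moreover have "finv a x < y" using \<open>x < y\<close> \<open>a y = y\<close> H by (simp add: inv_less_iff)
    ultimately show False by auto
  qed
  have d: "c (b y) = a (b (finv a y))" for y using rel[of "finv a y"] H by simp
  have ay: "x \<le> finv a y" "finv a y \<le> finv a m" if "a x \<le> y" "y \<le> m" for y
    using that H by (simp_all add: le_inv_iff)
  consider "\<forall>y\<in>{x..max m (finv a m)}. y < b y" | "\<forall>y\<in>{x..max m (finv a m)}. b y < y"
    using fixed_point_free_sign[OF H(2), of x "max m (finv a m)"] nofix by blast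
  then have "(\<forall>y\<in>{x..m}. y < b y) \<and> (\<forall>y\<in>{a x..m}. y < c (b y)) \<or>
      (\<forall>y\<in>{x..m}. b y < y) \<and> (\<forall>y\<in>{a x..m}. c (b y) < y)"
  proof cases
    case 1
    have "y < c (b y)" if "a x \<le> y" "y \<le> m" for y
    proof -
      have "finv a y < b (finv a y)" using 1 ay[OF that] by auto
      then show ?thesis using d[of y] H by (simp add: inv_less_iff)
    qed
    then show ?thesis using 1 by auto
  next
    case 2
    have "c (b y) < y" if "a x \<le> y" "y \<le> m" for y
    proof -
      have "b (finv a y) < finv a y" using 2 ay[OF that] by auto
      then show ?thesis using d[of y] H by (simp add: less_inv_iff)
    qed
    then show ?thesis using 2 by auto
  qed
  then show ?thesis
    by (intro handle_extends_dominated[OF H(1,2) rel \<open>N \<le> x\<close>, of m]) (auto simp: m_def)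
qed

lemma handle_extends_if_not_fixed:
  assumes H: "line_homeo a" "line_homeo b" "line_homeo c"
    and rel: "\<And>x. a (b x) = c (b (a x))"
    and "N \<le> x" "a x \<noteq> x \<or> b x \<noteq> x"
  shows "handle_extends a b c N"
proof (cases "b x = x")
  case True
  then show ?thesis using handle_extends_at_fixed_point[OF H rel] assms by blast
qed (use handle_extends_if_moved[OF H rel] assms in blast)

section \<open>Truncation to translations\<close>

definition homeo_commutator :: "(real \<Rightarrow> real) \<Rightarrow> (real \<Rightarrow> real) \<Rightarrow> real \<Rightarrow> real" where
  "homeo_commutator a b = a \<circ> b \<circ> finv a \<circ> finv b"

definition commutator_product :: "(nat \<Rightarrow> real \<Rightarrow> real) \<Rightarrow> (nat \<Rightarrow> real \<Rightarrow> real) \<Rightarrow> nat list \<Rightarrow> real \<Rightarrow> real" where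
  "commutator_product a b js = foldr (\<lambda>j f. homeo_commutator (a j) (b j) \<circ> f) js id"

lemma commutator_product_simps [simp]:
  "commutator_product a b [] = id"
  "commutator_product a b (j # js) = homeo_commutator (a j) (b j) \<circ> commutator_product a b js"
  by (simp_all add: commutator_product_def)

lemma commutator_product_append:
  "commutator_product a b (is @ js) = commutator_product a b is \<circ> commutator_product a b js"
  by (induction "is") (simp_all add: comp_assoc)

lemma commutator_product_cong:
  "(\<And>j. j \<in> set js \<Longrightarrow> a j = a' j \<and> b j = b' j) \<Longrightarrow> commutator_product a b js = commutator_product a' b' js"
  by (induction js) simp_all

lemma line_homeo_commutator [simp]:
  "line_homeo a \<Longrightarrow> line_homeo b \<Longrightarrow> line_homeo (homeo_commutator a b)"
  by (simp add: homeo_commutator_def)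

lemma line_homeo_commutator_product:
  "(\<And>j. j \<in> set js \<Longrightarrow> line_homeo (a j) \<and> line_homeo (b j)) \<Longrightarrow> line_homeo (commutator_product a b js)"
  by (induction js) simp_all

text \<open>
  Convergence that is eventually exact on every left half-line. Unlike equality up to a fixed bound it is
  compatible with composition and inversion without keeping track of bounds.
\<close>
definition agree_far :: "(real \<Rightarrow> real \<Rightarrow> real) \<Rightarrow> (real \<Rightarrow> real) \<Rightarrow> bool" where
  "agree_far F f \<longleftrightarrow> (\<forall>L. \<forall>\<^sub>F R in at_top. \<forall>x\<le>L. F R x = f x)"

lemma agree_far_compose:
  assumes h: "line_homeo h" and "agree_far F f" "agree_far G h"
  shows "agree_far (\<lambda>R. F R \<circ> G R) (f \<circ> h)"
  unfolding agree_far_def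
proof
  fix L
  have "\<forall>\<^sub>F R in at_top. \<forall>x\<le>L. G R x = h x" "\<forall>\<^sub>F R in at_top. \<forall>x\<le>h L. F R x = f x"
    using assms unfolding agree_far_def by blast+
  then show "\<forall>\<^sub>F R in at_top. \<forall>x\<le>L. (F R \<circ> G R) x = (f \<circ> h) x"
    by eventually_elim (use h in auto)
qed

lemma agree_far_inv:
  assumes f: "line_homeo f" "\<And>R. line_homeo (F R)" and "agree_far F f"
  shows "agree_far (\<lambda>R. finv (F R)) (finv f)"
  unfolding agree_far_def
proof
  fix L
  have "\<forall>\<^sub>F R in at_top. \<forall>x\<le>finv f L. F R x = f x"
    using assms unfolding agree_far_def by blast
  then show "\<forall>\<^sub>F R in at_top. \<forall>x\<le>L. finv (F R) x = finv f x"
    by eventually_elim (use f in \<open>auto simp: inv_eq_iff\<close>)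
qed

lemma agree_far_commutator_product:
  assumes "\<And>j. j \<in> set js \<Longrightarrow> line_homeo (a j) \<and> line_homeo (b j)"
    and "\<And>j R. j \<in> set js \<Longrightarrow> line_homeo (A R j) \<and> line_homeo (B R j)"
    and "\<And>j. j \<in> set js \<Longrightarrow> agree_far (\<lambda>R. A R j) (a j) \<and> agree_far (\<lambda>R. B R j) (b j)"
  shows "agree_far (\<lambda>R. commutator_product (A R) (B R) js) (commutator_product a b js)"
  using assms
proof (induction js)
  case Nil
  then show ?case by (simp add: agree_far_def)
next
  case (Cons j js)
  then show ?case
    unfolding commutator_product_simps homeo_commutator_def
    by (intro agree_far_compose agree_far_inv line_homeo_compose(2) line_homeo_inv
        line_homeo_commutator_product) auto
qed

text \<open>
  Commuting translations near \<open>+\<infinity>\<close> have trivial commutator, once \<open>x\<close> is far enough to the right for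
  \<open>b\<^sup>-\<^sup>1\<close> and \<open>a\<^sup>-\<^sup>1\<close> not to leave the half-line where this is known.
\<close>
lemma commutator_product_tail:
  assumes "\<And>j. j \<in> set js \<Longrightarrow> line_homeo (a j) \<and> line_homeo (b j)"
    and "\<And>j x. j \<in> set js \<Longrightarrow> S \<le> x \<Longrightarrow> a j x = x + 1 \<and> b j x = x + 1"
    and "S + 2 \<le> x"
  shows "commutator_product a b js x = x"
  using assms(1,2)
proof (induction js)
  case (Cons j js)
  have H: "line_homeo (a j)" "line_homeo (b j)" using Cons.prems by auto
  have t: "a j y = y + 1" "b j y = y + 1" if "S \<le> y" for y using Cons.prems(2) that by auto
  have "finv (b j) x = x - 1" using t(2)[of "x - 1"] \<open>S + 2 \<le> x\<close> H by (simp add: inv_eq_iff)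
  moreover have "finv (a j) (x - 1) = x - 2" using t(1)[of "x - 2"] \<open>S + 2 \<le> x\<close> H by (simp add: inv_eq_iff)
  ultimately have "homeo_commutator (a j) (b j) x = x"
    using t[of "x - 2"] t[of "x - 1"] \<open>S + 2 \<le> x\<close> by (simp add: homeo_commutator_def)
  then show ?case using Cons by simp
qed simp

text \<open>
  The handle \<open>i\<close> moving \<open>N\<close> is reserved to restore the relation; the others are cut off by translations
  beyond a large \<open>R\<close>. Writing the relation as \<open>X [a\<^sub>i, b\<^sub>i] Y = 1\<close>, the new commutator of handle \<open>i\<close> has to be
  \<open>X'\<^sup>-\<^sup>1 Y'\<^sup>-\<^sup>1\<close>. No global fixed point arises: up to \<open>P\<close> nothing has changed, up to \<open>p\<close> handle \<open>i\<close> moves every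
  point, and from there on any other handle acts by translations.
\<close>
proposition truncate_to_translations:
  fixes a b :: "nat \<Rightarrow> real \<Rightarrow> real"
  assumes "2 \<le> g" and H: "\<And>j. j < g \<Longrightarrow> line_homeo (a j) \<and> line_homeo (b j)"
    and rel: "commutator_product a b [0..<g] = id"
    and nofix: "\<And>x. \<exists>j<g. a j x \<noteq> x \<or> b j x \<noteq> x"
  shows "\<exists>a' b' q. (\<forall>j<g. line_homeo (a' j) \<and> line_homeo (b' j)) \<and>
    commutator_product a' b' [0..<g] = id \<and> (\<forall>x. \<exists>j<g. a' j x \<noteq> x \<or> b' j x \<noteq> x) \<and>
    (\<forall>j<g. \<forall>x\<le>N. a' j x = a j x \<and> b' j x = b j x) \<and>
    (\<forall>j<g. \<forall>x\<ge>q. a' j x = x + 1 \<and> b' j x = x + 1)"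
proof -
  obtain i where i: "i < g" "a i N \<noteq> N \<or> b i N \<noteq> N" using nofix by blast
  define pre where "pre = [0..<i]"
  define post where "post = [Suc i..<g]"
  have split: "[0..<g] = pre @ i # post"
    unfolding pre_def post_def using i(1) upt_add_eq_append[of 0 i "g - i"] by (simp add: upt_conv_Cons)
  have pre: "j < g" "j \<noteq> i" if "j \<in> set pre" for j using that i by (auto simp: pre_def)
  have post: "j < g" "j \<noteq> i" if "j \<in> set post" for j using that by (auto simp: post_def)
  define X where "X = commutator_product a b pre"
  define Y where "Y = commutator_product a b post"
  define c where "c = homeo_commutator (a i) (b i)"
  have HX: "line_homeo X" and HY: "line_homeo Y" and Hc: "line_homeo c"
    unfolding X_def Y_def c_def using H pre post i
    by (simp_all add: line_homeo_commutator_product)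
  have Hi: "line_homeo (a i)" "line_homeo (b i)" using H i by auto
  have XcY: "X (c (Y y)) = y" for y
    using fun_cong[OF rel, of y] by (simp add: split commutator_product_append X_def Y_def c_def)
  have c_eq: "c = finv X \<circ> finv Y"
  proof
    fix w
    have "X (c w) = finv Y w" using XcY[of "finv Y w"] HY by simp
    then show "c w = (finv X \<circ> finv Y) w" using inv_left[OF HX, of "c w"] by simp
  qed
  have "handle_extends (a i) (b i) c N"
    using i(2) by (intro handle_extends_if_not_fixed[OF Hi Hc, of N N])
      (simp_all add: c_def homeo_commutator_def Hi)
  then obtain P L where "N \<le> P" and ext: "\<forall>c' S. line_homeo c' \<longrightarrow> (\<forall>x\<le>L. c' x = c x) \<longrightarrow>
      (\<forall>x\<ge>S. c' x = x) \<longrightarrow> extends_to (a i) (b i) c' P S"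
    unfolding handle_extends_def by (elim exE conjE) (rule that)
  define cut where "cut = (\<lambda>R f. SOME k. line_homeo k \<and> (\<forall>x\<le>R. k x = f x) \<and> (\<exists>S. \<forall>x\<ge>S. k x = x + (1::real)))"
  have cut: "line_homeo (cut R f) \<and> (\<forall>x\<le>R. cut R f x = f x) \<and> (\<exists>S. \<forall>x\<ge>S. cut R f x = x + 1)"
    if "line_homeo f" for f R
  proof -
    have "\<exists>k. line_homeo k \<and> (\<forall>x\<le>R. k x = f x) \<and> (\<exists>S. \<forall>x\<ge>S. k x = x + 1)"
      using interpolate_homeo[OF that line_homeo_translation, of R 1] by blast
    from someI_ex[OF this] show ?thesis unfolding cut_def .
  qed
  define A where "A = (\<lambda>R j. cut R (a j))"
  define B where "B = (\<lambda>R j. cut R (b j))"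
  have A: "line_homeo (A R j)" "\<forall>x\<le>R. A R j x = a j x" "\<exists>S. \<forall>x\<ge>S. A R j x = x + 1"
    and B: "line_homeo (B R j)" "\<forall>x\<le>R. B R j x = b j x" "\<exists>S. \<forall>x\<ge>S. B R j x = x + 1"
    if "j < g" for R j
    using cut[of "a j" R] cut[of "b j" R] H[OF that] by (simp_all add: A_def B_def)
  have far: "agree_far (\<lambda>R. A R j) (a j)" "agree_far (\<lambda>R. B R j) (b j)" if "j < g" for j
    unfolding agree_far_def using A(2)[OF that] B(2)[OF that]
    by (blast intro: eventually_mono[OF eventually_ge_at_top] order_trans)+
  define X' where "X' = (\<lambda>R. commutator_product (A R) (B R) pre)"
  define Y' where "Y' = (\<lambda>R. commutator_product (A R) (B R) post)"
  have HX': "line_homeo (X' R)" and HY': "line_homeo (Y' R)" for R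
    unfolding X'_def Y'_def using A(1) B(1) pre post by (simp_all add: line_homeo_commutator_product)
  have "agree_far X' X" "agree_far Y' Y"
    unfolding X'_def Y'_def X_def Y_def
    using A(1) B(1) far H pre post by (auto intro!: agree_far_commutator_product)
  then have "agree_far (\<lambda>R. finv (X' R) \<circ> finv (Y' R)) c"
    unfolding c_eq using HX HY HX' HY' by (intro agree_far_compose agree_far_inv) auto
  \<comment> \<open>truncating the other handles far enough to the right keeps \<open>c\<close> up to \<open>L\<close> and everything up to \<open>P\<close>\<close>
  then have "\<forall>\<^sub>F R in at_top. P \<le> R \<and> (\<forall>x\<le>L. (finv (X' R) \<circ> finv (Y' R)) x = c x)"
    unfolding agree_far_def by (intro eventually_conj eventually_ge_at_top) blast
  then obtain R where "P \<le> R" and R: "\<forall>x\<le>L. (finv (X' R) \<circ> finv (Y' R)) x = c x"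
    using eventually_happens'[OF trivial_limit_at_top_linorder] by blast
  define c' where "c' = finv (X' R) \<circ> finv (Y' R)"
  have "\<forall>\<^sub>F x in at_top. \<forall>j\<in>{..<g}. A R j x = x + 1 \<and> B R j x = x + 1"
    by (intro eventually_ball_finite ballI eventually_conj)
      (use A(3) B(3) in \<open>auto simp: eventually_at_top_linorder\<close>)
  then obtain S where S: "A R j x = x + 1" "B R j x = x + 1" if "S \<le> x" "j < g" for x j
    unfolding eventually_at_top_linorder by auto
  have "X' R x = x" "Y' R x = x" if "S + 2 \<le> x" for x
    unfolding X'_def Y'_def using A(1) B(1) S pre post that
    by (auto intro!: commutator_product_tail[where S = S])
  then have "finv (X' R) x = x" "finv (Y' R) x = x" if "S + 2 \<le> x" for x
    using HX' HY' that by (simp_all add: inv_eq_iff)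
  then have "\<forall>x\<ge>S + 2. c' x = x" by (simp add: c'_def)
  moreover have "line_homeo c'" using HX' HY' by (simp add: c'_def)
  ultimately have "extends_to (a i) (b i) c' P (S + 2)"
    using ext R unfolding c'_def by blast
  then obtain a' b' p q where H': "line_homeo a'" "line_homeo b'" and "S + 2 \<le> p"
    and rel': "\<forall>x. a' (b' x) = c' (b' (a' x))" and old: "\<forall>x\<le>P. a' x = a i x \<and> b' x = b i x"
    and moved: "\<forall>x. P \<le> x \<longrightarrow> x < p \<longrightarrow> a' x \<noteq> x \<or> b' x \<noteq> x" and tail: "\<forall>x\<ge>q. a' x = x + 1 \<and> b' x = x + 1"
    unfolding extends_to_def by (elim exE conjE) (rule that)
  define a'' where "a'' = (A R)(i := a')"
  define b'' where "b'' = (B R)(i := b')"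
  have other: "a'' j = A R j" "b'' j = B R j" if "j \<noteq> i" for j using that by (auto simp: a''_def b''_def)
  have at_i: "a'' i = a'" "b'' i = b'" by (auto simp: a''_def b''_def)
  have old'': "a'' j x = a j x" "b'' j x = b j x" if "x \<le> P" "j < g" for j x
    using that old A(2)[of j R] B(2)[of j R] \<open>P \<le> R\<close> by (cases "j = i"; simp add: other at_i)+
  have comm: "homeo_commutator a' b' = c'"
    using rel' H' by (auto simp: homeo_commutator_def fun_eq_iff)
  have "commutator_product a'' b'' pre = X' R" "commutator_product a'' b'' post = Y' R"
    unfolding X'_def Y'_def using other pre post by (auto intro!: commutator_product_cong)
  then have "commutator_product a'' b'' [0..<g] = X' R \<circ> c' \<circ> Y' R"
    by (simp add: split commutator_product_append at_i comm comp_assoc)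
  also have "\<dots> = id" using HX' HY' by (auto simp: c'_def fun_eq_iff)
  finally have "commutator_product a'' b'' [0..<g] = id" .
  moreover have "line_homeo (a'' j) \<and> line_homeo (b'' j)" if "j < g" for j
    using that A(1) B(1) H' by (cases "j = i") (auto simp: other at_i)
  moreover have "\<exists>j<g. a'' j x \<noteq> x \<or> b'' j x \<noteq> x" for x
  proof -
    consider "x \<le> P" | "P \<le> x" "x < p" | "p \<le> x" by linarith
    then show ?thesis
    proof cases
      case 1
      then show ?thesis using nofix[of x] old'' by metis
    next
      case 2
      then show ?thesis using moved i(1) at_i by metis
    next
      case 3
      define j where "j = (if i = 0 then 1 else 0 :: nat)"
      have "j < g" "j \<noteq> i" using \<open>2 \<le> g\<close> by (auto simp: j_def)
      then have "a'' j x = x + 1" using S(1)[of x j] 3 \<open>S + 2 \<le> p\<close> by (simp add: other)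
      then show ?thesis using \<open>j < g\<close> by (intro exI[of _ j]) simp
    qed
  qed
  moreover have "a'' j x = x + 1 \<and> b'' j x = x + 1" if "max S q \<le> x" "j < g" for j x
    using that S[of x j] tail by (cases "j = i") (auto simp: other at_i)
  ultimately show ?thesis
    using old'' \<open>N \<le> P\<close> by (intro exI[of _ a''] exI[of _ b''] exI[of _ "max S q"]) simp
qed

section \<open>Representations of a surface group\<close>

definition surface_word :: "('g, 'm) monoid_scheme \<Rightarrow> (nat \<Rightarrow> 'g) \<Rightarrow> (nat \<Rightarrow> 'g) \<Rightarrow> nat list \<Rightarrow> 'g" where
  "surface_word G \<alpha> \<beta> js =
    foldr (\<lambda>j x. \<alpha> j \<otimes>\<^bsub>G\<^esub> \<beta> j \<otimes>\<^bsub>G\<^esub> inv\<^bsub>G\<^esub> \<alpha> j \<otimes>\<^bsub>G\<^esub> inv\<^bsub>G\<^esub> \<beta> j \<otimes>\<^bsub>G\<^esub> x) js \<one>\<^bsub>G\<^esub>"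

lemma surface_word_simps [simp]:
  "surface_word G \<alpha> \<beta> [] = \<one>\<^bsub>G\<^esub>"
  "surface_word G \<alpha> \<beta> (j # js) =
    \<alpha> j \<otimes>\<^bsub>G\<^esub> \<beta> j \<otimes>\<^bsub>G\<^esub> inv\<^bsub>G\<^esub> \<alpha> j \<otimes>\<^bsub>G\<^esub> inv\<^bsub>G\<^esub> \<beta> j \<otimes>\<^bsub>G\<^esub> surface_word G \<alpha> \<beta> js"
  by (simp_all add: surface_word_def)

lemma (in group) surface_word_snoc:
  assumes "\<forall>j\<in>insert k (set js). a j \<in> carrier G \<and> b j \<in> carrier G"
  shows "surface_word G a b js \<in> carrier G \<and>
    surface_word G a b (js @ [k]) = surface_word G a b js \<otimes> (a k \<otimes> b k \<otimes> inv a k \<otimes> inv b k)"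
  using assms
proof (induction js)
  case (Cons i js)
  then have "surface_word G a b js \<in> carrier G \<and>
      surface_word G a b (js @ [k]) = surface_word G a b js \<otimes> (a k \<otimes> b k \<otimes> inv a k \<otimes> inv b k)"
    by simp
  moreover have "a i \<in> carrier G" "b i \<in> carrier G" "a k \<in> carrier G" "b k \<in> carrier G"
    using Cons.prems by auto
  ultimately show ?case by (simp add: m_assoc)
qed (auto simp: m_assoc)

text \<open>
  The presentation by standard generators, in the form in which it is used: generation, one relation, and
  extension of admissible tuples of line homeomorphisms to homomorphisms.
\<close>
locale surface_group = group G for G (structure) +
  fixes g :: nat and \<alpha> \<beta> :: "nat \<Rightarrow> 'a"
  assumes gen_closed: "j < g \<Longrightarrow> \<alpha> j \<in> carrier G" "j < g \<Longrightarrow> \<beta> j \<in> carrier G"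
    and generated: "subgroup K G \<Longrightarrow> (\<And>j. j < g \<Longrightarrow> \<alpha> j \<in> K \<and> \<beta> j \<in> K) \<Longrightarrow> carrier G \<subseteq> K"
    and relation: "surface_word G \<alpha> \<beta> [0..<g] = \<one>"
    and universal: "(\<And>j. j < g \<Longrightarrow> a j \<in> carrier Homeo_plus \<and> b j \<in> carrier Homeo_plus) \<Longrightarrow>
      surface_word Homeo_plus a b [0..<g] = \<one>\<^bsub>Homeo_plus\<^esub> \<Longrightarrow>
      \<exists>\<phi>\<in>hom G Homeo_plus. \<forall>j<g. \<phi> (\<alpha> j) = a j \<and> \<phi> (\<beta> j) = b j"

lemma hom_surface_word:
  assumes "group G" "group H" "\<phi> \<in> hom G H" "\<And>j. j \<in> set js \<Longrightarrow> \<alpha> j \<in> carrier G \<and> \<beta> j \<in> carrier G"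
  shows "surface_word G \<alpha> \<beta> js \<in> carrier G \<and>
    \<phi> (surface_word G \<alpha> \<beta> js) = surface_word H (\<phi> \<circ> \<alpha>) (\<phi> \<circ> \<beta>) js"
proof -
  interpret group_hom G H \<phi> using assms by (simp add: group_hom_def group_hom_axioms_def)
  show ?thesis using assms(4) by (induction js) auto
qed

lemma Homeo_plus_simps [simp]:
  "f \<otimes>\<^bsub>Homeo_plus\<^esub> h = f \<circ> h" "\<one>\<^bsub>Homeo_plus\<^esub> = id"
  by (simp_all add: Homeo_plus_def)

lemma inv_Homeo_plus: "line_homeo f \<Longrightarrow> inv\<^bsub>Homeo_plus\<^esub> f = finv f"
  by (rule group.inv_equality[OF group_Homeo_plus]) (auto simp: carrier_Homeo_plus fun_eq_iff)

lemma surface_word_Homeo_plus: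
  assumes "\<And>j. j \<in> set js \<Longrightarrow> line_homeo (a j) \<and> line_homeo (b j)"
  shows "surface_word Homeo_plus a b js = commutator_product a b js"
  using assms by (induction js) (auto simp: inv_Homeo_plus homeo_commutator_def comp_assoc)

lemma limitin_topology_generated_by:
  assumes "l \<in> \<Union>S" and "\<And>U. U \<in> S \<Longrightarrow> l \<in> U \<Longrightarrow> \<forall>\<^sub>F n in F. f n \<in> U"
  shows "limitin (topology_generated_by S) f l F"
proof -
  have "l \<in> U \<longrightarrow> (\<forall>\<^sub>F n in F. f n \<in> U)" if "generate_topology_on S U" for U
    using that
  proof induction
    case (Int a b)
    then show ?case by (auto intro: eventually_conj)
  next
    case (UN K)
    show ?case
    proof
      assume "l \<in> \<Union>K"
      then obtain X where "X \<in> K" "l \<in> X" by blast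
      then have "\<forall>\<^sub>F n in F. f n \<in> X" using UN by blast
      then show "\<forall>\<^sub>F n in F. f n \<in> \<Union>K" by eventually_elim (use \<open>X \<in> K\<close> in blast)
    qed
  qed (use assms(2) in auto)
  then show ?thesis
    using assms(1) by (auto simp: limitin_def topology_generated_by_topspace openin_topology_generated_by_iff)
qed

lemma Union_compact_open_subbase:
  "\<Union>{{f :: 'a::topological_space \<Rightarrow> 'b::topological_space. f ` K \<subseteq> U} | K U. compact K \<and> open U} = UNIV"
proof -
  have "UNIV \<in> {{f :: 'a \<Rightarrow> 'b. f ` K \<subseteq> U} | K U. compact K \<and> open U}"
    by (rule CollectI, rule exI[of _ "{}"], rule exI[of _ UNIV]) simp
  then show ?thesis by blast
qed

lemma limitin_Homeo_plus_topology:
  assumes "line_homeo f" "\<And>n. line_homeo (F n)"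
    and agree: "\<And>L. \<forall>\<^sub>F n in net. \<forall>x\<in>{-L..L}. F n x = f x"
  shows "limitin Homeo_plus_topology F f net"
proof -
  have "limitin compact_open_topology F f net"
    unfolding compact_open_topology_def
  proof (rule limitin_topology_generated_by)
    fix W assume "W \<in> {{f. f ` K \<subseteq> U} | K U. compact K \<and> open U}" "f \<in> W"
    then obtain K U where W: "W = {f. f ` K \<subseteq> U}" "compact K" by blast
    then obtain L where "\<forall>x\<in>K. \<bar>x\<bar> \<le> L"
      using compact_imp_bounded bounded_real by metis
    then have K: "K \<subseteq> {-L..L}" by (auto simp: abs_le_iff minus_le_iff)
    show "\<forall>\<^sub>F n in net. F n \<in> W"
      using agree[of L]
    proof eventually_elim
      case (elim n)
      then have "F n ` K = f ` K" using K by (intro image_cong) auto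
      then show ?case using \<open>f \<in> W\<close> W by simp
    qed
  qed (simp add: Union_compact_open_subbase)
  then show ?thesis
    using assms by (simp add: Homeo_plus_topology_def limitin_subtopology carrier_Homeo_plus)
qed

lemma line_homeo_translation_conjugate:
  assumes f: "line_homeo f" shows "line_homeo (\<lambda>x. f (x + t) - t)"
  using line_homeo_compose(1)[OF line_homeo_translation[of "-t"] line_homeo_compose(1)[OF f line_homeo_translation[of t]]]
  by simp

lemma continuous_map_translation_conjugate:
  assumes f: "line_homeo f"
  shows "continuous_map euclideanreal Homeo_plus_topology (\<lambda>t x. f (x + t) - t)"
proof -
  have "open {t. (\<lambda>x. f (x + t) - t) ` K \<subseteq> U}" if "compact K" "open U" for K U
  proof -
    have "continuous_on UNIV (\<lambda>z. f (fst z + snd z) - snd z)"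
      by (intro continuous_intros continuous_on_compose2[OF continuous_on_line_homeo[OF f, of UNIV]]) auto
    then have "closed ((\<lambda>z. f (fst z + snd z) - snd z) -` (- U))"
      using that(2) by (intro closed_vimage) auto
    then have "closed {t. \<exists>x. x \<in> K \<and> (x, t) \<in> (\<lambda>z. f (fst z + snd z) - snd z) -` (- U)}"
      by (rule closed_compact_projection[OF that(1)])
    then show ?thesis by (rule back_subst[of "\<lambda>S. open S", OF open_Compl]) auto
  qed
  moreover have "(\<lambda>x. f (x + t) - t) \<in> carrier Homeo_plus" for t
    using line_homeo_translation_conjugate[OF f] by (simp add: carrier_Homeo_plus)
  ultimately show ?thesis
    unfolding Homeo_plus_topology_def compact_open_topology_def
    by (auto simp: continuous_map_in_subtopology continuous_on_generated_topo_iff vimage_def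
        Union_compact_open_subbase)
qed


lemma RepD:
  assumes "\<rho> \<in> Rep G"
  shows "x \<in> carrier G \<Longrightarrow> line_homeo (\<rho> x)"
    and "x \<in> carrier G \<Longrightarrow> y \<in> carrier G \<Longrightarrow> \<rho> (x \<otimes>\<^bsub>G\<^esub> y) z = \<rho> x (\<rho> y z)"
  using assms by (auto simp: Rep_def hom_def carrier_Homeo_plus Pi_iff)

lemma (in group) Rep_one: "\<rho> \<in> Rep G \<Longrightarrow> \<rho> \<one> x = x"
  using RepD(2)[of \<rho> G \<one> \<one> x] RepD(1)[of \<rho> G \<one>] by (metis line_homeo_eq one_closed r_one)

lemma (in group) Rep_inv:
  assumes "\<rho> \<in> Rep G" "x \<in> carrier G"
  shows "\<rho> (inv x) y = finv (\<rho> x) y"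
proof -
  have "\<rho> x (\<rho> (inv x) y) = y" using RepD(2)[OF assms(1,2), of "inv x" y] Rep_one[OF assms(1)] assms(2) by simp
  then show ?thesis using inv_left[OF RepD(1)[OF assms]] by metis
qed

context surface_group
begin

text \<open>
  Group elements whose values agree eventually on every bounded interval form a subgroup, because
  homeomorphisms map bounded intervals into bounded intervals.
\<close>
lemma agree_on_generators_imp_limitin:
  assumes \<rho>: "\<rho> \<in> Rep_sharp G" and R: "\<And>n. R n \<in> Rep_sharp G"
    and agree: "\<And>j L. j < g \<Longrightarrow> \<forall>\<^sub>F n in net. \<forall>x\<in>{-L..L}.
      R n (\<alpha> j) x = \<rho> (\<alpha> j) x \<and> R n (\<beta> j) x = \<rho> (\<beta> j) x"
  shows "limitin (Rep_sharp_topology G) R \<rho> net"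
proof -
  have Rep: "\<rho> \<in> Rep G" "R n \<in> Rep G" for n using \<rho> R by (auto simp: Rep_sharp_def)
  define K where "K = {h \<in> carrier G. \<forall>L. \<forall>\<^sub>F n in net. \<forall>x\<in>{-L..L}. R n h x = \<rho> h x}"
  have bounded: "\<exists>M. \<forall>x\<in>{-L..L}. f x \<in> {-M..M}" if f: "line_homeo f" for f L
  proof (intro exI ballI)
    fix x assume "x \<in> {-L..L}"
    then have "f (-L) \<le> f x" "f x \<le> f L" using f by auto
    then show "f x \<in> {-max \<bar>f (-L)\<bar> \<bar>f L\<bar>..max \<bar>f (-L)\<bar> \<bar>f L\<bar>}" by auto
  qed
  have "subgroup K G"
  proof (rule subgroupI)
    show "K \<noteq> {}" using Rep_one[OF Rep(1)] Rep_one[OF Rep(2)] by (auto simp: K_def intro!: exI[of _ \<one>])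
  next
    fix h assume h: "h \<in> K"
    then have hc: "h \<in> carrier G" by (simp add: K_def)
    have "\<forall>\<^sub>F n in net. \<forall>x\<in>{-L..L}. R n (inv h) x = \<rho> (inv h) x" for L
    proof -
      obtain M where M: "\<forall>x\<in>{-L..L}. finv (\<rho> h) x \<in> {-M..M}"
        using bounded[of "finv (\<rho> h)" L] RepD(1)[OF Rep(1) hc] by auto
      have "\<forall>\<^sub>F n in net. \<forall>x\<in>{-M..M}. R n h x = \<rho> h x" using h by (simp add: K_def)
      then show ?thesis
      proof eventually_elim
        case (elim n)
        show ?case
        proof
          fix x assume "x \<in> {-L..L}"
          then have "R n h (finv (\<rho> h) x) = x"
            using elim M RepD(1)[OF Rep(1) hc] by simp
          then show "R n (inv h) x = \<rho> (inv h) x"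
            using Rep_inv[OF Rep(1) hc] Rep_inv[OF Rep(2) hc] inv_left[OF RepD(1)[OF Rep(2) hc]] by metis
        qed
      qed
    qed
    then show "inv h \<in> K" using hc by (simp add: K_def)
  next
    fix h k assume h: "h \<in> K" and k: "k \<in> K"
    then have c: "h \<in> carrier G" "k \<in> carrier G" by (simp_all add: K_def)
    have "\<forall>\<^sub>F n in net. \<forall>x\<in>{-L..L}. R n (h \<otimes> k) x = \<rho> (h \<otimes> k) x" for L
    proof -
      obtain M where M: "\<forall>x\<in>{-L..L}. \<rho> k x \<in> {-M..M}"
        using bounded[OF RepD(1)[OF Rep(1) c(2)]] by blast
      have "\<forall>\<^sub>F n in net. \<forall>x\<in>{-M..M}. R n h x = \<rho> h x" "\<forall>\<^sub>F n in net. \<forall>x\<in>{-L..L}. R n k x = \<rho> k x"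
        using h k by (simp_all add: K_def)
      then show ?thesis
        by eventually_elim (use M in \<open>simp add: RepD(2)[OF Rep(1) c] RepD(2)[OF Rep(2) c]\<close>)
    qed
    then show "h \<otimes> k \<in> K" using c by (simp add: K_def)
  qed (auto simp: K_def)
  moreover have "\<alpha> j \<in> K \<and> \<beta> j \<in> K" if "j < g" for j
    using gen_closed[OF that] by (auto simp: K_def intro: eventually_mono[OF agree[OF that]])
  ultimately have K: "carrier G \<subseteq> K" by (rule generated)
  have "limitin Homeo_plus_topology (\<lambda>n. R n h) (\<rho> h) net" if "h \<in> carrier G" for h
    using K that RepD(1)[OF Rep(1) that] RepD(1)[OF Rep(2) that]
    by (intro limitin_Homeo_plus_topology) (auto simp: K_def)
  moreover have "R n \<in> topspace (product_topology (\<lambda>_. Homeo_plus_topology) (carrier G))" for n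
    using Rep(2)[of n] by (auto simp: Rep_def topspace_Homeo_plus_topology hom_def PiE_def)
  ultimately have "limitin (product_topology (\<lambda>_. Homeo_plus_topology) (carrier G)) R \<rho> net"
    using Rep(1) by (simp add: limitin_componentwise Rep_def del: topspace_product_topology)
  then show ?thesis
    using \<rho> R Rep by (simp add: Rep_sharp_topology_def Rep_topology_def limitin_subtopology)
qed

lemma moved_by_generator:
  assumes "\<rho> \<in> Rep_sharp G"
  shows "\<exists>j<g. \<rho> (\<alpha> j) x \<noteq> x \<or> \<rho> (\<beta> j) x \<noteq> x"
proof (rule ccontr)
  assume fixed: "\<not> ?thesis"
  have Rep: "\<rho> \<in> Rep G" using assms by (simp add: Rep_sharp_def)
  have "subgroup {h \<in> carrier G. \<rho> h x = x} G"
  proof (rule subgroupI)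
    show "{h \<in> carrier G. \<rho> h x = x} \<noteq> {}" using Rep_one[OF Rep] by blast
    show "inv h \<in> {h \<in> carrier G. \<rho> h x = x}" if "h \<in> {h \<in> carrier G. \<rho> h x = x}" for h
      using that Rep_inv[OF Rep, of h x] RepD(1)[OF Rep, of h] by (simp add: inv_eq_iff)
  qed (auto simp: RepD(2)[OF Rep])
  then have "carrier G \<subseteq> {h \<in> carrier G. \<rho> h x = x}"
    using fixed gen_closed by (intro generated) auto
  then have "global_fixed_point G \<rho> x" by (auto simp: global_fixed_point_def)
  then show False using assms by (auto simp: Rep_sharp_def)
qed

lemma exists_representation:
  assumes H: "\<And>j. j < g \<Longrightarrow> line_homeo (a j) \<and> line_homeo (b j)"
    and rel: "commutator_product a b [0..<g] = id"
    and moved: "\<And>x. \<exists>j<g. a j x \<noteq> x \<or> b j x \<noteq> x"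
  shows "\<exists>\<rho>\<in>Rep_sharp G. \<forall>j<g. \<rho> (\<alpha> j) = a j \<and> \<rho> (\<beta> j) = b j"
proof -
  have "surface_word Homeo_plus a b [0..<g] = \<one>\<^bsub>Homeo_plus\<^esub>"
    using rel H by (subst surface_word_Homeo_plus) auto
  then obtain \<phi> where \<phi>: "\<phi> \<in> hom G Homeo_plus" "\<And>j. j < g \<Longrightarrow> \<phi> (\<alpha> j) = a j \<and> \<phi> (\<beta> j) = b j"
    using universal[of a b] H by (auto simp: carrier_Homeo_plus)
  define \<rho> where "\<rho> = restrict \<phi> (carrier G)"
  have gens: "\<rho> (\<alpha> j) = a j \<and> \<rho> (\<beta> j) = b j" if "j < g" for j
    using \<phi>(2) gen_closed that by (simp add: \<rho>_def)
  have "\<rho> \<in> Rep G"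
    using \<phi>(1) by (auto simp: Rep_def \<rho>_def hom_def Pi_iff)
  moreover have "\<not> global_fixed_point G \<rho> x" for x
    using moved[of x] gens gen_closed by (metis global_fixed_point_def)
  ultimately show ?thesis using gens by (auto simp: Rep_sharp_def)
qed

definition translate_rep :: "('a \<Rightarrow> real \<Rightarrow> real) \<Rightarrow> real \<Rightarrow> 'a \<Rightarrow> real \<Rightarrow> real" where
  "translate_rep \<rho> t = (\<lambda>h\<in>carrier G. \<lambda>x. \<rho> h (x + t) - t)"

lemma translate_rep_in_Rep_sharp:
  assumes "\<rho> \<in> Rep_sharp G"
  shows "translate_rep \<rho> t \<in> Rep_sharp G"
proof -
  have Rep: "\<rho> \<in> Rep G" using assms by (simp add: Rep_sharp_def)
  have "translate_rep \<rho> t \<in> Rep G"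
    using RepD[OF Rep] line_homeo_translation_conjugate
    by (auto simp: Rep_def hom_def carrier_Homeo_plus translate_rep_def fun_eq_iff)
  moreover have "global_fixed_point G \<rho> (x + t)" if "global_fixed_point G (translate_rep \<rho> t) x" for x
    using that by (auto simp: global_fixed_point_def translate_rep_def algebra_simps)
  ultimately show ?thesis using assms by (auto simp: Rep_sharp_def)
qed

lemma continuous_map_translate_rep:
  assumes "\<rho> \<in> Rep_sharp G"
  shows "continuous_map euclideanreal (Rep_sharp_topology G) (translate_rep \<rho>)"
proof -
  have Rep: "\<rho> \<in> Rep G" using assms by (simp add: Rep_sharp_def)
  have "continuous_map euclideanreal Homeo_plus_topology (\<lambda>t. translate_rep \<rho> t h)" if "h \<in> carrier G" for h
    using continuous_map_translation_conjugate[OF RepD(1)[OF Rep that]] that by (simp add: translate_rep_def)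
  moreover have "translate_rep \<rho> t \<in> extensional (carrier G)" for t by (simp add: translate_rep_def)
  ultimately have "continuous_map euclideanreal (product_topology (\<lambda>_. Homeo_plus_topology) (carrier G)) (translate_rep \<rho>)"
    by (auto simp: continuous_map_componentwise)
  then show ?thesis
    using translate_rep_in_Rep_sharp[OF assms]
    by (auto simp: Rep_sharp_topology_def Rep_topology_def continuous_map_in_subtopology Rep_sharp_def)
qed

text \<open>
  Any two disjoint open sets covering the space are compared through the translation representation
  \<open>\<tau>\<close>: if \<open>\<tau>\<close> lies in one and \<open>\<rho>\<close> in the other, then so do a conjugate of a truncation of \<open>\<rho>\<close> and this truncation
  itself, although both belong to a connected family of conjugates.
\<close>
theorem connected_Rep_sharp:
  assumes "2 \<le> g"
  shows "connected_space (Rep_sharp_topology G)"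
proof -
  have trans: "commutator_product (\<lambda>_ x. x + 1) (\<lambda>_ x. x + 1) [0..<g] = id"
    using commutator_product_tail[of "[0..<g]" "\<lambda>_ x. x + 1" "\<lambda>_ x. x + 1"]
    by (auto simp: fun_eq_iff) (metis add_diff_cancel_right' diff_add_cancel order_refl)
  obtain \<tau> where \<tau>: "\<tau> \<in> Rep_sharp G"
    and \<tau>_gen: "\<And>j x. j < g \<Longrightarrow> \<tau> (\<alpha> j) x = x + 1 \<and> \<tau> (\<beta> j) x = x + 1"
    using exists_representation[OF _ trans] \<open>2 \<le> g\<close> by (force intro: exI[of _ "0::nat"])
  have "\<not> (openin (Rep_sharp_topology G) E1 \<and> openin (Rep_sharp_topology G) E2 \<and>
      E1 \<union> E2 = Rep_sharp G \<and> E1 \<inter> E2 = {} \<and> \<tau> \<in> E1 \<and> \<rho> \<in> E2)" for E1 E2 \<rho>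
  proof clarify
    assume E: "openin (Rep_sharp_topology G) E1" "openin (Rep_sharp_topology G) E2"
      "E1 \<union> E2 = Rep_sharp G" "E1 \<inter> E2 = {}" and \<tau>E: "\<tau> \<in> E1" and \<rho>E: "\<rho> \<in> E2"
    have \<rho>: "\<rho> \<in> Rep_sharp G" and Rep: "\<rho> \<in> Rep G" using \<rho>E E(3) by (auto simp: Rep_sharp_def)
    define a where "a = (\<lambda>j. \<rho> (\<alpha> j))"
    define b where "b = (\<lambda>j. \<rho> (\<beta> j))"
    have H: "line_homeo (a j) \<and> line_homeo (b j)" if "j < g" for j
      using gen_closed[OF that] RepD(1)[OF Rep] by (simp add: a_def b_def)
    have "commutator_product a b [0..<g] = surface_word Homeo_plus (\<rho> \<circ> \<alpha>) (\<rho> \<circ> \<beta>) [0..<g]"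
      using H by (subst surface_word_Homeo_plus) (auto simp: a_def b_def o_def)
    also have "\<dots> = \<rho> \<one>"
      using hom_surface_word[OF is_group group_Homeo_plus, of \<rho> "[0..<g]" \<alpha> \<beta>] Rep gen_closed
      by (auto simp: relation Rep_def)
    also have "\<dots> = id" using Rep_one[OF Rep] by auto
    finally have rel: "commutator_product a b [0..<g] = id" .
    have moved: "\<exists>j<g. a j x \<noteq> x \<or> b j x \<noteq> x" for x
      using moved_by_generator[OF \<rho>] by (simp add: a_def b_def)
    have "\<exists>\<sigma>\<in>Rep_sharp G. (\<forall>j<g. \<forall>x\<le>N. \<sigma> (\<alpha> j) x = a j x \<and> \<sigma> (\<beta> j) x = b j x) \<and>
        (\<exists>q. \<forall>j<g. \<forall>x\<ge>q. \<sigma> (\<alpha> j) x = x + 1 \<and> \<sigma> (\<beta> j) x = x + 1)" for N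
    proof -
      have "\<exists>a' b' q. (\<forall>j<g. line_homeo (a' j) \<and> line_homeo (b' j)) \<and>
          commutator_product a' b' [0..<g] = id \<and> (\<forall>x. \<exists>j<g. a' j x \<noteq> x \<or> b' j x \<noteq> x) \<and>
          (\<forall>j<g. \<forall>x\<le>N. a' j x = a j x \<and> b' j x = b j x) \<and>
          (\<forall>j<g. \<forall>x\<ge>q. a' j x = x + 1 \<and> b' j x = x + 1)"
        by (rule truncate_to_translations[OF assms H rel moved])
      then obtain a' b' q where t: "\<forall>j<g. line_homeo (a' j) \<and> line_homeo (b' j)"
        "commutator_product a' b' [0..<g] = id" "\<forall>x. \<exists>j<g. a' j x \<noteq> x \<or> b' j x \<noteq> x"
        and ends: "\<forall>j<g. \<forall>x\<le>N. a' j x = a j x \<and> b' j x = b j x"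
        "\<forall>j<g. \<forall>x\<ge>q. a' j x = x + 1 \<and> b' j x = x + 1"
        by (elim exE conjE) (rule that)
      obtain \<sigma> where "\<sigma> \<in> Rep_sharp G" "\<forall>j<g. \<sigma> (\<alpha> j) = a' j \<and> \<sigma> (\<beta> j) = b' j"
        using exists_representation[of a' b'] t by blast
      then show ?thesis using ends by (intro bexI[of _ \<sigma>] conjI exI[of _ q]) auto
    qed
    then obtain \<sigma> where \<sigma>: "\<sigma> N \<in> Rep_sharp G"
      and \<sigma>_old: "\<forall>j<g. \<forall>x\<le>N. \<sigma> N (\<alpha> j) x = a j x \<and> \<sigma> N (\<beta> j) x = b j x"
      and \<sigma>_end: "\<exists>q. \<forall>j<g. \<forall>x\<ge>q. \<sigma> N (\<alpha> j) x = x + 1 \<and> \<sigma> N (\<beta> j) x = x + 1" for N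
      by metis
    have "limitin (Rep_sharp_topology G) \<sigma> \<rho> at_top"
    proof (rule agree_on_generators_imp_limitin[OF \<rho> \<sigma>])
      fix j L assume "j < g"
      then show "\<forall>\<^sub>F N in at_top. \<forall>x\<in>{-L..L}. \<sigma> N (\<alpha> j) x = \<rho> (\<alpha> j) x \<and> \<sigma> N (\<beta> j) x = \<rho> (\<beta> j) x"
        using \<sigma>_old by (intro eventually_mono[OF eventually_ge_at_top[of L]]) (auto simp: a_def b_def)
    qed
    then have "\<forall>\<^sub>F N in at_top. \<sigma> N \<in> E2" using E(2) \<rho>E by (rule limitinD)
    then obtain N where N: "\<sigma> N \<in> E2" using eventually_happens'[OF trivial_limit_at_top_linorder] by blast
    obtain q where q: "\<forall>j<g. \<forall>x\<ge>q. \<sigma> N (\<alpha> j) x = x + 1 \<and> \<sigma> N (\<beta> j) x = x + 1"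
      using \<sigma>_end by blast
    let ?T = "translate_rep (\<sigma> N)"
    have "limitin (Rep_sharp_topology G) ?T \<tau> at_top"
    proof (rule agree_on_generators_imp_limitin[OF \<tau> translate_rep_in_Rep_sharp[OF \<sigma>]])
      fix j L assume "j < g"
      then show "\<forall>\<^sub>F t in at_top. \<forall>x\<in>{-L..L}. ?T t (\<alpha> j) x = \<tau> (\<alpha> j) x \<and> ?T t (\<beta> j) x = \<tau> (\<beta> j) x"
        using q by (intro eventually_mono[OF eventually_ge_at_top[of "q + L"]])
          (auto simp: translate_rep_def gen_closed \<tau>_gen)
    qed
    then have "\<forall>\<^sub>F t in at_top. ?T t \<in> E1" using E(1) \<tau>E by (rule limitinD)
    then obtain t where t: "?T t \<in> E1" using eventually_happens'[OF trivial_limit_at_top_linorder] by blast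
    have "?T 0 = \<sigma> N" using \<sigma>[of N]
      by (auto simp: translate_rep_def fun_eq_iff Rep_sharp_def Rep_def extensional_def)
    then have "E2 \<inter> range ?T \<noteq> {}" using N by (metis IntI empty_iff rangeI)
    moreover have "E1 \<inter> range ?T \<noteq> {}" using t by blast
    moreover have "range ?T \<subseteq> E1 \<union> E2" using translate_rep_in_Rep_sharp[OF \<sigma>] E(3) by blast
    moreover have "connectedin (Rep_sharp_topology G) (range ?T)"
      by (rule connectedin_continuous_map_image[OF continuous_map_translate_rep[OF \<sigma>]]) simp
    moreover have "E1 \<inter> E2 \<inter> range ?T = {}" using E(4) by blast
    ultimately show False using E(1,2) unfolding connectedin by metis
  qed
  then have "E1 = {} \<or> E2 = {}"
    if "openin (Rep_sharp_topology G) E1" "openin (Rep_sharp_topology G) E2"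
      "E1 \<union> E2 = Rep_sharp G" "E1 \<inter> E2 = {}" for E1 E2
    using that \<tau> by (metis Un_iff Un_commute Int_commute ex_in_conv)
  then show ?thesis
    unfolding connected_space_eq topspace_Rep_sharp_topology by blast
qed

end

section \<open>Holonomy of locally constant cocycles\<close>

lemma (in group) mult_inv_cancel:
  assumes "x \<in> carrier G" "y \<in> carrier G"
  shows "x \<otimes> (inv x \<otimes> y) = y" "inv x \<otimes> (x \<otimes> y) = y" "y \<otimes> x \<otimes> inv x = y" "y \<otimes> inv x \<otimes> x = y"
  using assms m_assoc[of x "inv x" y] m_assoc[of "inv x" x y] m_assoc[of y x "inv x"] m_assoc[of y "inv x" x]
  by simp_all

text \<open>
  Transition functions of a principal bundle with discrete structure group \<open>H\<close>: values on overlaps of charts are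
  locally constant and multiplicative.
\<close>
locale cech_cocycle = group H for H (structure) +
  fixes S :: "'a::topological_space set" and V :: "'i \<Rightarrow> 'a set" and c :: "'i \<Rightarrow> 'i \<Rightarrow> 'a \<Rightarrow> 'b"
  assumes chart_open: "openin (top_of_set S) (V i)"
    and charts_cover: "x \<in> S \<Longrightarrow> \<exists>i. x \<in> V i"
    and cocycle_closed: "x \<in> V i \<Longrightarrow> x \<in> V j \<Longrightarrow> c i j x \<in> carrier H"
    and cocycle_mult: "x \<in> V i \<Longrightarrow> x \<in> V j \<Longrightarrow> x \<in> V k \<Longrightarrow> c i j x \<otimes> c j k x = c i k x"
    and cocycle_locally_constant:
      "x \<in> V i \<Longrightarrow> x \<in> V j \<Longrightarrow> \<exists>U. openin (top_of_set S) U \<and> x \<in> U \<and> (\<forall>y\<in>U. y \<in> V i \<longrightarrow> y \<in> V j \<longrightarrow> c i j y = c i j x)"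
begin

text \<open>
  A flat section along \<open>\<sigma>\<close>, where \<open>F \<tau> i\<close> is its value at \<open>\<sigma> \<tau>\<close> in the trivialisation over the chart \<open>V i\<close>. In
  each chart the value is locally constant in the parameter.
\<close>
definition flat :: "('t::metric_space \<Rightarrow> 'a) \<Rightarrow> 't set \<Rightarrow> ('t \<Rightarrow> 'i \<Rightarrow> 'b) \<Rightarrow> bool" where
  "flat \<sigma> A F \<longleftrightarrow> (\<forall>\<tau>\<in>A. \<forall>i. \<sigma> \<tau> \<in> V i \<longrightarrow> F \<tau> i \<in> carrier H \<and>
     (\<forall>j. \<sigma> \<tau> \<in> V j \<longrightarrow> F \<tau> j = F \<tau> i \<otimes> c i j (\<sigma> \<tau>)) \<and>
     (\<forall>\<^sub>F \<tau>' in at \<tau> within A. F \<tau>' i = F \<tau> i))"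

lemma flatD:
  assumes "flat \<sigma> A F" "\<tau> \<in> A" "\<sigma> \<tau> \<in> V i"
  shows "F \<tau> i \<in> carrier H" "\<sigma> \<tau> \<in> V j \<Longrightarrow> F \<tau> j = F \<tau> i \<otimes> c i j (\<sigma> \<tau>)"
    "\<forall>\<^sub>F \<tau>' in at \<tau> within A. F \<tau>' i = F \<tau> i"
  using assms unfolding flat_def by blast+

lemma chart_subset: "V i \<subseteq> S"
  using chart_open openin_imp_subset by blast

lemma eventually_in_chart:
  assumes "continuous_on A \<sigma>" "\<sigma> ` A \<subseteq> S" "openin (top_of_set S) U" "\<tau> \<in> A" "\<sigma> \<tau> \<in> U"
  shows "\<forall>\<^sub>F \<tau>' in at \<tau> within A. \<sigma> \<tau>' \<in> U"
proof -
  obtain W where W: "open W" "U = S \<inter> W" using assms(3) by (auto simp: openin_open)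
  have "(\<sigma> \<longlongrightarrow> \<sigma> \<tau>) (at \<tau> within A)" using assms by (simp add: continuous_on_def)
  then have "\<forall>\<^sub>F \<tau>' in at \<tau> within A. \<sigma> \<tau>' \<in> W" using W assms(5) by (auto dest: topological_tendstoD)
  moreover have "\<forall>\<^sub>F \<tau>' in at \<tau> within A. \<tau>' \<in> A" by (simp add: eventually_at_filter)
  ultimately show ?thesis by eventually_elim (use W assms(2) in auto)
qed

lemma cocycle_refl: "x \<in> V i \<Longrightarrow> c i i x = \<one>"
  using cocycle_mult[of x i i i] cocycle_closed[of x i i] by (metis r_cancel_one)

lemma flat_left_mult:
  assumes "flat \<sigma> A F" "h \<in> carrier H"
  shows "flat \<sigma> A (\<lambda>\<tau> i. h \<otimes> F \<tau> i)"
  unfolding flat_def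
proof (intro ballI allI impI conjI)
  fix \<tau> i assume t: "\<tau> \<in> A" "\<sigma> \<tau> \<in> V i"
  note F = flatD[OF assms(1) t]
  show "h \<otimes> F \<tau> i \<in> carrier H" using F(1) assms(2) by simp
  show "h \<otimes> F \<tau> j = h \<otimes> F \<tau> i \<otimes> c i j (\<sigma> \<tau>)" if "\<sigma> \<tau> \<in> V j" for j
    using F(1) F(2)[OF that] assms(2) cocycle_closed t that by (simp add: m_assoc)
  show "\<forall>\<^sub>F \<tau>' in at \<tau> within A. h \<otimes> F \<tau>' i = h \<otimes> F \<tau> i"
    using F(3) by eventually_elim simp
qed

lemma flat_chart:
  assumes "continuous_on A \<sigma>" "\<sigma> ` A \<subseteq> V i"
  shows "flat \<sigma> A (\<lambda>\<tau> j. c i j (\<sigma> \<tau>))"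
  unfolding flat_def
proof (intro ballI allI impI conjI)
  fix \<tau> j assume t: "\<tau> \<in> A" "\<sigma> \<tau> \<in> V j"
  then have i: "\<sigma> \<tau> \<in> V i" using assms by auto
  show "c i j (\<sigma> \<tau>) \<in> carrier H" using i t cocycle_closed by blast
  show "c i k (\<sigma> \<tau>) = c i j (\<sigma> \<tau>) \<otimes> c j k (\<sigma> \<tau>)" if "\<sigma> \<tau> \<in> V k" for k
    using i t that cocycle_mult by simp
  obtain U where U: "openin (top_of_set S) U" "\<sigma> \<tau> \<in> U"
    "\<forall>y\<in>U. y \<in> V i \<longrightarrow> y \<in> V j \<longrightarrow> c i j y = c i j (\<sigma> \<tau>)"
    using cocycle_locally_constant[OF i t(2)] by blast
  have "openin (top_of_set S) (U \<inter> V i \<inter> V j)" using U chart_open by (intro openin_Int)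
  moreover have "\<sigma> ` A \<subseteq> S" using assms(2) chart_subset by blast
  ultimately have "\<forall>\<^sub>F \<tau>' in at \<tau> within A. \<sigma> \<tau>' \<in> U \<inter> V i \<inter> V j"
    using U t i assms by (intro eventually_in_chart) auto
  then show "\<forall>\<^sub>F \<tau>' in at \<tau> within A. c i j (\<sigma> \<tau>') = c i j (\<sigma> \<tau>)"
    by eventually_elim (use U(3) in auto)
qed

text \<open>
  The ratio of two flat sections is the same in all charts, and it is locally constant.
\<close>
lemma flat_unique:
  assumes "connected A" "continuous_on A \<sigma>" "\<sigma> ` A \<subseteq> S" "flat \<sigma> A F" "flat \<sigma> A F'"
    and "\<tau> \<in> A" "\<tau>' \<in> A" "\<sigma> \<tau> \<in> V i" "\<sigma> \<tau>' \<in> V j"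
  shows "F \<tau>' j \<otimes> inv (F' \<tau>' j) = F \<tau> i \<otimes> inv (F' \<tau> i)"
proof -
  define r where "r = (\<lambda>\<tau>. let i = SOME i. \<sigma> \<tau> \<in> V i in F \<tau> i \<otimes> inv (F' \<tau> i))"
  have r: "r \<tau> = F \<tau> i \<otimes> inv (F' \<tau> i)" if t: "\<tau> \<in> A" "\<sigma> \<tau> \<in> V i" for \<tau> i
  proof -
    define k where "k = (SOME i. \<sigma> \<tau> \<in> V i)"
    have k: "\<sigma> \<tau> \<in> V k" unfolding k_def using t(2) by (rule someI)
    note F = flatD[OF assms(4) t] flatD[OF assms(5) t] cocycle_closed[OF t(2) k]
    have "F \<tau> k \<otimes> inv (F' \<tau> k) = F \<tau> i \<otimes> c i k (\<sigma> \<tau>) \<otimes> (inv (c i k (\<sigma> \<tau>)) \<otimes> inv (F' \<tau> i))"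
      using F k by (simp add: inv_mult_group)
    also have "\<dots> = F \<tau> i \<otimes> inv (F' \<tau> i)" using F by (simp add: m_assoc mult_inv_cancel)
    finally show ?thesis by (simp add: r_def k_def[symmetric])
  qed
  have "r \<tau> = r \<tau>'"
  proof (rule connected_local_const[OF assms(1) assms(6,7)], intro ballI)
    fix t assume t: "t \<in> A"
    then obtain k where k: "\<sigma> t \<in> V k" using charts_cover assms(3) by blast
    have "\<forall>\<^sub>F t' in at t within A. F t' k = F t k" "\<forall>\<^sub>F t' in at t within A. F' t' k = F' t k"
      using flatD(3)[OF assms(4) t k] flatD(3)[OF assms(5) t k] .
    moreover have "\<forall>\<^sub>F t' in at t within A. \<sigma> t' \<in> V k"
      using eventually_in_chart[OF assms(2,3) chart_open t k] .
    moreover have "\<forall>\<^sub>F t' in at t within A. t' \<in> A" by (simp add: eventually_at_filter)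
    ultimately show "\<forall>\<^sub>F t' in at t within A. r t = r t'"
      by eventually_elim (use r t k in simp)
  qed
  then show ?thesis using r assms by simp
qed

lemma flat_subset: "flat \<sigma> A F \<Longrightarrow> B \<subseteq> A \<Longrightarrow> flat \<sigma> B F"
  unfolding flat_def by (meson at_le filter_leD subsetD)

text \<open>
  After multiplication by a constant from the left, both sections agree at one point of \<open>A \<inter> B\<close>, hence on all of this
  connected set.
\<close>
lemma flat_glue:
  assumes con: "connected (A \<inter> B)" "A \<inter> B \<noteq> {}" and clo: "closed A" "closed B"
    and \<sigma>: "continuous_on (A \<union> B) \<sigma>" "\<sigma> ` (A \<union> B) \<subseteq> S"
    and F: "flat \<sigma> A F" and F': "flat \<sigma> B F'"
  shows "\<exists>F. flat \<sigma> (A \<union> B) F"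
proof -
  obtain t where t: "t \<in> A" "t \<in> B" using con by blast
  then obtain i where i: "\<sigma> t \<in> V i" using charts_cover \<sigma> by blast
  define h where "h = F t i \<otimes> inv (F' t i)"
  have h: "h \<in> carrier H" unfolding h_def using flatD(1)[OF F t(1) i] flatD(1)[OF F' t(2) i] by simp
  define F'' where "F'' = (\<lambda>\<tau> i. h \<otimes> F' \<tau> i)"
  have F'': "flat \<sigma> B F''" unfolding F''_def by (rule flat_left_mult[OF F' h])
  have agree: "F \<tau> j = F'' \<tau> j" if \<tau>: "\<tau> \<in> A" "\<tau> \<in> B" "\<sigma> \<tau> \<in> V j" for \<tau> j
  proof -
    have "F \<tau> j \<otimes> inv (F' \<tau> j) = h"
      unfolding h_def
      by (rule flat_unique[OF con(1)])
        (use t \<tau> i \<sigma> in \<open>auto intro: flat_subset[OF F] flat_subset[OF F'] continuous_on_subset\<close>)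
    then show ?thesis
      using flatD(1)[OF F \<tau>(1,3)] flatD(1)[OF F' \<tau>(2,3)] h
      unfolding F''_def by (metis inv_closed inv_solve_right')
  qed
  \<comment> \<open>a closed set contributes nothing to the limit at a point outside of it, so flatness may be tested on \<open>A\<close> and \<open>B\<close> separately\<close>
  define K where "K = (\<lambda>\<tau>. if \<tau> \<in> A then F \<tau> else F'' \<tau>)"
  have KA: "K \<tau> j = F \<tau> j" if "\<tau> \<in> A" for \<tau> j using that by (simp add: K_def)
  have KB: "K \<tau> j = F'' \<tau> j" if "\<tau> \<in> B" "\<sigma> \<tau> \<in> V j" for \<tau> j using that agree by (simp add: K_def)
  have part: "\<forall>\<^sub>F \<tau>' in at \<tau> within C. K \<tau>' j = K \<tau> j"
    if \<tau>: "\<tau> \<in> A \<union> B" "\<sigma> \<tau> \<in> V j" and C: "closed C" "C \<subseteq> A \<union> B" "flat \<sigma> C G"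
      and KC: "\<And>\<tau> j. \<tau> \<in> C \<Longrightarrow> \<sigma> \<tau> \<in> V j \<Longrightarrow> K \<tau> j = G \<tau> j" for \<tau> j C G
  proof (cases "\<tau> \<in> C")
    case True
    have "\<forall>\<^sub>F \<tau>' in at \<tau> within C. \<sigma> \<tau>' \<in> V j"
      using \<sigma> C(2) \<tau> True by (intro eventually_in_chart[OF _ _ chart_open]) (auto intro: continuous_on_subset)
    moreover have "\<forall>\<^sub>F \<tau>' in at \<tau> within C. \<tau>' \<in> C" by (simp add: eventually_at_filter)
    ultimately show ?thesis using flatD(3)[OF C(3) True \<tau>(2)]
      by eventually_elim (use KC True \<tau> in auto)
  next
    case False
    then have "at \<tau> within C = bot"
      using C(1) by (intro not_in_closure_trivial_limitI) simp
    then show ?thesis by simp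
  qed
  have "flat \<sigma> (A \<union> B) K"
    unfolding flat_def
  proof (intro ballI allI impI conjI)
    fix \<tau> j assume \<tau>: "\<tau> \<in> A \<union> B" "\<sigma> \<tau> \<in> V j"
    show "K \<tau> j \<in> carrier H"
      using \<tau> KA KB flatD(1)[OF F] flatD(1)[OF F''] by auto
    show "K \<tau> k = K \<tau> j \<otimes> c j k (\<sigma> \<tau>)" if "\<sigma> \<tau> \<in> V k" for k
    proof (cases "\<tau> \<in> A")
      case True
      then show ?thesis using KA flatD(2)[OF F True \<tau>(2) that] by simp
    next
      case False
      then have B: "\<tau> \<in> B" using \<tau> by simp
      show ?thesis using KB[OF B] flatD(2)[OF F'' B \<tau>(2) that] that \<tau>(2) by simp
    qed
    show "\<forall>\<^sub>F \<tau>' in at \<tau> within A \<union> B. K \<tau>' j = K \<tau> j"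
      unfolding at_within_union eventually_sup
      using part[OF \<tau> clo(1) _ F] part[OF \<tau> clo(2) _ F''] KA KB by auto
  qed
  then show ?thesis by blast
qed

lemma flat_compose:
  assumes F: "flat \<sigma> A F" and f: "continuous_on B f" "f ` B \<subseteq> A"
  shows "flat (\<lambda>t. \<sigma> (f t)) B (\<lambda>t. F (f t))"
  unfolding flat_def
proof (intro ballI allI impI conjI)
  fix t i assume t: "t \<in> B" "\<sigma> (f t) \<in> V i"
  then have ft: "f t \<in> A" using f by auto
  note F' = flatD[OF F ft t(2)]
  show "F (f t) i \<in> carrier H" "\<And>j. \<sigma> (f t) \<in> V j \<Longrightarrow> F (f t) j = F (f t) i \<otimes> c i j (\<sigma> (f t))"
    using F' by auto
  have "\<forall>\<^sub>F x in nhds (f t). x \<in> A \<longrightarrow> F x i = F (f t) i"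
    using F'(3) by (auto simp: eventually_at_filter elim: eventually_mono)
  then obtain U where U: "open U" "f t \<in> U" "\<forall>x\<in>U. x \<in> A \<longrightarrow> F x i = F (f t) i"
    unfolding eventually_nhds by blast
  have "(f \<longlongrightarrow> f t) (at t within B)" using f t by (simp add: continuous_on_def)
  then have "\<forall>\<^sub>F x in at t within B. f x \<in> U" using U by (auto dest: topological_tendstoD)
  moreover have "\<forall>\<^sub>F x in at t within B. x \<in> B" by (simp add: eventually_at_filter)
  ultimately show "\<forall>\<^sub>F x in at t within B. F (f x) i = F (f t) i"
    by eventually_elim (use U f in auto)
qed

text \<open>
  Sections exist on small rectangles, since these are mapped into a single chart, and sections on two
  rectangles sharing a side can be glued. Bolzano's principle in each of the two coordinates turns this into a section on
  the whole square.
\<close>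
lemma flat_exists_on_rectangle:
  fixes h :: "real \<times> real \<Rightarrow> 'a"
  assumes "continuous_on ({0..1} \<times> {0..1}) h" "h ` ({0..1} \<times> {0..1}) \<subseteq> S"
  shows "\<exists>F. flat h ({0..1} \<times> {0..1}) F"
proof -
  define I where "I = (\<lambda>a b. {a..b} \<inter> {0..1::real})"
  have I_union: "I a b \<union> I b d = I a d" and I_int: "I a b \<inter> I b d = I b b" if "a \<le> b" "b \<le> d" for a b d
    using that by (auto simp: I_def)
  have I_convex: "connected (I a b)" and I_closed: "closed (I a b)" for a b
    by (auto simp: I_def convex_Int convex_connected)
  have h_on: "continuous_on (I a b \<times> I a' b') h" "h ` (I a b \<times> I a' b') \<subseteq> S" for a b a' b'
    using assms by (auto simp: I_def intro: continuous_on_subset)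
  define P where "P = (\<lambda>a b a' b'. \<exists>F. flat h (I a b \<times> I a' b') F)"
  have empty: "P a b a' b'" if "I a b \<times> I a' b' = {}" for a b a' b'
    unfolding P_def flat_def that by simp
  have join1: "P a d a' b'" if asm: "P a b a' b'" "P b d a' b'" "a \<le> b" "b \<le> d" for a b d a' b'
  proof (cases "I b b \<times> I a' b' = {}")
    case True
    then have "b \<notin> {0..1} \<or> I a' b' = {}" by (auto simp: I_def)
    then have "I a d \<times> I a' b' = I a b \<times> I a' b' \<or> I a d \<times> I a' b' = I b d \<times> I a' b'"
      using asm(3,4) by (auto simp: I_def)
    then show ?thesis using asm unfolding P_def by metis
  next
    case False
    have e: "I a d \<times> I a' b' = (I a b \<times> I a' b') \<union> (I b d \<times> I a' b')"
      "(I a b \<times> I a' b') \<inter> (I b d \<times> I a' b') = I b b \<times> I a' b'"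
      using I_union[OF asm(3,4)] I_int[OF asm(3,4)] by auto
    obtain F F' where "flat h (I a b \<times> I a' b') F" "flat h (I b d \<times> I a' b') F'" using asm(1,2) unfolding P_def by blast
    then show ?thesis
      unfolding P_def e(1)
      by (rule flat_glue[rotated 6])
        (use False h_on in \<open>auto simp: e(2) e(1)[symmetric] connected_Times I_convex closed_Times I_closed\<close>)
  qed
  have join2: "P a b a' d'" if asm: "P a b a' b'" "P a b b' d'" "a' \<le> b'" "b' \<le> d'" for a b a' b' d'
  proof (cases "I a b \<times> I b' b' = {}")
    case True
    then have "b' \<notin> {0..1} \<or> I a b = {}" by (auto simp: I_def)
    then have "I a b \<times> I a' d' = I a b \<times> I a' b' \<or> I a b \<times> I a' d' = I a b \<times> I b' d'"
      using asm(3,4) by (auto simp: I_def)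
    then show ?thesis using asm unfolding P_def by metis
  next
    case False
    have e: "I a b \<times> I a' d' = (I a b \<times> I a' b') \<union> (I a b \<times> I b' d')"
      "(I a b \<times> I a' b') \<inter> (I a b \<times> I b' d') = I a b \<times> I b' b'"
      using I_union[OF asm(3,4)] I_int[OF asm(3,4)] by auto
    obtain F F' where "flat h (I a b \<times> I a' b') F" "flat h (I a b \<times> I b' d') F'" using asm(1,2) unfolding P_def by blast
    then show ?thesis
      unfolding P_def e(1)
      by (rule flat_glue[rotated 6])
        (use False h_on in \<open>auto simp: e(2) e(1)[symmetric] connected_Times I_convex closed_Times I_closed\<close>)
  qed
  have local: "\<exists>d>0. \<forall>a b a' b'. a \<le> x \<and> x \<le> b \<and> b - a < d \<and> a' \<le> y \<and> y \<le> b' \<and> b' - a' < d \<longrightarrow> P a b a' b'"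
    if xy: "x \<in> {0..1}" "y \<in> {0..1}" for x y
  proof -
    have "h (x, y) \<in> S" using assms xy by auto
    then obtain i where i: "h (x, y) \<in> V i" using charts_cover by blast
    obtain W where W: "open W" "V i = S \<inter> W" using chart_open[of i] by (auto simp: openin_open)
    have "\<exists>U. open U \<and> (x, y) \<in> U \<and> (\<forall>z\<in>{0..1} \<times> {0..1}. z \<in> U \<longrightarrow> h z \<in> W)"
      using assms(1) W i xy unfolding continuous_on_topological by blast
    then obtain U where U: "open U" "(x, y) \<in> U" "\<forall>z\<in>{0..1} \<times> {0..1}. z \<in> U \<longrightarrow> h z \<in> W" by blast
    then obtain e where e: "e > 0" "ball (x, y) e \<subseteq> U" using open_contains_ball by blast
    have "P a b a' b'" if "a \<le> x" "x \<le> b" "b - a < e / 2" "a' \<le> y" "y \<le> b'" "b' - a' < e / 2" for a b a' b'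
    proof -
      have "z \<in> U" if "z \<in> I a b \<times> I a' b'" for z
      proof -
        obtain u v where z: "z = (u, v)" by fastforce
        have "a \<le> u" "u \<le> b" "a' \<le> v" "v \<le> b'" using that by (auto simp: z I_def)
        then have "\<bar>x - u\<bar> < e / 2" "\<bar>y - v\<bar> < e / 2"
          using \<open>a \<le> x\<close> \<open>x \<le> b\<close> \<open>b - a < e / 2\<close> \<open>a' \<le> y\<close> \<open>y \<le> b'\<close> \<open>b' - a' < e / 2\<close>
          by linarith+
        then have "dist x u + dist y v < e" by (simp add: dist_real_def)
        moreover have "dist (x, y) (u, v) \<le> dist x u + dist y v"
          unfolding dist_Pair_Pair by (rule sqrt_sum_squares_le_sum) auto
        ultimately show ?thesis using e(2) by (auto simp: z)
      qed
      then have "h ` (I a b \<times> I a' b') \<subseteq> V i"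
        using U(3) W(2) h_on(2)[of a b a' b'] by (fastforce simp: I_def)
      then show ?thesis unfolding P_def using flat_chart[OF h_on(1)] by blast
    qed
    then show ?thesis using \<open>e > 0\<close> by (intro exI[of _ "e / 2"]) auto
  qed
  have strip: "\<exists>d>0. \<forall>a b. a \<le> x \<and> x \<le> b \<and> b - a < d \<longrightarrow> P a b 0 1" if x: "x \<in> {0..1}" for x
  proof -
    have "\<exists>d>0. \<forall>a b. a \<le> x \<and> x \<le> b \<and> b - a < d \<longrightarrow> P a b 0 1"
    proof (rule Bolzano[of 0 1 "\<lambda>a' b'. \<exists>d>0. \<forall>a b. a \<le> x \<and> x \<le> b \<and> b - a < d \<longrightarrow> P a b a' b'"])
      fix u v w assume "u \<le> v" "v \<le> w"
        "\<exists>d>0. \<forall>a b. a \<le> x \<and> x \<le> b \<and> b - a < d \<longrightarrow> P a b u v"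
        "\<exists>d>0. \<forall>a b. a \<le> x \<and> x \<le> b \<and> b - a < d \<longrightarrow> P a b v w"
      then obtain d d' where "d > 0" "d' > 0"
        "\<forall>a b. a \<le> x \<and> x \<le> b \<and> b - a < d \<longrightarrow> P a b u v"
        "\<forall>a b. a \<le> x \<and> x \<le> b \<and> b - a < d' \<longrightarrow> P a b v w" by blast
      then show "\<exists>d>0. \<forall>a b. a \<le> x \<and> x \<le> b \<and> b - a < d \<longrightarrow> P a b u w"
        using join2[OF _ _ \<open>u \<le> v\<close> \<open>v \<le> w\<close>] by (intro exI[of _ "min d d'"]) auto
    next
      fix y :: real assume "0 \<le> y" "y \<le> 1"
      then obtain d where "d > 0" and d: "\<forall>a b a' b'. a \<le> x \<and> x \<le> b \<and> b - a < d \<and> a' \<le> y \<and> y \<le> b' \<and> b' - a' < d \<longrightarrow> P a b a' b'"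
        using local[OF x, of y] by auto
      then show "\<exists>d>0. \<forall>a' b'. a' \<le> y \<and> y \<le> b' \<and> b' - a' < d \<longrightarrow>
          (\<exists>d>0. \<forall>a b. a \<le> x \<and> x \<le> b \<and> b - a < d \<longrightarrow> P a b a' b')"
        by blast
    qed simp
    then show ?thesis .
  qed
  have "P 0 1 0 1"
  proof (rule Bolzano[of 0 1 "\<lambda>a b. P a b 0 1"])
    show "\<exists>d>0. \<forall>a b. a \<le> x \<and> x \<le> b \<and> b - a < d \<longrightarrow> P a b 0 1" if "0 \<le> x" "x \<le> 1" for x
      using strip[of x] that by simp
  qed (use join1 in \<open>auto\<close>)
  then show ?thesis by (simp add: P_def I_def)
qed

text \<open>
  Parallel transport along \<open>p\<close>, from the trivialisation over \<open>V i\<close> at its start to the one over \<open>V j\<close> at its end.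
\<close>
definition hol :: "(real \<Rightarrow> 'a) \<Rightarrow> 'i \<Rightarrow> 'i \<Rightarrow> 'b" where
  "hol p i j = (let F = SOME F. flat p {0..1} F in inv (F 0 i) \<otimes> F 1 j)"

lemma flat_exists_on_path:
  assumes "path p" "path_image p \<subseteq> S"
  shows "\<exists>F. flat p {0..1} F"
proof -
  have "continuous_on ({0..1} \<times> {0..1}) (\<lambda>z :: real \<times> real. p (snd z))"
    using assms(1) unfolding path_def
    by (intro continuous_on_compose2[of "{0..1}" p _ snd] continuous_intros) auto
  then obtain F where "flat (\<lambda>z :: real \<times> real. p (snd z)) ({0..1} \<times> {0..1}) F"
    using flat_exists_on_rectangle[of "\<lambda>z. p (snd z)"] assms(2)
    by (fastforce simp: path_image_def image_subset_iff)
  then have "flat (\<lambda>t. p (snd (0 :: real, t))) {0..1} (\<lambda>t. F (0, t))"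
    by (rule flat_compose) (auto intro!: continuous_intros)
  then show ?thesis by auto
qed

lemma flat_cong:
  assumes "flat \<sigma> A F" "\<And>\<tau>. \<tau> \<in> A \<Longrightarrow> \<sigma>' \<tau> = \<sigma> \<tau>"
  shows "flat \<sigma>' A F"
  unfolding flat_def using assms(2) flatD[OF assms(1)] by metis

lemma hol_eq:
  assumes p: "path p" "path_image p \<subseteq> S" and F: "flat p {0..1} F" and ends: "p 0 \<in> V i" "p 1 \<in> V j"
  shows "hol p i j = inv (F 0 i) \<otimes> F 1 j"
proof -
  define F' where "F' = (SOME F. flat p {0..1} F)"
  have F': "flat p {0..1} F'" unfolding F'_def using flat_exists_on_path[OF p] by (rule someI_ex)
  note C = flatD(1)[OF F _ ends(1)] flatD(1)[OF F _ ends(2)] flatD(1)[OF F' _ ends(1)] flatD(1)[OF F' _ ends(2)]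
  have C: "F 0 i \<in> carrier H" "F 1 j \<in> carrier H" "F' 0 i \<in> carrier H" "F' 1 j \<in> carrier H"
    using C by simp_all
  have "F 1 j \<otimes> inv (F' 1 j) = F 0 i \<otimes> inv (F' 0 i)"
    using p ends by (intro flat_unique[OF _ _ _ F F']) (auto simp: path_def path_image_def)
  then have "inv (F 0 i) \<otimes> (F 1 j \<otimes> inv (F' 1 j)) \<otimes> F' 1 j = inv (F 0 i) \<otimes> (F 0 i \<otimes> inv (F' 0 i)) \<otimes> F' 1 j"
    by simp
  then have "inv (F 0 i) \<otimes> F 1 j = inv (F' 0 i) \<otimes> F' 1 j"
    using C by (simp add: m_assoc mult_inv_cancel)
  then show ?thesis by (simp add: hol_def F'_def[symmetric])
qed

lemma hol_closed:
  assumes "path p" "path_image p \<subseteq> S" "p 0 \<in> V i" "p 1 \<in> V j"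
  shows "hol p i j \<in> carrier H"
proof -
  obtain F where F: "flat p {0..1} F" using flat_exists_on_path assms by blast
  then show ?thesis using hol_eq[OF assms(1,2) F assms(3,4)] flatD(1)[OF F] assms by simp
qed

lemma hol_join:
  assumes p: "path p" "path_image p \<subseteq> S" and q: "path q" "path_image q \<subseteq> S"
    and pq: "p 1 = q 0" and ends: "p 0 \<in> V i" "p 1 \<in> V j" "q 1 \<in> V k"
  shows "hol (p +++ q) i k = hol p i j \<otimes> hol q j k"
proof -
  have pq': "pathfinish p = pathstart q" using pq by (simp add: pathfinish_def pathstart_def)
  have join: "path (p +++ q)" "path_image (p +++ q) \<subseteq> S"
    using p q pq' by (auto simp: path_image_join)
  obtain F where F: "flat (p +++ q) {0..1} F" using flat_exists_on_path[OF join] by blast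
  have "flat (\<lambda>t. (p +++ q) (t / 2)) {0..1} (\<lambda>t. F (t / 2))"
    by (rule flat_compose[OF F]) (auto intro!: continuous_intros)
  then have Fp: "flat p {0..1} (\<lambda>t. F (t / 2))"
    by (rule flat_cong) (auto simp: joinpaths_def)
  have "flat (\<lambda>t. (p +++ q) ((t + 1) / 2)) {0..1} (\<lambda>t. F ((t + 1) / 2))"
    by (rule flat_compose[OF F]) (auto intro!: continuous_intros)
  then have Fq: "flat q {0..1} (\<lambda>t. F ((t + 1) / 2))"
    by (rule flat_cong) (use pq in \<open>auto simp: joinpaths_def add_divide_distrib\<close>)
  have "p 0 = (p +++ q) 0" "q 1 = (p +++ q) 1" by (auto simp: joinpaths_def)
  then have "hol (p +++ q) i k = inv (F 0 i) \<otimes> F 1 k"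
    using ends by (intro hol_eq[OF join F]) auto
  moreover have "hol p i j = inv (F 0 i) \<otimes> F (1/2) j" using hol_eq[OF p Fp ends(1,2)] by simp
  moreover have "hol q j k = inv (F (1/2) j) \<otimes> F 1 k" using hol_eq[OF q Fq _ ends(3)] ends(2) pq by simp
  moreover have "F 0 i \<in> carrier H" "F (1/2) j \<in> carrier H" "F 1 k \<in> carrier H"
    using flatD(1)[OF Fp, of 0 i] flatD(1)[OF Fp, of 1 j] flatD(1)[OF Fq, of 1 k] ends by simp_all
  ultimately show ?thesis by (simp add: m_assoc mult_inv_cancel)
qed

lemma hol_reversepath:
  assumes p: "path p" "path_image p \<subseteq> S" and ends: "p 0 \<in> V i" "p 1 \<in> V j"
  shows "hol (reversepath p) j i = inv (hol p i j)"
proof -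
  obtain F where F: "flat p {0..1} F" using flat_exists_on_path[OF p] by blast
  have "flat (\<lambda>t. p (1 - t)) {0..1} (\<lambda>t. F (1 - t))"
    by (rule flat_compose[OF F]) (auto intro!: continuous_intros)
  then have "flat (reversepath p) {0..1} (\<lambda>t. F (1 - t))" by (simp add: reversepath_def[abs_def])
  moreover have r: "reversepath p 0 = p 1" "reversepath p 1 = p 0" by (simp_all add: reversepath_def)
  ultimately have "hol (reversepath p) j i = inv (F 1 j) \<otimes> F 0 i"
    using hol_eq[of "reversepath p" "\<lambda>t. F (1 - t)" j i] p ends path_reversepath[of p] path_image_reversepath[of p]
    by (simp add: r)
  moreover have "F 0 i \<in> carrier H" "F 1 j \<in> carrier H"
    using flatD(1)[OF F] ends by simp_all
  ultimately show ?thesis using hol_eq[OF p F ends] by (simp add: inv_mult_group)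
qed

lemma flat_along_constant:
  assumes "connected A" "flat (\<lambda>_. x) A F" "x \<in> V i" "\<tau> \<in> A" "\<tau>' \<in> A"
  shows "F \<tau> i = F \<tau>' i"
proof (rule connected_local_const[OF assms(1,4,5)], intro ballI)
  fix t assume "t \<in> A"
  from flatD(3)[OF assms(2) this assms(3)]
  show "\<forall>\<^sub>F t' in at t within A. F t i = F t' i" by (simp add: eq_commute)
qed

text \<open>
  A flat section on the square of a homotopy is constant along the two sides that are mapped to the end points.
\<close>
lemma hol_homotopic:
  assumes "homotopic_paths S p q" and ends: "p 0 \<in> V i" "p 1 \<in> V j"
  shows "hol p i j = hol q i j"
proof -
  obtain h where h: "continuous_on ({0..1} \<times> {0..1}) h" "h ` ({0..1} \<times> {0..1}) \<subseteq> S"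
    and h01: "\<And>t. t \<in> {0..1} \<Longrightarrow> h (0, t) = p t" "\<And>t. t \<in> {0..1} \<Longrightarrow> h (1, t) = q t"
    and hend: "\<And>s. s \<in> {0..1::real} \<Longrightarrow> h (s, 0) = p 0 \<and> h (s, 1) = p 1"
    using assms(1) unfolding homotopic_paths
    by (auto simp: pathstart_def pathfinish_def image_subset_iff Pi_iff)
  obtain F where F: "flat h ({0..1} \<times> {0..1}) F" using flat_exists_on_rectangle[OF h] by blast
  have row: "flat (\<lambda>t. h (s, t)) {0..1} (\<lambda>t. F (s, t))" if "s \<in> {0..1}" for s
    by (rule flat_compose[OF F]) (use that in \<open>auto intro!: continuous_intros\<close>)
  have col: "flat (\<lambda>s. h (s, t)) {0..1} (\<lambda>s. F (s, t))" if "t \<in> {0..1}" for t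
    by (rule flat_compose[OF F]) (use that in \<open>auto intro!: continuous_intros\<close>)
  have p: "path p" "path_image p \<subseteq> S" and q: "path q" "path_image q \<subseteq> S"
    using homotopic_paths_imp_path[OF assms(1)] homotopic_paths_imp_subset[OF assms(1)] by auto
  have Fp: "flat p {0..1} (\<lambda>t. F (0, t))" using row[of 0] by (rule flat_cong) (simp_all add: h01)
  have Fq: "flat q {0..1} (\<lambda>t. F (1, t))" using row[of 1] by (rule flat_cong) (simp_all add: h01)
  have q01: "q 0 = p 0" "q 1 = p 1" using hend[of 1] h01(2)[of 0] h01(2)[of 1] by simp_all
  have "flat (\<lambda>s. p 0) {0..1} (\<lambda>s. F (s, 0))" using col[of 0] by (rule flat_cong) (simp_all add: hend)
  then have "F (0, 0) i = F (1, 0) i" by (rule flat_along_constant[rotated]) (use ends in auto)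
  moreover have "flat (\<lambda>s. p 1) {0..1} (\<lambda>s. F (s, 1))" using col[of 1] by (rule flat_cong) (simp_all add: hend)
  then have "F (0, 1) j = F (1, 1) j" by (rule flat_along_constant[rotated]) (use ends in auto)
  ultimately show ?thesis
    using hol_eq[OF p Fp ends] hol_eq[OF q Fq] ends q01 by simp
qed

lemma hol_in_chart:
  assumes p: "path p" "path_image p \<subseteq> V i" and "p 1 \<in> V j"
  shows "hol p i j = c i j (p 1)"
proof -
  have "flat p {0..1} (\<lambda>t j. c i j (p t))"
    by (rule flat_chart) (use p in \<open>auto simp: path_def path_image_def\<close>)
  moreover have ends: "p 0 \<in> V i" "p 1 \<in> V i" using p(2) by (auto simp: path_image_def)
  moreover have "path_image p \<subseteq> S" using p(2) chart_subset by blast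
  ultimately have "hol p i j = inv (c i i (p 0)) \<otimes> c i j (p 1)"
    using hol_eq[OF p(1)] assms(3) by blast
  then show ?thesis using cocycle_refl[OF ends(1)] cocycle_closed[OF ends(2) assms(3)] by simp
qed

proposition holonomy_representation:
  assumes "x0 \<in> V i"
  shows "\<exists>\<Phi>\<in>hom (fundamental_group S x0) H. \<forall>p\<in>loops_at S x0. \<Phi> (path_class S p) = hol p i i"
proof -
  define \<Phi> where "\<Phi> = (\<lambda>A. hol (SOME p. p \<in> A) i i)"
  have \<Phi>: "\<Phi> (path_class S p) = hol p i i" if p: "p \<in> loops_at S x0" for p
  proof -
    have "(SOME q. q \<in> path_class S p) \<in> path_class S p"
      using someI[of "\<lambda>q. q \<in> path_class S p", OF path_class_self[OF p]] .
    then have "homotopic_paths S p (SOME q. q \<in> path_class S p)" by (simp add: path_class_def)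
    then show ?thesis
      using hol_homotopic[of p _ i i] p assms by (simp add: \<Phi>_def loops_at_def pathstart_def pathfinish_def)
  qed
  have C: "carrier (fundamental_group S x0) = path_class S ` loops_at S x0"
    by (simp add: fundamental_group_def)
  have "\<Phi> \<in> hom (fundamental_group S x0) H"
  proof (rule homI)
    fix A assume "A \<in> carrier (fundamental_group S x0)"
    then obtain p where p: "p \<in> loops_at S x0" "A = path_class S p" by (auto simp: C)
    then show "\<Phi> A \<in> carrier H"
      using \<Phi>[OF p(1)] hol_closed[of p i i] assms by (simp add: loops_at_def pathstart_def pathfinish_def)
    fix B assume "B \<in> carrier (fundamental_group S x0)"
    then obtain q where q: "q \<in> loops_at S x0" "B = path_class S q" by (auto simp: C)
    show "\<Phi> (A \<otimes>\<^bsub>fundamental_group S x0\<^esub> B) = \<Phi> A \<otimes> \<Phi> B"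
      using p q \<Phi> loops_at_join[OF p(1) q(1)] hol_join[of p q i i i] assms
      by (simp add: mult_path_class loops_at_def pathstart_def pathfinish_def)
  qed
  then show ?thesis using \<Phi> by blast
qed

end

section \<open>Homotopies and lassos\<close>

lemma homotopic_images_of_convex:
  fixes D :: "'b::real_normed_vector set" and f :: "'b \<Rightarrow> 'a::topological_space"
  assumes D: "convex D" and f: "continuous_on D f" "f ` D \<subseteq> S"
    and p: "path p" "path_image p \<subseteq> D" and r: "path r" "path_image r \<subseteq> D"
    and ends: "pathstart r = pathstart p" "pathfinish r = pathfinish p"
  shows "homotopic_paths S (f \<circ> p) (f \<circ> r)"
proof (rule homotopic_paths_continuous_image)
  show "homotopic_paths D p r"
    using convex_imp_simply_connected[OF D] p r ends
    unfolding simply_connected_eq_homotopic_paths by auto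
qed (use f in auto)

lemma homotopic_reparametrizations:
  assumes p: "path p" "path_image p \<subseteq> S"
    and r: "path r" "path_image r \<subseteq> {0..1}" and r': "path r'" "path_image r' \<subseteq> {0..1}"
    and ends: "pathstart r' = pathstart r" "pathfinish r' = pathfinish r"
  shows "homotopic_paths S (p \<circ> r) (p \<circ> r')"
  using p by (intro homotopic_images_of_convex[of "{0..1}"] r r' ends) (auto simp: path_def path_image_def)

lemma compose_linepath_01: "p \<circ> linepath 0 1 = (p :: real \<Rightarrow> 'a)"
  by (auto simp: linepath_def)

lemma homotopic_reverse_join:
  assumes p: "path p" "path_image p \<subseteq> S"
  shows "homotopic_paths S (reversepath p +++ p) (\<lambda>_. pathfinish p)"
proof -
  have "homotopic_paths S (p \<circ> (linepath 1 0 +++ linepath 0 1)) (p \<circ> linepath 1 1)"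
    by (rule homotopic_reparametrizations[OF p])
      (auto simp: path_image_join closed_segment_eq_real_ivl)
  moreover have "p \<circ> linepath 1 0 = reversepath p" "p \<circ> linepath 1 1 = (\<lambda>_. pathfinish p)"
    by (auto simp: reversepath_def linepath_def pathfinish_def fun_eq_iff)
  ultimately show ?thesis by (simp add: path_compose_join compose_linepath_01)
qed

lemma homotopic_const_join:
  assumes p: "path p" "path_image p \<subseteq> S"
  shows "homotopic_paths S ((\<lambda>_. pathstart p) +++ p) p"
    and "homotopic_paths S (p +++ (\<lambda>_. pathfinish p)) p"
proof -
  have "homotopic_paths S (p \<circ> (linepath 0 0 +++ linepath 0 1)) (p \<circ> linepath 0 1)"
    "homotopic_paths S (p \<circ> (linepath 0 1 +++ linepath 1 1)) (p \<circ> linepath 0 1)"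
    by (rule homotopic_reparametrizations[OF p];
        auto simp: path_image_join closed_segment_eq_real_ivl)+
  moreover have "p \<circ> linepath 0 0 = (\<lambda>_. pathstart p)" "p \<circ> linepath 1 1 = (\<lambda>_. pathfinish p)"
    by (auto simp: linepath_def pathfinish_def pathstart_def fun_eq_iff)
  ultimately show "homotopic_paths S ((\<lambda>_. pathstart p) +++ p) p"
    "homotopic_paths S (p +++ (\<lambda>_. pathfinish p)) p"
    by (simp_all add: path_compose_join compose_linepath_01)
qed

lemma homotopic_cancel:
  assumes p: "path p" "path_image p \<subseteq> S" and r: "path r" "path_image r \<subseteq> S"
    and s: "path s" "path_image s \<subseteq> S"
    and ends: "pathfinish p = pathfinish r" "pathstart s = pathfinish r"
  shows "homotopic_paths S ((p +++ reversepath r) +++ (r +++ s)) (p +++ s)"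
proof -
  have 1: "homotopic_paths S (reversepath r +++ (r +++ s)) ((reversepath r +++ r) +++ s)"
    using r s ends by (intro homotopic_paths_assoc) auto
  have 2: "homotopic_paths S ((reversepath r +++ r) +++ s) ((\<lambda>_. pathstart s) +++ s)"
    using homotopic_reverse_join[OF r] r s ends
    by (intro homotopic_paths_join) (auto simp: homotopic_paths_refl)
  have "homotopic_paths S (reversepath r +++ (r +++ s)) s"
    using homotopic_paths_trans[OF homotopic_paths_trans[OF 1 2] homotopic_const_join(1)[OF s]] .
  then have 3: "homotopic_paths S (p +++ (reversepath r +++ (r +++ s))) (p +++ s)"
    using p r s ends by (intro homotopic_paths_join) (auto simp: homotopic_paths_refl)
  have "homotopic_paths S (p +++ (reversepath r +++ (r +++ s))) ((p +++ reversepath r) +++ (r +++ s))"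
    using p r s ends by (intro homotopic_paths_assoc) (auto simp: path_image_join)
  then show ?thesis using 3 homotopic_paths_sym homotopic_paths_trans by blast
qed

text \<open>
  In the square, the path along bottom and right side is homotopic to the one along left side and top, and
  the top is mapped to a point.
\<close>
lemma homotopic_across_square:
  fixes h :: "real \<times> real \<Rightarrow> 'a::topological_space"
  assumes h: "continuous_on ({0..1} \<times> {0..1}) h" "h ` ({0..1} \<times> {0..1}) \<subseteq> S"
    and top: "\<And>t. t \<in> {0..1} \<Longrightarrow> h (t, 1) = y"
  shows "homotopic_paths S ((\<lambda>t. h (t, 0)) +++ (\<lambda>s. h (1, s))) (\<lambda>s. h (0, s))"
proof -
  let ?D = "{0..1} \<times> {0..1} :: (real \<times> real) set"
  let ?seg = "\<lambda>a b :: real \<times> real. linepath a b"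
  have D: "convex ?D" by (intro convex_Times) auto
  have seg: "path (?seg a b) \<and> path_image (?seg a b) \<subseteq> ?D" if "a \<in> ?D" "b \<in> ?D" for a b
    using that D by (auto simp: closed_segment_subset)
  have hom: "homotopic_paths S (h \<circ> (?seg (0,0) (1,0) +++ ?seg (1,0) (1,1))) (h \<circ> (?seg (0,0) (0,1) +++ ?seg (0,1) (1,1)))"
  proof (rule homotopic_images_of_convex[OF D h])
    show "path_image (?seg (0,0) (1,0) +++ ?seg (1,0) (1,1)) \<subseteq> ?D"
      using seg[of "(0,0)" "(1,0)"] seg[of "(1,0)" "(1,1)"] by (subst path_image_join) auto
    show "path_image (?seg (0,0) (0,1) +++ ?seg (0,1) (1,1)) \<subseteq> ?D"
      using seg[of "(0,0)" "(0,1)"] seg[of "(0,1)" "(1,1)"] by (subst path_image_join) auto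
  qed auto
  have sides: "h \<circ> ?seg (0,0) (1,0) = (\<lambda>t. h (t, 0))" "h \<circ> ?seg (1,0) (1,1) = (\<lambda>s. h (1, s))"
    "h \<circ> ?seg (0,0) (0,1) = (\<lambda>s. h (0, s))"
    by (auto simp: linepath_def)
  have left: "path (\<lambda>s. h (0, s))" "path_image (\<lambda>s. h (0, s)) \<subseteq> S"
    unfolding path_def path_image_def
    using h(2) by (auto intro!: continuous_on_compose2[OF h(1)] continuous_intros)
  have "homotopic_paths S ((\<lambda>s. h (0, s)) +++ (h \<circ> ?seg (0,1) (1,1))) ((\<lambda>s. h (0, s)) +++ (\<lambda>_. h (0, 1)))"
  proof (rule homotopic_paths_join)
    have "path (h \<circ> ?seg (0,1) (1,1))"
      using seg[of "(0,1)" "(1,1)"] h(1) by (intro path_continuous_image) (auto intro: continuous_on_subset)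
    moreover have "path_image (h \<circ> ?seg (0,1) (1,1)) \<subseteq> S"
      using seg[of "(0,1)" "(1,1)"] h(2) by (auto simp: path_image_compose)
    ultimately show "homotopic_paths S (h \<circ> ?seg (0,1) (1,1)) (\<lambda>_. h (0, 1))"
      by (rule homotopic_paths_eq) (auto simp: linepath_def top)
  qed (use left in \<open>auto simp: homotopic_paths_refl pathstart_def pathfinish_def linepath_def\<close>)
  moreover have "homotopic_paths S ((\<lambda>s. h (0, s)) +++ (\<lambda>_. h (0, 1))) (\<lambda>s. h (0, s))"
    using homotopic_const_join(2)[OF left] by (simp add: pathfinish_def)
  ultimately show ?thesis
    using hom[unfolded path_compose_join sides] by (blast intro: homotopic_paths_trans)
qed

locale pointed_space =
  fixes S :: "'a::topological_space set" and x0 :: 'a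
  assumes base_in: "x0 \<in> S"
begin

abbreviation \<pi> where "\<pi> \<equiv> fundamental_group S x0"

sublocale \<pi>: group \<pi>
  by (rule group_fundamental_group[OF base_in])

definition arc_from_base :: "(real \<Rightarrow> 'a) \<Rightarrow> bool" where
  "arc_from_base p \<longleftrightarrow> path p \<and> path_image p \<subseteq> S \<and> pathstart p = x0"

text \<open>
  Two arcs from the base point to a common end point form a loop. Products, inverses and moves of the end point are
  then formal, so every loop below is presented in this way.
\<close>
definition lasso :: "(real \<Rightarrow> 'a) \<Rightarrow> (real \<Rightarrow> 'a) \<Rightarrow> (real \<Rightarrow> 'a) set" where
  "lasso p r = path_class S (p +++ reversepath r)"

lemma lasso_loop:
  assumes "arc_from_base p" "arc_from_base r" "pathfinish p = pathfinish r"
  shows "p +++ reversepath r \<in> loops_at S x0"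
  using assms by (auto simp: arc_from_base_def loops_at_def path_image_join)

lemma lasso_closed:
  assumes "arc_from_base p" "arc_from_base r" "pathfinish p = pathfinish r"
  shows "lasso p r \<in> carrier \<pi>"
  using lasso_loop[OF assms] by (simp add: lasso_def fundamental_group_def)

lemma lasso_mult:
  assumes "arc_from_base p" "arc_from_base r" "arc_from_base s"
    and "pathfinish p = pathfinish r" "pathfinish r = pathfinish s"
  shows "lasso p r \<otimes>\<^bsub>\<pi>\<^esub> lasso r s = lasso p s"
proof -
  have "lasso p r \<otimes>\<^bsub>\<pi>\<^esub> lasso r s = path_class S ((p +++ reversepath r) +++ (r +++ reversepath s))"
    unfolding lasso_def using assms by (intro mult_path_class lasso_loop) auto
  also have "\<dots> = path_class S (p +++ reversepath s)"
    using assms by (intro path_class_eq homotopic_cancel) (auto simp: arc_from_base_def)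
  finally show ?thesis by (simp add: lasso_def)
qed

lemma lasso_refl: "arc_from_base p \<Longrightarrow> lasso p p = \<one>\<^bsub>\<pi>\<^esub>"
  using lasso_mult[of p p p] lasso_closed[of p p] by simp

lemma lasso_inv:
  assumes "arc_from_base p" "arc_from_base r" "pathfinish p = pathfinish r"
  shows "inv\<^bsub>\<pi>\<^esub> (lasso p r) = lasso r p"
  using assms by (intro \<pi>.inv_equality) (auto simp: lasso_mult lasso_refl lasso_closed)

lemma lasso_cong:
  assumes "homotopic_paths S p p'" "homotopic_paths S r r'" "pathfinish p = pathfinish r"
  shows "lasso p r = lasso p' r'"
  unfolding lasso_def using assms
  by (intro path_class_eq homotopic_paths_join homotopic_paths_reversepath_D) auto

lemma arc_from_base_join:
  assumes "arc_from_base p" "path r" "path_image r \<subseteq> S" "pathstart r = pathfinish p"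
  shows "arc_from_base (p +++ r)"
  using assms by (auto simp: arc_from_base_def path_image_join)

text \<open>
  The end point common to both arcs can be moved freely.
\<close>
lemma lasso_extend:
  assumes "arc_from_base p" "arc_from_base r" "pathfinish p = pathfinish r"
    and s: "path s" "path_image s \<subseteq> S" "pathstart s = pathfinish p"
  shows "lasso (p +++ s) (r +++ s) = lasso p r"
proof -
  have "homotopic_paths S ((p +++ reversepath (reversepath s)) +++ (reversepath s +++ reversepath r)) (p +++ reversepath r)"
    using assms by (intro homotopic_cancel) (auto simp: arc_from_base_def)
  then show ?thesis
    using assms by (simp add: lasso_def reversepath_joinpaths path_class_eq)
qed

end

section \<open>The unrolled polygon\<close>

locale glued_polygon =
  fixes g :: nat and S :: "'a::topological_space set" and q :: "complex \<Rightarrow> 'a"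
  assumes g_pos: "1 \<le> g"
    and q_quotient: "quotient_map (top_of_set (cball 0 1)) (top_of_set S) q"
    and q_fibres: "z \<in> cball 0 1 \<Longrightarrow> w \<in> cball 0 1 \<Longrightarrow> q z = q w \<longleftrightarrow> equivclp (side_pairing g) z w"
begin

definition \<kappa> :: real where "\<kappa> = 2 * pi / real (4 * g)"

text \<open>
  The exponential unrolls the punctured disc to a half-plane, scaled such that sides have unit length: the side
  \<open>k\<close> corresponds to imaginary parts in \<open>[k, k + 1]\<close>.
\<close>
definition wrap :: "complex \<Rightarrow> complex" where "wrap w = exp (of_real \<kappa> * w)"

definition period :: complex where "period = of_real (4 * real g) * \<i>"

definition rim :: "real \<Rightarrow> complex" where "rim u = wrap (\<i> * of_real u)"

text \<open>
  The surface without the centre of the polygon, as a quotient of the left half-plane \<open>L\<close>.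
\<close>
definition Q :: "complex \<Rightarrow> 'a" where "Q w = q (wrap w)"

text \<open>
  The sides carrying the letters \<open>a\<^sub>j\<close> and \<open>b\<^sub>j\<close>; side \<open>k\<close> of this kind is glued to side \<open>k + 2\<close>.
\<close>
definition base_side :: "nat \<Rightarrow> bool" where "base_side k \<longleftrightarrow> k < 4 * g \<and> k mod 4 < 2"

abbreviation L :: "complex set" where "L \<equiv> {w. Re w \<le> 0}"

lemma \<kappa>_pos: "0 < \<kappa>" and \<kappa>_period: "\<kappa> * (4 * real g) = 2 * pi"
  using g_pos by (simp_all add: \<kappa>_def)

lemma Re_period [simp]: "Re period = 0" and Im_period [simp]: "Im period = real (4 * g)"
  by (simp_all add: period_def)

lemma norm_wrap: "norm (wrap w) = exp (\<kappa> * Re w)"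
  by (simp add: wrap_def)

lemma wrap_in_disc: "wrap w \<in> cball 0 1 \<longleftrightarrow> w \<in> L"
  using \<kappa>_pos by (simp add: norm_wrap mult_le_0_iff)

lemma norm_wrap_less_1: "norm (wrap w) < 1 \<longleftrightarrow> Re w < 0"
  using \<kappa>_pos by (simp add: norm_wrap mult_less_0_iff)

lemma wrap_nonzero [simp]: "wrap w \<noteq> 0"
  by (simp add: wrap_def)

lemma wrap_eq_iff: "wrap w = wrap w' \<longleftrightarrow> (\<exists>n::int. w = w' + of_int n * period)"
proof -
  have "of_real \<kappa> * w = of_real \<kappa> * w' + (of_int (2 * n) * pi) * \<i> \<longleftrightarrow>
      w = w' + of_int n * period" for n
  proof -
    have "of_real \<kappa> * (of_int n * period) = of_int n * (of_real (\<kappa> * (4 * real g)) * \<i>)"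
      by (simp add: period_def)
    also have "\<dots> = (of_int (2 * n) * pi) * \<i>" unfolding \<kappa>_period by simp
    finally have "of_real \<kappa> * w' + (of_int (2 * n) * pi) * \<i> = of_real \<kappa> * (w' + of_int n * period)"
      by (simp only: distrib_left)
    then show ?thesis using \<kappa>_pos by (simp only: mult_cancel_left) simp
  qed
  then show ?thesis unfolding wrap_def exp_eq by simp
qed

lemma wrap_surj:
  assumes "z \<noteq> 0" shows "\<exists>w. wrap w = z"
  using assms \<kappa>_pos by (intro exI[of _ "Ln z / of_real \<kappa>"]) (simp add: wrap_def)

lemma rim_cis: "rim u = cis (\<kappa> * u)"
  by (simp add: rim_def wrap_def cis_conv_exp mult_ac)

lemma polygon_side_eq: "polygon_side g k s = rim (real k + s)"
  unfolding polygon_side_def rim_cis \<kappa>_def by simp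

lemma norm_rim [simp]: "norm (rim u) = 1"
  by (simp add: rim_def norm_wrap)

lemma rim_in_disc [simp]: "rim u \<in> cball 0 1"
  by simp

lemma rim_periodic: "rim (u + real (4 * g)) = rim u"
  unfolding rim_def wrap_eq_iff by (rule exI[of _ 1]) (simp add: period_def distrib_left mult_ac)

lemma continuous_on_wrap: "continuous_on A wrap"
  unfolding wrap_def by (intro continuous_intros)

lemma continuous_on_rim: "continuous_on A rim"
  unfolding rim_def by (intro continuous_intros continuous_on_compose2[OF continuous_on_wrap]) auto

text \<open>
  In the coordinate along the rim, both kinds of gluing are the same reflection \<open>u \<mapsto> 2 k + 3 - u\<close>.
\<close>
lemma side_pairing_iff:
  "side_pairing g z w \<longleftrightarrow>
    (\<exists>k s. base_side k \<and> s \<in> {0..1} \<and> z = rim (real k + s) \<and> w = rim (real k + 3 - s))"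
proof
  assume "side_pairing g z w"
  then show "\<exists>k s. base_side k \<and> s \<in> {0..1} \<and> z = rim (real k + s) \<and> w = rim (real k + 3 - s)"
  proof cases
    case (a_sides j s)
    then show ?thesis
      by (intro exI[of _ "4 * j"] exI[of _ s]) (auto simp: base_side_def polygon_side_eq algebra_simps mod_Suc)
  next
    case (b_sides j s)
    then show ?thesis
      by (intro exI[of _ "4 * j + 1"] exI[of _ s]) (auto simp: base_side_def polygon_side_eq mod_Suc algebra_simps)
  qed
next
  assume "\<exists>k s. base_side k \<and> s \<in> {0..1} \<and> z = rim (real k + s) \<and> w = rim (real k + 3 - s)"
  then obtain k s where k: "base_side k" and s: "s \<in> {0..1}"
    and zw: "z = rim (real k + s)" "w = rim (real k + 3 - s)" by blast
  define j where "j = k div 4"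
  have j: "j < g" using k by (simp add: base_side_def j_def less_mult_imp_div_less)
  have "k mod 4 < 2" using k by (simp add: base_side_def)
  then have "k = 4 * j \<or> k = 4 * j + 1" unfolding j_def by presburger
  then show "side_pairing g z w"
  proof
    assume "k = 4 * j"
    then show ?thesis using side_pairing.a_sides[OF j s] zw by (simp add: polygon_side_eq algebra_simps)
  next
    assume "k = 4 * j + 1"
    then show ?thesis using side_pairing.b_sides[OF j s] zw by (simp add: polygon_side_eq algebra_simps)
  qed
qed

lemma q_glue: "base_side k \<Longrightarrow> s \<in> {0..1} \<Longrightarrow> q (rim (real k + s)) = q (rim (real k + 3 - s))"
  by (subst q_fibres, simp, simp, rule r_into_equivclp, unfold side_pairing_iff) blast

lemma q_surj: "q ` cball 0 1 = S"
  using q_quotient by (simp add: quotient_map_def)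

lemma openin_iff_q:
  "U \<subseteq> S \<Longrightarrow> openin (top_of_set S) U \<longleftrightarrow> openin (top_of_set (cball 0 1)) {z \<in> cball 0 1. q z \<in> U}"
  using q_quotient by (simp add: quotient_map_def)

lemma q_in: "z \<in> cball 0 1 \<Longrightarrow> q z \<in> S"
  using q_surj by blast

lemma continuous_on_q: "continuous_on (cball 0 1) q"
  using quotient_imp_continuous_map[OF q_quotient] by simp

lemma q_interior_inj:
  assumes "q z = q w" "norm z < 1" "w \<in> cball 0 1"
  shows "w = z"
proof -
  have "equivclp (side_pairing g) z w" using assms by (subst q_fibres[symmetric]) auto
  then show ?thesis
  proof (induction rule: equivclp_induct)
    case (step y w)
    then have "norm z = 1" using step by (auto simp: side_pairing_iff)
    then show ?case using assms by simp
  qed simp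
qed

lemma Q_in: "w \<in> L \<Longrightarrow> Q w \<in> S"
  using q_in wrap_in_disc by (simp add: Q_def)

lemma Q_not_centre: "w \<in> L \<Longrightarrow> Q w \<noteq> q 0"
  using q_interior_inj[of 0 "wrap w"] wrap_in_disc[of w] by (metis wrap_nonzero Q_def norm_zero zero_less_one)

text \<open>
  Functions on the half-plane that are invariant under the period and under the side reflections factor
  through \<open>Q\<close>. This is the way in which everything below is descended to the surface.
\<close>
lemma Q_invariant:
  assumes per: "\<And>w. w \<in> L \<Longrightarrow> J (w + period) = J w"
    and side: "\<And>k s. base_side k \<Longrightarrow> s \<in> {0..1} \<Longrightarrow>
      J (\<i> * of_real (real k + s)) = J (\<i> * of_real (real k + 3 - s))"
    and "w \<in> L" "w' \<in> L" "Q w = Q w'"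
  shows "J w = J w'"
proof -
  have per_nat: "J (w + of_nat n * period) = J w" if "w \<in> L" for w n
  proof (induction n)
    case (Suc n)
    have "w + of_nat n * period \<in> L" using that by simp
    from per[OF this] show ?case using Suc by (simp add: algebra_simps)
  qed simp
  have per_int: "J w = J w'" if "w \<in> L" "w' \<in> L" and e: "wrap w = wrap w'" for w w'
  proof -
    obtain n where n: "w = w' + of_int n * period" using e unfolding wrap_eq_iff by blast
    show ?thesis
    proof (cases "0 \<le> n")
      case True
      then have "w = w' + of_nat (nat n) * period" using n by (simp add: of_nat_nat)
      then show ?thesis using per_nat[OF that(2)] by simp
    next
      case False
      then have "w' = w + of_nat (nat (- n)) * period" using n by (simp add: of_nat_nat)
      then show ?thesis using per_nat[OF that(1)] by simp
    qed
  qed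
  define J' where "J' = (\<lambda>z. J (SOME w. w \<in> L \<and> wrap w = z))"
  have J': "J' (wrap w) = J w" if "w \<in> L" for w
  proof -
    have "(SOME v. v \<in> L \<and> wrap v = wrap w) \<in> L \<and> wrap (SOME v. v \<in> L \<and> wrap v = wrap w) = wrap w"
      using that by (intro someI[of "\<lambda>v. v \<in> L \<and> wrap v = wrap w" w]) simp
    then show ?thesis unfolding J'_def using per_int that by blast
  qed
  have J'_bd: "J' (rim u) = J (\<i> * of_real u)" for u unfolding rim_def by (rule J') simp
  have "equivclp (side_pairing g) (wrap w) (wrap w')"
    using assms(3-5) wrap_in_disc unfolding Q_def by (subst q_fibres[symmetric]) blast+
  then have "J' (wrap w) = J' (wrap w')"
  proof (induction rule: equivclp_induct)
    case (step y z)
    then show ?case using side by (auto simp: side_pairing_iff J'_bd)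
  qed simp
  then show ?thesis using J' assms by simp
qed

lemma centre_complement_vimage: "{z \<in> cball 0 1. q z \<in> S - {q 0}} = cball 0 1 - {0}"
  using q_in q_interior_inj[of 0] by auto

lemma open_centre_complement: "openin (top_of_set S) (S - {q 0})"
proof -
  have "openin (top_of_set (cball 0 1)) (cball 0 1 - {0::complex})"
    by (auto intro: openin_open_Int simp: Diff_eq)
  then show ?thesis by (simp only: openin_iff_q[OF Diff_subset] centre_complement_vimage)
qed

text \<open>
  The exponential is an open map, being a covering, and \<open>q\<close> restricts to a quotient map over the open complement
  of the centre.
\<close>
lemma Q_quotient: "quotient_map (top_of_set L) (top_of_set (S - {q 0})) Q"
proof -
  have "open_map (top_of_set L) (top_of_set (cball 0 1 - {0})) wrap"
    unfolding open_map_def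
  proof (intro allI impI)
    fix U assume "openin (top_of_set L) U"
    then obtain W where W: "open W" "U = L \<inter> W" by (auto simp: openin_open)
    have "open ((\<lambda>w. \<kappa> *\<^sub>R w) ` W)"
      using W(1) \<kappa>_pos by (intro open_scaling) auto
    then have "openin (top_of_set (- {0})) (exp ` (\<lambda>w. \<kappa> *\<^sub>R w) ` W)"
      by (intro covering_space_open_map[OF covering_space_exp_punctured_plane]) simp
    then have "open (exp ` (\<lambda>w. \<kappa> *\<^sub>R w) ` W)"
      by (subst (asm) openin_open_eq) auto
    then have "open (wrap ` W)" by (simp add: image_image wrap_def[abs_def] scaleR_conv_of_real)
    moreover have "wrap ` U = (cball 0 1 - {0}) \<inter> wrap ` W" using W(2) wrap_in_disc by auto
    ultimately show "openin (top_of_set (cball 0 1 - {0})) (wrap ` U)" by (auto simp: openin_open)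
  qed
  moreover have "wrap ` L = cball 0 1 - {0}"
    using wrap_surj wrap_in_disc by (auto simp: image_iff) metis
  ultimately have wrap: "quotient_map (top_of_set L) (top_of_set (cball 0 1 - {0})) wrap"
    using continuous_on_wrap by (intro continuous_open_imp_quotient_map) auto
  have "quotient_map (subtopology (top_of_set (cball 0 1)) (cball 0 1 - {0})) (subtopology (top_of_set S) (S - {q 0})) q"
    using centre_complement_vimage open_centre_complement by (intro quotient_map_restriction[OF q_quotient]) auto
  then have "quotient_map (top_of_set (cball 0 1 - {0})) (top_of_set (S - {q 0})) q"
    by (simp add: subtopology_subtopology Int_absorb1 Int_Diff)
  from quotient_map_compose[OF wrap this] show ?thesis by (simp add: o_def Q_def[abs_def])
qed

lemma Q_surj: "Q ` L = S - {q 0}"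
  using Q_quotient by (simp add: quotient_map_def)

lemma openin_iff_Q:
  assumes "U \<subseteq> S - {q 0}"
  shows "openin (top_of_set S) U \<longleftrightarrow> openin (top_of_set L) {w \<in> L. Q w \<in> U}"
proof -
  have "openin (top_of_set L) {w \<in> L. Q w \<in> U} \<longleftrightarrow> openin (top_of_set (S - {q 0})) U"
    using Q_quotient assms unfolding quotient_map_def by simp
  also have "\<dots> \<longleftrightarrow> openin (top_of_set S) U"
    using open_centre_complement assms
    by (meson openin_trans openin_subset_trans Diff_subset)
  finally show ?thesis by blast
qed

end

section \<open>Three charts and their contractions\<close>

text \<open>
  The open polygon; the neighbourhood of the open edges consisting of all rays that avoid the vertices; and
  the neighbourhood of the vertex consisting of all rays that avoid the edge midpoints.
\<close>
datatype chart = Cell | Edges | Vertices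

text \<open>
  With these offsets the sectors of both boundary charts are bounded by the integral values of
  \<open>Im w + offset i\<close>: vertices have integral coordinates, edge midpoints half-integral ones.
\<close>
fun offset :: "chart \<Rightarrow> real" where
  "offset Cell = 0" | "offset Edges = 0" | "offset Vertices = 1 / 2"

context glued_polygon
begin

definition in_chart :: "chart \<Rightarrow> complex \<Rightarrow> bool" where
  "in_chart i w \<longleftrightarrow> (if i = Cell then Re w < 0 else Im w + offset i \<notin> \<int>)"

definition sector :: "chart \<Rightarrow> complex \<Rightarrow> int" where
  "sector i w = (if i = Cell then 0 else \<lfloor>Im w + offset i\<rfloor>)"

definition V :: "chart \<Rightarrow> 'a set" where
  "V i = (if i = Cell then q ` ball 0 1 else Q ` {w \<in> L. in_chart i w})"

lemma base_side_bound: "base_side k \<Longrightarrow> k + 3 \<le> 4 * g"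
  unfolding base_side_def by presburger

lemma add_of_nat_in_Ints_iff: "x + real n \<in> \<int> \<longleftrightarrow> x \<in> \<int>"
  by (metis Ints_add Ints_diff Ints_of_nat add_diff_cancel_right')

lemma in_chart_invariant:
  assumes "w \<in> L" "w' \<in> L" "Q w = Q w'"
  shows "in_chart i w = in_chart i w'"
proof (rule Q_invariant[of "in_chart i", OF _ _ assms])
  fix w
  show "in_chart i (w + period) = in_chart i w"
    using add_of_nat_in_Ints_iff[of "Im w + offset i" "4 * g"] by (simp add: in_chart_def add_ac)
next
  fix k :: nat and s :: real
  have "real k + 3 - s + offset i \<in> \<int> \<longleftrightarrow> real k + s + offset i \<in> \<int>"
  proof -
    have "2 * offset i \<in> \<int>" by (cases i) auto
    then have "real (2 * k + 3) + 2 * offset i \<in> \<int>" by (intro Ints_add) auto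
    then have sum: "(real k + 3 - s + offset i) + (real k + s + offset i) \<in> \<int>" by (simp add: algebra_simps)
    then show ?thesis by (metis Ints_diff add_diff_cancel add_diff_cancel_left')
  qed
  then show "in_chart i (\<i> * of_real (real k + s)) = in_chart i (\<i> * of_real (real k + 3 - s))"
    by (simp add: in_chart_def)
qed

lemma Q_in_chart_iff: "w \<in> L \<Longrightarrow> Q w \<in> V i \<longleftrightarrow> in_chart i w"
proof (cases "i = Cell")
  case True
  assume w: "w \<in> L"
  have "norm (wrap w) < 1" if "Q w \<in> q ` ball 0 1"
  proof -
    obtain z where z: "norm z < 1" "q z = q (wrap w)" using \<open>Q w \<in> q ` ball 0 1\<close> by (auto simp: Q_def)
    then have "wrap w = z" using q_interior_inj w wrap_in_disc by blast
    then show ?thesis using z(1) by simp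
  qed
  then have "Q w \<in> q ` ball 0 1 \<longleftrightarrow> norm (wrap w) < 1" by (auto simp: Q_def)
  then show ?thesis using True by (simp add: V_def in_chart_def norm_wrap_less_1)
next
  case False
  assume "w \<in> L"
  have "in_chart i w" if "w' \<in> L" "in_chart i w'" "Q w = Q w'" for w'
    using in_chart_invariant[OF \<open>w \<in> L\<close> that(1,3)] that(2) by simp
  then show ?thesis using False \<open>w \<in> L\<close> unfolding V_def by auto
qed

lemma centre_in_chart_iff: "q 0 \<in> V i \<longleftrightarrow> i = Cell"
proof
  show "i = Cell" if centre: "q 0 \<in> V i"
  proof (rule ccontr)
    assume "i \<noteq> Cell"
    then obtain w where "w \<in> L" "q 0 = Q w" using centre by (auto simp: V_def)
    then show False using Q_not_centre[of w] by simp
  qed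
qed (simp add: V_def)

lemma open_in_chart_sector: "open {w. i \<noteq> Cell \<and> in_chart i w \<and> sector i w = n}"
proof (cases "i = Cell")
  case False
  have "{w. in_chart i w \<and> sector i w = n} = {w. of_int n < Im w + offset i \<and> Im w + offset i < of_int n + 1}"
  proof -
    have "x \<notin> \<int> \<and> \<lfloor>x\<rfloor> = n \<longleftrightarrow> of_int n < x \<and> x < of_int n + 1" for x :: real
    proof
      assume x: "x \<notin> \<int> \<and> \<lfloor>x\<rfloor> = n"
      then have "x \<noteq> of_int n" by (metis Ints_of_int)
      then show "of_int n < x \<and> x < of_int n + 1" using x by (simp add: floor_eq_iff)
    next
      assume x: "of_int n < x \<and> x < of_int n + 1"
      then have "\<lfloor>x\<rfloor> = n" by (simp add: floor_eq_iff)
      then show "x \<notin> \<int> \<and> \<lfloor>x\<rfloor> = n" using x by (auto simp: Ints_def)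
    qed
    then show ?thesis using False by (simp add: in_chart_def sector_def)
  qed
  moreover have "open {w. of_int n < Im w + offset i \<and> Im w + offset i < of_int n + 1}"
    by (intro open_Collect_conj open_Collect_less continuous_intros)
  ultimately show ?thesis using False by simp
qed simp

lemma open_in_chart_sectors: "open {w. in_chart i w \<and> in_chart j w \<and> P (sector i w) (sector j w)}"
proof -
  have part: "open {w. in_chart l w \<and> sector l w = n}" for l n
  proof (cases "l = Cell")
    case True
    then show ?thesis by (cases "n = 0") (simp_all add: in_chart_def sector_def open_halfspace_Re_lt)
  qed (use open_in_chart_sector[of l n] in simp)
  have "{w. in_chart i w \<and> in_chart j w \<and> P (sector i w) (sector j w)} =
      (\<Union>(n, m)\<in>{(n, m). P n m}. {w. in_chart i w \<and> sector i w = n} \<inter> {w. in_chart j w \<and> sector j w = m})"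
    by auto
  then show ?thesis using part by (auto intro!: open_Int)
qed

lemma open_chart: "openin (top_of_set S) (V i)"
proof (cases "i = Cell")
  case True
  have "{z \<in> cball 0 1. q z \<in> q ` ball 0 1} = ball 0 1"
    using q_interior_inj by (auto simp: dist_norm) (metis norm_minus_cancel minus_diff_eq diff_zero)
  moreover have "openin (top_of_set (cball 0 1)) (ball (0::complex) 1)"
    using openin_open_Int[of "ball 0 1" "cball (0::complex) 1"] by (simp add: Int_absorb1 ball_subset_cball)
  moreover have "q ` ball 0 1 \<subseteq> S" using q_in by auto
  ultimately show ?thesis using True by (simp add: V_def openin_iff_q)
next
  case False
  have sub: "V i \<subseteq> S - {q 0}" using False Q_in Q_not_centre by (auto simp: V_def)
  have "{w \<in> L. Q w \<in> V i} = L \<inter> {w. in_chart i w}" using Q_in_chart_iff by auto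
  moreover have "open {w. in_chart i w}" using open_in_chart_sectors[of i i "\<lambda>_ _. True"] by simp
  ultimately show ?thesis unfolding openin_iff_Q[OF sub] by (simp add: openin_open_Int)
qed

lemma charts_cover_surface:
  assumes x: "x \<in> S" shows "\<exists>i. x \<in> V i"
proof (cases "x = q 0")
  case True
  then show ?thesis using centre_in_chart_iff by blast
next
  case False
  then have "x \<in> Q ` L" using x Q_surj by simp
  then obtain w where w: "w \<in> L" "x = Q w" by blast
  have "in_chart Edges w \<or> in_chart Vertices w"
  proof (rule ccontr)
    assume "\<not> ?thesis"
    then have "Im w + 1 / 2 - Im w \<in> \<int>" unfolding in_chart_def by (intro Ints_diff) auto
    then show False by simp
  qed
  then show ?thesis using w Q_in_chart_iff by blast
qed

lemma chart_cases:
  assumes x: "x \<in> V i" shows "x = q 0 \<and> i = Cell \<or> (\<exists>w\<in>L. x = Q w \<and> in_chart i w)"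
proof (cases "x = q 0")
  case True
  then show ?thesis using x centre_in_chart_iff by simp
next
  case False
  then have "x \<in> Q ` L" using x openin_imp_subset[OF open_chart[of i]] Q_surj by blast
  then obtain w where "w \<in> L" "x = Q w" by blast
  then show ?thesis using x Q_in_chart_iff by blast
qed

text \<open>
  The point of the rim, in the unrolled coordinate, at the middle of the sector of \<open>w\<close>: an edge midpoint or a
  vertex.
\<close>
definition centre :: "chart \<Rightarrow> complex \<Rightarrow> real" where
  "centre i w = of_int (sector i w) + 1 / 2 - offset i"

definition slide :: "chart \<Rightarrow> complex \<Rightarrow> real \<Rightarrow> complex" where
  "slide i w s = of_real (1 - s) * w + of_real s * (\<i> * of_real (centre i w))"

lemma slide_in_L: "w \<in> L \<Longrightarrow> s \<in> {0..1} \<Longrightarrow> slide i w s \<in> L"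
  by (simp add: slide_def mult_nonneg_nonpos)

lemma slide_ends [simp]: "slide i w 0 = w" "slide i w 1 = \<i> * of_real (centre i w)"
  by (simp_all add: slide_def)

lemma sector_period: "i \<noteq> Cell \<Longrightarrow> sector i (w + period) = sector i w + 4 * int g"
proof -
  assume i: "i \<noteq> Cell"
  have "\<lfloor>Im w + offset i + of_int (4 * int g)\<rfloor> = \<lfloor>Im w + offset i\<rfloor> + 4 * int g"
    by (rule floor_add_int[symmetric])
  then show ?thesis using i by (simp add: sector_def add_ac)
qed

lemma Q_period: "w \<in> L \<Longrightarrow> Q (w + period) = Q w"
  unfolding Q_def by (rule arg_cong[of _ _ q]) (auto simp: wrap_eq_iff intro!: exI[of _ "1::int"])

lemma Q_boundary: "Q (\<i> * of_real u) = q (rim u)"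
  by (simp add: Q_def rim_def)

lemma centre_reflect:
  assumes i: "i \<noteq> Cell" and in_chart: "in_chart i (\<i> * of_real (real k + s))"
  shows "centre i (\<i> * of_real (real k + 3 - s)) = 2 * real k + 3 - centre i (\<i> * of_real (real k + s))"
proof -
  define y where "y = real k + s + offset i"
  obtain m :: int where m: "of_int m = 2 * real k + 3 + 2 * offset i"
  proof (cases i)
    case Edges
    then show ?thesis by (intro that[of "2 * int k + 3"]) simp
  next
    case Vertices
    then show ?thesis by (intro that[of "2 * int k + 4"]) simp
  qed (use i in simp)
  have "y \<notin> \<int>" using in_chart i by (simp add: in_chart_def y_def)
  then have "y \<noteq> of_int \<lfloor>y\<rfloor>" by (metis Ints_of_int)
  then have "of_int \<lfloor>y\<rfloor> < y" "y < of_int \<lfloor>y\<rfloor> + 1" by linarith+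
  then have "\<lfloor>of_int m - y\<rfloor> = m - 1 - \<lfloor>y\<rfloor>"
    unfolding floor_eq_iff of_int_diff of_int_1 by linarith
  moreover have "real k + 3 - s + offset i = of_int m - y" using m by (simp add: y_def)
  moreover have idx: "sector i (\<i> * of_real (real k + s)) = \<lfloor>y\<rfloor>"
    "sector i (\<i> * of_real (real k + 3 - s)) = \<lfloor>real k + 3 - s + offset i\<rfloor>"
    using i by (simp_all add: sector_def y_def)
  ultimately have idx': "sector i (\<i> * of_real (real k + 3 - s)) = m - 1 - \<lfloor>y\<rfloor>" by (simp only:)
  show ?thesis unfolding centre_def idx(1) idx' using m by simp
qed

lemma centre_in_side:
  assumes i: "i \<noteq> Cell" and in_chart: "in_chart i (\<i> * of_real (real k + s))" and s: "s \<in> {0..1}"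
  shows "centre i (\<i> * of_real (real k + s)) \<in> {real k..real k + 1}"
proof (cases i)
  case Edges
  then have "real k + s \<notin> \<int>" using in_chart by (simp add: in_chart_def)
  then have "s \<noteq> 1" by (metis Ints_1 Ints_add Ints_of_nat)
  then have "\<lfloor>real k + s\<rfloor> = int k" using s by (simp add: floor_eq_iff)
  then show ?thesis using Edges by (simp add: centre_def sector_def)
next
  case Vertices
  have "\<lfloor>real k + s + 1 / 2\<rfloor> \<in> {int k..int k + 1}"
    using s by (simp add: le_floor_iff floor_le_iff)
  then show ?thesis using Vertices by (auto simp: centre_def sector_def)
qed (use i in simp)

text \<open>
  The contraction of a sector is affine in the unrolled coordinate and maps the rim to itself, so it commutes with the
  reflections that glue the sides.
\<close>
lemma slide_respects_gluing:
  assumes i: "i \<noteq> Cell" and w: "w \<in> L" "w' \<in> L" "Q w = Q w'" "in_chart i w" and \<sigma>: "\<sigma> \<in> {0..1}"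
  shows "Q (slide i w \<sigma>) = Q (slide i w' \<sigma>)"
proof -
  define J where "J = (\<lambda>w. if in_chart i w then Q (slide i w \<sigma>) else undefined)"
  have "J w = J w'"
  proof (rule Q_invariant[of J, OF _ _ w(1-3)])
    fix w assume w: "w \<in> L"
    have "in_chart i (w + period) = in_chart i w"
      using w by (intro in_chart_invariant) (auto simp: Q_period)
    moreover have "centre i (w + period) = centre i w + 4 * real g"
      using sector_period[OF i] by (simp add: centre_def)
    then have "slide i (w + period) \<sigma> = slide i w \<sigma> + period"
      unfolding slide_def by (simp add: period_def algebra_simps)
    ultimately show "J (w + period) = J w"
      using Q_period[OF slide_in_L[OF w \<sigma>]] by (simp add: J_def)
  next
    fix k s assume k: "base_side k" and s: "s \<in> {0..1::real}"
    let ?w = "\<i> * of_real (real k + s)" and ?w' = "\<i> * of_real (real k + 3 - s)"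
    have "Q ?w = Q ?w'" using q_glue[OF k s] by (simp only: Q_boundary)
    then have in_chart: "in_chart i ?w = in_chart i ?w'" by (intro in_chart_invariant) auto
    have "Q (slide i ?w \<sigma>) = Q (slide i ?w' \<sigma>)" if g: "in_chart i ?w"
    proof -
      \<comment> \<open>the point reached at time \<open>\<sigma>\<close>, as a parameter of the side \<open>k\<close>\<close>
      define u where "u = (1 - \<sigma>) * s + \<sigma> * (centre i ?w - real k)"
      have c: "centre i ?w - real k \<in> {0..1}" using centre_in_side[OF i g s] by simp
      have "u \<in> {0..1}"
        using convex_bound_le[of s 1 "centre i ?w - real k" "1 - \<sigma>" \<sigma>] c s \<sigma> by (simp add: u_def)
      moreover have "slide i ?w \<sigma> = \<i> * of_real (real k + u)"
        by (simp add: slide_def u_def algebra_simps)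
      moreover have "slide i ?w' \<sigma> = \<i> * of_real (real k + 3 - u)"
        unfolding slide_def centre_reflect[OF i g] by (simp add: u_def algebra_simps)
      ultimately show ?thesis using q_glue[OF k] by (simp only: Q_boundary)
    qed
    then show "J ?w = J ?w'" using in_chart by (simp add: J_def)
  qed
  then show ?thesis using w in_chart_invariant[OF w(1-3)] by (simp add: J_def)
qed

lemma continuous_on_slide:
  assumes i: "i \<noteq> Cell"
  shows "continuous_on ({w \<in> L. in_chart i w} \<times> {0..1}) (\<lambda>z. slide i (fst z) (snd z))"
proof -
  have "continuous_on {w \<in> L. in_chart i w} (\<lambda>w. centre i w)"
    unfolding continuous_on_def
  proof
    fix w assume w: "w \<in> {w \<in> L. in_chart i w}"
    have "\<forall>\<^sub>F w' in at w within {w \<in> L. in_chart i w}. w' \<in> {w'. i \<noteq> Cell \<and> in_chart i w' \<and> sector i w' = sector i w}"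
      using topological_tendstoD[OF tendsto_ident_at open_in_chart_sector] w i by blast
    then show "(centre i \<longlongrightarrow> centre i w) (at w within {w \<in> L. in_chart i w})"
      by (intro tendsto_eventually) (auto simp: centre_def elim: eventually_mono)
  qed
  then show ?thesis
    unfolding slide_def
    by (intro continuous_intros continuous_on_compose2[of "{w \<in> L. in_chart i w}" "centre i" _ fst]) auto
qed

text \<open>
  A contraction of \<open>X\<close> given upstairs descends because multiplying a quotient map with the unit interval yields a
  quotient map again. It makes any path in \<open>X\<close> homotopic to the track of its start followed by the reversed track of
  its end.
\<close>
lemma contract_along_quotient:
  assumes f: "quotient_map (top_of_set Y) (top_of_set X) f" and "X \<subseteq> S"
    and k: "continuous_on (Y \<times> {0..1}) (\<lambda>z. k (fst z) (snd z))" "\<And>y s. y \<in> Y \<Longrightarrow> s \<in> {0..1} \<Longrightarrow> k y s \<in> S"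
    and fibres: "\<And>y y' s. y \<in> Y \<Longrightarrow> y' \<in> Y \<Longrightarrow> f y = f y' \<Longrightarrow> s \<in> {0..1} \<Longrightarrow> k y s = k y' s"
    and bottom: "\<And>y. y \<in> Y \<Longrightarrow> k y 0 = f y"
    and p: "path p" "path_image p \<subseteq> X" and top: "\<And>y. y \<in> Y \<Longrightarrow> f y \<in> path_image p \<Longrightarrow> k y 1 = x1"
    and ends: "y0 \<in> Y" "y1 \<in> Y" "p 0 = f y0" "p 1 = f y1"
  shows "homotopic_paths S (p +++ k y1) (k y0)"
proof -
  let ?I = "top_of_set {0..1::real}"
  have "compact_space ?I" by (simp add: compact_space_subtopology)
  then have "locally_compact_space ?I" by (rule compact_imp_locally_compact_space)
  moreover have "Hausdorff_space ?I" by (simp add: Hausdorff_space_subtopology)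
  ultimately have qm: "quotient_map (prod_topology (top_of_set Y) ?I) (prod_topology (top_of_set X) ?I) (\<lambda>(y, s). (f y, s))"
    using f by (intro quotient_map_prod_left) auto
  have cm: "continuous_map (prod_topology (top_of_set Y) ?I) (top_of_set S) (\<lambda>(y, s). k y s)"
    using k by (auto simp: case_prod_beta)
  have inv: "(\<lambda>(y, s). k y s) z = (\<lambda>(y, s). k y s) z'"
    if "z \<in> topspace (prod_topology (top_of_set Y) ?I)" "z' \<in> topspace (prod_topology (top_of_set Y) ?I)"
      "(\<lambda>(y, s). (f y, s)) z = (\<lambda>(y, s). (f y, s)) z'" for z z'
    using that fibres[of "fst z" "fst z'" "snd z"] by (simp add: case_prod_beta mem_Times_iff)
  obtain K where K: "continuous_map (prod_topology (top_of_set X) ?I) (top_of_set S) K"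
    and K_f: "\<And>z. z \<in> topspace (prod_topology (top_of_set Y) ?I) \<Longrightarrow> K ((\<lambda>(y, s). (f y, s)) z) = (\<lambda>(y, s). k y s) z"
    by (rule quotient_map_lift_exists[OF qm cm inv]) (assumption+, rule that)
  have Kk: "K (f y, s) = k y s" if "y \<in> Y" "s \<in> {0..1}" for y s using K_f[of "(y, s)"] that by simp
  have K': "continuous_on (X \<times> {0..1}) K" "K ` (X \<times> {0..1}) \<subseteq> S" using K by (auto simp: image_subset_iff Pi_iff)
  have surj: "f ` Y = X" using f by (simp add: quotient_map_def)
  have lift: "\<exists>y\<in>Y. p t = f y" if "t \<in> {0..1}" for t
  proof -
    have "p t \<in> path_image p" using that by (simp add: path_image_def)
    then have "p t \<in> f ` Y" using p(2) surj by blast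
    then show ?thesis by blast
  qed
  define h where "h = (\<lambda>z. K (p (fst z), snd z))"
  have main: "homotopic_paths S ((\<lambda>t. h (t, 0)) +++ (\<lambda>s. h (1, s))) (\<lambda>s. h (0, s))"
  proof (rule homotopic_across_square)
    show "continuous_on ({0..1} \<times> {0..1}) h"
      unfolding h_def using p
      by (intro continuous_on_compose2[OF K'(1)] continuous_intros continuous_on_compose2[of "{0..1}" p _ fst])
        (auto simp: path_def path_image_def)
    show "h ` ({0..1} \<times> {0..1}) \<subseteq> S" unfolding h_def using p(2) K'(2) by (auto simp: path_image_def image_subset_iff)
    show "h (t, 1) = x1" if t: "t \<in> {0..1}" for t
    proof -
      obtain y where "y \<in> Y" "p t = f y" using lift[OF t] by blast
      moreover have "p t \<in> path_image p" using t by (simp add: path_image_def)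
      ultimately have "f y \<in> path_image p" by simp
      note \<open>y \<in> Y\<close> \<open>p t = f y\<close>
      moreover note \<open>f y \<in> path_image p\<close>
      ultimately show ?thesis using Kk[of y 1] top[of y] by (simp add: h_def)
    qed
  qed
  have h0: "h (t, 0) = p t" if "t \<in> {0..1}" for t
    using lift[OF that] Kk bottom by (auto simp: h_def)
  have side: "h (1, s) = k y1 s" "h (0, s) = k y0 s" if "s \<in> {0..1}" for s
    using ends Kk that by (auto simp: h_def)
  have ky: "path (k y)" "path_image (k y) \<subseteq> S" if "y \<in> Y" for y
    using that k(2) unfolding path_def path_image_def
    by (auto intro!: continuous_on_compose2[OF k(1), of _ "\<lambda>s. (y, s)", simplified] continuous_intros)
  have join: "path (p +++ k y1)" "path_image (p +++ k y1) \<subseteq> S"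
    using p \<open>X \<subseteq> S\<close> ky[OF ends(2)] bottom[OF ends(2)] ends
    by (auto simp: pathfinish_def pathstart_def path_image_join)
  have "homotopic_paths S (p +++ k y1) ((\<lambda>t. h (t, 0)) +++ (\<lambda>s. h (1, s)))"
    by (rule homotopic_paths_eq[OF join]) (auto simp: joinpaths_def h0 side)
  moreover have "homotopic_paths S (\<lambda>s. h (0, s)) (k y0)"
    by (rule homotopic_paths_sym, rule homotopic_paths_eq[OF ky[OF ends(1)]]) (auto simp: side)
  ultimately show ?thesis
    using main by (blast intro: homotopic_paths_trans)
qed

end

section \<open>Gluing loops and the surface relation\<close>

locale based_polygon = glued_polygon g S q
  for g :: nat and S :: "'a::topological_space set" and q :: "complex \<Rightarrow> 'a" +
  fixes z0 :: complex
  assumes z0: "z0 \<in> cball 0 1"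
begin

sublocale pointed_space S "q z0"
  by unfold_locales (rule q_in[OF z0])

text \<open>
  Going from the base point to the centre first makes \<open>spoke z0\<close> null-homotopic.
\<close>
definition spoke :: "complex \<Rightarrow> real \<Rightarrow> 'a" where
  "spoke z = q \<circ> (linepath z0 0 +++ linepath 0 z)"

text \<open>
  The loop that runs to a point of the rim and returns from the point glued to it.
\<close>
definition gluing_loop :: "real \<Rightarrow> real \<Rightarrow> (real \<Rightarrow> 'a) set" where
  "gluing_loop u u' = lasso (spoke (rim u)) (spoke (rim u'))"

lemma disc_segment: "a \<in> cball 0 1 \<Longrightarrow> b \<in> cball 0 1 \<Longrightarrow> path_image (linepath a b) \<subseteq> cball (0::complex) 1"
  unfolding path_image_linepath by (rule closed_segment_subset) auto

lemma q_path: "path r \<Longrightarrow> path_image r \<subseteq> cball 0 1 \<Longrightarrow> path (q \<circ> r)"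
  using continuous_on_subset[OF continuous_on_q] by (intro path_continuous_image) auto

lemma q_path_image: "path_image r \<subseteq> cball 0 1 \<Longrightarrow> path_image (q \<circ> r) \<subseteq> S"
  unfolding path_image_compose using q_surj by blast

lemma q_path_homotopic:
  assumes "path r" "path_image r \<subseteq> cball 0 1" "path r'" "path_image r' \<subseteq> cball 0 1"
    "pathstart r' = pathstart r" "pathfinish r' = pathfinish r"
  shows "homotopic_paths S (q \<circ> r) (q \<circ> r')"
  using assms q_surj by (intro homotopic_images_of_convex[of "cball 0 1"] continuous_on_q) auto

lemma spoke_base_path:
  assumes "z \<in> cball 0 1"
  shows "path (linepath z0 0 +++ linepath 0 z)" "path_image (linepath z0 0 +++ linepath 0 z) \<subseteq> cball 0 1"
  using disc_segment[OF z0, of 0] disc_segment[of 0 z] assms by (auto simp: path_image_join)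

lemma pathfinish_spoke [simp]: "pathfinish (spoke z) = q z"
  by (simp add: spoke_def pathfinish_compose)

lemma arc_spoke: "z \<in> cball 0 1 \<Longrightarrow> arc_from_base (spoke z)"
  unfolding arc_from_base_def spoke_def
  using spoke_base_path[of z] by (simp add: q_path q_path_image pathstart_compose)

lemma spoke_extend:
  assumes z: "z \<in> cball 0 1" and r: "path r" "path_image r \<subseteq> cball 0 1" "pathstart r = z"
  shows "homotopic_paths S (spoke z +++ (q \<circ> r)) (spoke (pathfinish r))"
proof -
  have "pathfinish r \<in> cball 0 1" using r(2) pathfinish_in_path_image by blast
  then show ?thesis
    unfolding spoke_def path_compose_join[symmetric]
    using spoke_base_path[OF z] spoke_base_path[of "pathfinish r"] r
    by (intro q_path_homotopic) (auto simp: path_image_join)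
qed

lemma gluing_loop_closed: "q (rim u) = q (rim u') \<Longrightarrow> gluing_loop u u' \<in> carrier \<pi>"
  unfolding gluing_loop_def by (intro lasso_closed arc_spoke) auto

lemma gluing_loop_mult: "q (rim u) = q (rim u') \<Longrightarrow> q (rim u') = q (rim u'') \<Longrightarrow> gluing_loop u u' \<otimes>\<^bsub>\<pi>\<^esub> gluing_loop u' u'' = gluing_loop u u''"
  unfolding gluing_loop_def by (intro lasso_mult arc_spoke) auto

lemma gluing_loop_inv: "q (rim u) = q (rim u') \<Longrightarrow> inv\<^bsub>\<pi>\<^esub> (gluing_loop u u') = gluing_loop u' u"
  unfolding gluing_loop_def by (intro lasso_inv arc_spoke) auto

lemma gluing_loop_refl: "gluing_loop u u = \<one>\<^bsub>\<pi>\<^esub>"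
  unfolding gluing_loop_def by (intro lasso_refl arc_spoke) auto

text \<open>
  Moving the crossing point along the side moves both end points of the spokes along the same path in the surface.
\<close>
lemma gluing_loop_along_side:
  assumes k: "base_side k" and s: "s \<in> {0..1}" "s' \<in> {0..1}"
  shows "gluing_loop (real k + s) (real k + 3 - s) = gluing_loop (real k + s') (real k + 3 - s')"
proof -
  define m where "m = (\<lambda>t::real. (1 - t) * s + t * s')"
  define r where "r = (\<lambda>t. rim (real k + m t))"
  define r' where "r' = (\<lambda>t. rim (real k + 3 - m t))"
  have m: "m t \<in> {0..1}" if "t \<in> {0..1}" for t
    using convex_bound_le[of s 1 s' "1 - t" t] s that by (simp add: m_def)
  have r: "path r" "path r'"
    unfolding path_def r_def r'_def m_def
    by (auto intro!: continuous_on_compose2[OF continuous_on_rim[of UNIV]] continuous_intros)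
  have im: "path_image r \<subseteq> cball 0 1" "path_image r' \<subseteq> cball 0 1" by (auto simp: path_image_def r_def r'_def)
  have ends: "pathstart r = rim (real k + s)" "pathfinish r = rim (real k + s')"
    "pathstart r' = rim (real k + 3 - s)" "pathfinish r' = rim (real k + 3 - s')"
    by (simp_all add: r_def r'_def m_def pathstart_def pathfinish_def)
  have rr': "homotopic_paths S (q \<circ> r) (q \<circ> r')"
    using q_glue[OF k] m by (intro homotopic_paths_eq q_path q_path_image r im) (simp add: r_def r'_def)
  have "homotopic_paths S (spoke (rim (real k + 3 - s)) +++ (q \<circ> r)) (spoke (rim (real k + 3 - s)) +++ (q \<circ> r'))"
    using arc_spoke[of "rim (real k + 3 - s)"] rr' q_glue[OF k s(1)] ends
    by (intro homotopic_paths_join) (auto simp: homotopic_paths_refl arc_from_base_def pathstart_compose)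
  then have "homotopic_paths S (spoke (rim (real k + 3 - s)) +++ (q \<circ> r)) (spoke (rim (real k + 3 - s')))"
    using spoke_extend[of "rim (real k + 3 - s)" r'] r im ends by (auto intro: homotopic_paths_trans)
  moreover have "homotopic_paths S (spoke (rim (real k + s)) +++ (q \<circ> r)) (spoke (rim (real k + s')))"
    using spoke_extend[of "rim (real k + s)" r] r im ends by auto
  ultimately have "lasso (spoke (rim (real k + s)) +++ (q \<circ> r)) (spoke (rim (real k + 3 - s)) +++ (q \<circ> r)) = gluing_loop (real k + s') (real k + 3 - s')"
    unfolding gluing_loop_def by (intro lasso_cong) simp_all
  moreover have "lasso (spoke (rim (real k + s)) +++ (q \<circ> r)) (spoke (rim (real k + 3 - s)) +++ (q \<circ> r)) = gluing_loop (real k + s) (real k + 3 - s)"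
    unfolding gluing_loop_def using r im ends q_glue[OF k s(1)]
    by (intro lasso_extend arc_spoke q_path q_path_image) (auto simp: pathstart_compose)
  ultimately show ?thesis by simp
qed

text \<open>
  The crossing point is the midpoint of the side \<open>k\<close>, glued to the midpoint of the side \<open>k + 2\<close>.
\<close>
definition crossing :: "nat \<Rightarrow> (real \<Rightarrow> 'a) set" where "crossing k = gluing_loop (real k + 1 / 2) (real k + 3 - 1 / 2)"

definition gen_a :: "nat \<Rightarrow> (real \<Rightarrow> 'a) set" where "gen_a j = crossing (4 * j)"
text \<open>
  The inverse makes the relation read off at the vertex a product of commutators.
\<close>
definition gen_b :: "nat \<Rightarrow> (real \<Rightarrow> 'a) set" where "gen_b j = inv\<^bsub>\<pi>\<^esub> crossing (4 * j + 1)"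

lemma gluing_loop_side:
  assumes "base_side k"
  shows "gluing_loop (real k) (real k + 3) = crossing k" "gluing_loop (real k + 1) (real k + 2) = crossing k"
  unfolding crossing_def using gluing_loop_along_side[OF assms, of 0 "1/2"] gluing_loop_along_side[OF assms, of 1 "1/2"]
  by (simp_all add: add_diff_eq[symmetric])

lemma crossing_closed: "base_side k \<Longrightarrow> crossing k \<in> carrier \<pi>"
  unfolding crossing_def by (intro gluing_loop_closed q_glue) auto

lemma base_sides: "j < g \<Longrightarrow> base_side (4 * j)" "j < g \<Longrightarrow> base_side (4 * j + 1)"
  by (simp_all add: base_side_def mod_Suc)

lemma vertices_glued:
  assumes "j < g"
  shows "q (rim (real (4 * j))) = q (rim (real (4 * j) + 3))" "q (rim (real (4 * j) + 1)) = q (rim (real (4 * j) + 2))"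
    "q (rim (real (4 * j) + 1)) = q (rim (real (4 * j) + 4))" "q (rim (real (4 * j) + 2)) = q (rim (real (4 * j) + 3))"
  using q_glue[OF base_sides(1)[OF assms], of 0] q_glue[OF base_sides(1)[OF assms], of 1]
    q_glue[OF base_sides(2)[OF assms], of 0] q_glue[OF base_sides(2)[OF assms], of 1]
  by (simp_all add: add_ac)

text \<open>
  Crossing a side at its end points connects corners of the polygon; four crossings lead from the corner
  \<open>4 j\<close> to the corner \<open>4 j + 4\<close>.
\<close>
lemma gluing_loop_vertices:
  assumes j: "j < g"
  shows "gluing_loop (real (4 * j)) (real (4 * j) + 3) = gen_a j" 
    "gluing_loop (real (4 * j)) (real (4 * j) + 2) = gen_a j \<otimes>\<^bsub>\<pi>\<^esub> gen_b j"
    "gluing_loop (real (4 * j)) (real (4 * j) + 1) = gen_a j \<otimes>\<^bsub>\<pi>\<^esub> gen_b j \<otimes>\<^bsub>\<pi>\<^esub> inv\<^bsub>\<pi>\<^esub> gen_a j"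
    "gluing_loop (real (4 * j)) (real (4 * j) + 4) = gen_a j \<otimes>\<^bsub>\<pi>\<^esub> gen_b j \<otimes>\<^bsub>\<pi>\<^esub> inv\<^bsub>\<pi>\<^esub> gen_a j \<otimes>\<^bsub>\<pi>\<^esub> inv\<^bsub>\<pi>\<^esub> gen_b j"
proof -
  note v = vertices_glued[OF j]
  let ?k = "real (4 * j)"
  have a: "gluing_loop ?k (?k + 3) = gen_a j" "gluing_loop (?k + 1) (?k + 2) = gen_a j"
    using gluing_loop_side[OF base_sides(1)[OF j]] by (simp_all add: gen_a_def)
  have crossing: "gluing_loop (?k + 1) (?k + 4) = crossing (4 * j + 1)" "gluing_loop (?k + 2) (?k + 3) = crossing (4 * j + 1)"
    using gluing_loop_side[OF base_sides(2)[OF j]] by (simp_all add: add_ac)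
  have inv_b: "inv\<^bsub>\<pi>\<^esub> gen_b j = crossing (4 * j + 1)" using crossing_closed[OF base_sides(2)[OF j]] by (simp add: gen_b_def)
  show 1: "gluing_loop ?k (?k + 3) = gen_a j" by (rule a)
  have "gluing_loop (?k + 3) (?k + 2) = gen_b j" using gluing_loop_inv[OF v(4)] crossing by (simp add: gen_b_def)
  then show 2: "gluing_loop ?k (?k + 2) = gen_a j \<otimes>\<^bsub>\<pi>\<^esub> gen_b j"
    using gluing_loop_mult[OF v(1) v(4)[symmetric]] 1 by simp
  have "gluing_loop (?k + 2) (?k + 1) = inv\<^bsub>\<pi>\<^esub> gen_a j" using gluing_loop_inv[OF v(2)] a by simp
  then show 3: "gluing_loop ?k (?k + 1) = gen_a j \<otimes>\<^bsub>\<pi>\<^esub> gen_b j \<otimes>\<^bsub>\<pi>\<^esub> inv\<^bsub>\<pi>\<^esub> gen_a j"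
    using gluing_loop_mult[OF trans[OF v(1) v(4)[symmetric]] v(2)[symmetric]] 2 by simp
  show "gluing_loop ?k (?k + 4) = gen_a j \<otimes>\<^bsub>\<pi>\<^esub> gen_b j \<otimes>\<^bsub>\<pi>\<^esub> inv\<^bsub>\<pi>\<^esub> gen_a j \<otimes>\<^bsub>\<pi>\<^esub> inv\<^bsub>\<pi>\<^esub> gen_b j"
    using gluing_loop_mult[OF trans[OF trans[OF v(1) v(4)[symmetric]] v(2)[symmetric]] v(3)] 3 crossing(1) inv_b by simp
qed

lemma gen_closed: "j < g \<Longrightarrow> gen_a j \<in> carrier \<pi>" "j < g \<Longrightarrow> gen_b j \<in> carrier \<pi>"
  using crossing_closed base_sides by (simp_all add: gen_a_def gen_b_def)

lemma vertex_multiple_of_4: "j \<le> g \<Longrightarrow> q (rim (real (4 * j))) = q (rim 0)"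
proof (induction j)
  case (Suc j)
  then show ?case using vertices_glued[of j] by (simp add: add_ac)
qed simp

lemma gluing_loop_surface_word:
  "j \<le> g \<Longrightarrow> surface_word \<pi> gen_a gen_b [0..<j] = gluing_loop 0 (real (4 * j))"
proof (induction j)
  case 0
  then show ?case by (simp add: gluing_loop_refl)
next
  case (Suc j)
  have "surface_word \<pi> gen_a gen_b [0..<Suc j] = surface_word \<pi> gen_a gen_b [0..<j] \<otimes>\<^bsub>\<pi>\<^esub> gluing_loop (real (4 * j)) (real (4 * j) + 4)"
    using Suc gen_closed \<pi>.surface_word_snoc[of j "[0..<j]" gen_a gen_b] gluing_loop_vertices(4)[of j] by simp
  also have "\<dots> = gluing_loop 0 (real (4 * j) + 4)"
    using Suc vertex_multiple_of_4[of j] vertices_glued[of j] by (simp add: gluing_loop_mult)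
  finally show ?case by (simp add: add_ac)
qed

text \<open>
  The corner \<open>4 g\<close> is the corner \<open>0\<close>.
\<close>
lemma relation: "surface_word \<pi> gen_a gen_b [0..<g] = \<one>\<^bsub>\<pi>\<^esub>"
proof -
  have "gluing_loop 0 (real (4 * g)) = gluing_loop 0 0" using rim_periodic[of 0] by (simp add: gluing_loop_def)
  then show ?thesis using gluing_loop_surface_word[of g] gluing_loop_refl by simp
qed

section \<open>Gluing loops generate the fundamental group\<close>

text \<open>
  If the end of \<open>p\<close> can be contracted along the polygon, the loop closed up by \<open>p\<close> becomes a loop made of two
  spokes.
\<close>
lemma lasso_transport:
  assumes z: "z \<in> cball 0 1" "z' \<in> cball 0 1"
    and p: "path p" "path_image p \<subseteq> S" "pathstart p = q z" "pathfinish p = q z'"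
    and r: "path r" "path_image r \<subseteq> cball 0 1" "pathstart r = z"
    and r': "path r'" "path_image r' \<subseteq> cball 0 1" "pathstart r' = z'"
    and square: "homotopic_paths S (p +++ (q \<circ> r')) (q \<circ> r)"
  shows "lasso (spoke z +++ p) (spoke z') = lasso (spoke (pathfinish r)) (spoke (pathfinish r'))"
proof -
  have qr: "path (q \<circ> r)" "path (q \<circ> r')" "path_image (q \<circ> r) \<subseteq> S" "path_image (q \<circ> r') \<subseteq> S"
    using r r' by (simp_all add: q_path q_path_image)
  have ends: "pathstart (q \<circ> r) = q z" "pathstart (q \<circ> r') = q z'"
    using r r' by (simp_all add: pathstart_compose)
  have fin: "q (pathfinish r') = q (pathfinish r)"
    using homotopic_paths_imp_pathfinish[OF square] by (simp add: pathfinish_compose)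
  note arcs = arc_spoke[OF z(1)] arc_spoke[OF z(2)]
  have arc: "arc_from_base (spoke z +++ p)" using arcs p by (intro arc_from_base_join) auto
  have assoc: "homotopic_paths S (spoke z +++ (p +++ (q \<circ> r'))) ((spoke z +++ p) +++ (q \<circ> r'))"
    using arcs p qr ends by (intro homotopic_paths_assoc) (auto simp: arc_from_base_def)
  have "homotopic_paths S (spoke z +++ (p +++ (q \<circ> r'))) (spoke z +++ (q \<circ> r))"
    using arcs p square ends by (intro homotopic_paths_join) (auto simp: homotopic_paths_refl arc_from_base_def)
  then have "homotopic_paths S ((spoke z +++ p) +++ (q \<circ> r')) (spoke z +++ (q \<circ> r))"
    using assoc homotopic_paths_sym homotopic_paths_trans by blast
  then have 1: "homotopic_paths S ((spoke z +++ p) +++ (q \<circ> r')) (spoke (pathfinish r))"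
    using spoke_extend[OF z(1) r] homotopic_paths_trans by blast
  have "lasso (spoke z +++ p) (spoke z') = lasso ((spoke z +++ p) +++ (q \<circ> r')) (spoke z' +++ (q \<circ> r'))"
    using p qr ends by (intro lasso_extend[symmetric] arc arcs) auto
  also have "\<dots> = lasso (spoke (pathfinish r)) (spoke (pathfinish r'))"
    by (intro lasso_cong 1 spoke_extend[OF z(2) r']) (simp add: pathfinish_compose)
  finally show ?thesis .
qed

lemma lasso_in_cell:
  assumes z: "z \<in> cball 0 1" "z' \<in> cball 0 1" and p: "path p" "path_image p \<subseteq> V Cell" "pathstart p = q z" "pathfinish p = q z'"
  shows "lasso (spoke z +++ p) (spoke z') = \<one>\<^bsub>\<pi>\<^esub>"
proof -
  have cell: "V Cell \<subseteq> S" using openin_imp_subset[OF open_chart] .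
  have ball: "y \<in> ball 0 1" if "y \<in> cball 0 1" "q y \<in> V Cell" for y
    using that q_interior_inj[of _ y] by (auto simp: V_def)
  have pre: "{y \<in> topspace (top_of_set (cball 0 1)). q y \<in> V Cell} = ball 0 1"
    using ball by (auto simp: V_def)
  have "quotient_map (subtopology (top_of_set (cball 0 1)) (ball 0 1)) (subtopology (top_of_set S) (V Cell)) q"
    using open_chart[of Cell] by (intro quotient_map_restriction[OF q_quotient pre]) simp
  then have qm: "quotient_map (top_of_set (ball 0 1)) (top_of_set (V Cell)) q"
    using cell by (simp add: subtopology_subtopology Int_absorb1 ball_subset_cball)
  have zz: "z \<in> ball 0 1" "z' \<in> ball 0 1"
    using ball[OF z(1)] ball[OF z(2)] p pathstart_in_path_image[of p] pathfinish_in_path_image[of p] by auto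
  have in_disc: "of_real (1 - s) * y \<in> cball 0 1" if "y \<in> ball 0 1" "s \<in> {0..1}" for y :: complex and s
    using that mult_mono[of "1 - s" 1 "norm y" 1] by (simp add: norm_mult del: of_real_diff)
  have square: "homotopic_paths S (p +++ (\<lambda>s. q (of_real (1 - s) * z'))) (\<lambda>s. q (of_real (1 - s) * z))"
  proof (rule contract_along_quotient[where k = "\<lambda>y s. q (of_real (1 - s) * y)", OF qm cell])
    show "continuous_on (ball 0 1 \<times> {0..1}) (\<lambda>y. q (complex_of_real (1 - snd y) * fst y))"
      using in_disc by (intro continuous_on_compose2[OF continuous_on_q] continuous_intros) auto
    show "q (of_real (1 - s) * y) = q (of_real (1 - s) * y')"
      if "y \<in> ball 0 1" "y' \<in> ball 0 1" "q y = q y'" for y y' s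
      using q_interior_inj[OF that(3)] that by auto
  qed (use p zz in_disc q_in in \<open>auto simp: pathstart_def pathfinish_def\<close>)
  have seg: "(\<lambda>s. q (of_real (1 - s) * y)) = q \<circ> linepath y 0" for y
    by (auto simp: linepath_def scaleR_conv_of_real)
  have "lasso (spoke z +++ p) (spoke z') = lasso (spoke (pathfinish (linepath z 0))) (spoke (pathfinish (linepath z' 0)))"
    using square unfolding seg using p cell z disc_segment
    by (intro lasso_transport) auto
  then show ?thesis by (simp add: lasso_refl arc_spoke)
qed

text \<open>
  Contracting the sectors turns a path inside a boundary chart into a pair of centres of sectors; the hypothesis
  \<open>central\<close> says that the path stays in one piece, so that all its points are contracted to the same point of
  the surface.
\<close>
lemma lasso_in_chart:
  assumes i: "i \<noteq> Cell" and w: "w \<in> L" "w' \<in> L"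
    and p: "path p" "path_image p \<subseteq> V i" "pathstart p = Q w" "pathfinish p = Q w'"
    and central: "\<And>w. w \<in> L \<Longrightarrow> Q w \<in> path_image p \<Longrightarrow> q (rim (centre i w)) = y"
  shows "lasso (spoke (wrap w) +++ p) (spoke (wrap w')) = gluing_loop (centre i w) (centre i w')"
proof -
  have V: "V i \<subseteq> S" using openin_imp_subset[OF open_chart] .
  have V': "V i \<subseteq> S - {q 0}" using V centre_in_chart_iff i by blast
  have pre: "{w \<in> topspace (top_of_set L). Q w \<in> V i} = {w \<in> L. in_chart i w}" using Q_in_chart_iff by auto
  have "openin (top_of_set (S - {q 0})) (V i)" using openin_subset_trans[OF open_chart V'] by blast
  then have "quotient_map (subtopology (top_of_set L) {w \<in> L. in_chart i w}) (subtopology (top_of_set (S - {q 0})) (V i)) Q"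
    by (intro quotient_map_restriction[OF Q_quotient pre]) simp
  moreover have "L \<inter> {w \<in> L. in_chart i w} = {w \<in> L. in_chart i w}" "(S - {q 0}) \<inter> V i = V i" using V' by auto
  ultimately have qm: "quotient_map (top_of_set {w \<in> L. in_chart i w}) (top_of_set (V i)) Q"
    by (simp add: subtopology_subtopology)
  have gw: "in_chart i w" "in_chart i w'"
    using p Q_in_chart_iff w pathstart_in_path_image[of p] pathfinish_in_path_image[of p] by auto
  have EQ: "q (wrap (slide i w s)) = Q (slide i w s)" for w s by (simp add: Q_def)
  have square: "homotopic_paths S (p +++ (\<lambda>s. Q (slide i w' s))) (\<lambda>s. Q (slide i w s))"
  proof (rule contract_along_quotient[where k = "\<lambda>y s. Q (slide i y s)", OF qm V])
    have "continuous_on ({w \<in> L. in_chart i w} \<times> {0..1}) (\<lambda>y. q (wrap (slide i (fst y) (snd y))))"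
      using slide_in_L wrap_in_disc
      by (intro continuous_on_compose2[OF continuous_on_q] continuous_on_compose2[OF continuous_on_wrap[of UNIV]] continuous_on_slide i) auto
    then show "continuous_on ({w \<in> L. in_chart i w} \<times> {0..1}) (\<lambda>y. Q (slide i (fst y) (snd y)))"
      by (simp add: Q_def)
    show "Q (slide i y s) \<in> S" if "y \<in> {w \<in> L. in_chart i w}" "s \<in> {0..1}" for y s
      using that slide_in_L Q_in by blast
    show "Q (slide i y s) = Q (slide i y' s)"
      if "y \<in> {w \<in> L. in_chart i w}" "y' \<in> {w \<in> L. in_chart i w}" "Q y = Q y'" "s \<in> {0..1}" for y y' s
      using that by (intro slide_respects_gluing i) auto
    show "Q (slide i v 1) = y" if "v \<in> {w \<in> L. in_chart i w}" "Q v \<in> path_image p" for v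
      using central[of v] that by (simp add: Q_boundary)
  qed (use p w gw in \<open>auto simp: pathstart_def pathfinish_def\<close>)
  have tr: "path (\<lambda>s. wrap (slide i w s))" "path_image (\<lambda>s. wrap (slide i w s)) \<subseteq> cball 0 1"
    "pathstart (\<lambda>s. wrap (slide i w s)) = wrap w" "pathfinish (\<lambda>s. wrap (slide i w s)) = rim (centre i w)" if "w \<in> L" for w
  proof -
    have "continuous_on {0..1} (slide i w)" unfolding slide_def by (intro continuous_intros)
    then show "path (\<lambda>s. wrap (slide i w s))"
      unfolding path_def by (intro continuous_on_compose2[OF continuous_on_wrap[of UNIV]]) auto
    show "path_image (\<lambda>s. wrap (slide i w s)) \<subseteq> cball 0 1"
      using slide_in_L[OF that] wrap_in_disc unfolding path_image_def by blast
  qed (simp_all add: pathstart_def pathfinish_def rim_def)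
  have "lasso (spoke (wrap w) +++ p) (spoke (wrap w')) =
      lasso (spoke (pathfinish (\<lambda>s. wrap (slide i w s)))) (spoke (pathfinish (\<lambda>s. wrap (slide i w' s))))"
  proof (rule lasso_transport)
    show "homotopic_paths S (p +++ (q \<circ> (\<lambda>s. wrap (slide i w' s)))) (q \<circ> (\<lambda>s. wrap (slide i w s)))"
      using square by (simp add: o_def Q_def)
  qed (use p V w wrap_in_disc tr in \<open>auto simp: Q_def\<close>)
  then show ?thesis using tr w by (simp add: gluing_loop_def)
qed

end

context glued_polygon
begin

text \<open>
  Numbers the pairs of glued sides by their base sides.
\<close>
definition side_class :: "int \<Rightarrow> nat" where
  "side_class n = (let k = nat (n mod int (4 * g)) in if k mod 4 < 2 then k else k - 2)"

definition piece_index :: "chart \<Rightarrow> complex \<Rightarrow> nat" where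
  "piece_index i w = (if i = Edges then side_class (sector i w) else 0)"

lemma side_class_base: "base_side k \<Longrightarrow> side_class (int k) = k" "base_side k \<Longrightarrow> side_class (int (k + 2)) = k"
proof -
  assume k: "base_side k"
  then have "k < 4 * g" "k + 2 < 4 * g" "k mod 4 < 2" "(k + 2) mod 4 \<ge> 2"
    unfolding base_side_def by presburger+
  moreover have "nat (int m mod int (4 * g)) = m mod (4 * g)" for m
    by (metis nat_int zmod_int)
  ultimately show "side_class (int k) = k" "side_class (int (k + 2)) = k"
    unfolding side_class_def Let_def by (simp_all only: mod_less) simp_all
qed

lemma piece_index_invariant:
  assumes w: "w \<in> L" "w' \<in> L" "Q w = Q w'" "in_chart i w"
  shows "piece_index i w = piece_index i w'"
proof (cases "i = Edges")
  case i: True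
  define J where "J = (\<lambda>w. if in_chart Edges w then side_class (sector Edges w) else 0)"
  have "J w = J w'"
  proof (rule Q_invariant[of J, OF _ _ w(1-3)])
    fix w assume "w \<in> L"
    then have "in_chart Edges (w + period) = in_chart Edges w" by (intro in_chart_invariant) (auto simp: Q_period)
    then show "J (w + period) = J w" by (simp add: J_def sector_period side_class_def)
  next
    fix k s assume k: "base_side k" and s: "s \<in> {0..1::real}"
    let ?w = "\<i> * of_real (real k + s)" and ?w' = "\<i> * of_real (real k + 3 - s)"
    have "Q ?w = Q ?w'" using q_glue[OF k s] by (simp only: Q_boundary)
    then have in_chart: "in_chart Edges ?w = in_chart Edges ?w'" by (intro in_chart_invariant) auto
    have "sector Edges ?w = int k" "sector Edges ?w' = int (k + 2)" if "in_chart Edges ?w"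
    proof -
      have "s \<noteq> 0" "s \<noteq> 1" using that by (auto simp: in_chart_def)
      then show "sector Edges ?w = int k" "sector Edges ?w' = int (k + 2)"
        using s by (simp_all add: sector_def floor_eq_iff)
    qed
    then show "J ?w = J ?w'" using in_chart side_class_base[OF k] by (simp add: J_def)
  qed
  then show ?thesis using w in_chart_invariant[OF w(1-3)] i by (simp add: J_def piece_index_def)
qed (simp add: piece_index_def)

text \<open>
  The edge chart falls into one open strip for each pair of sides, whereas the vertex chart is in one piece.
\<close>
definition piece :: "chart \<Rightarrow> nat \<Rightarrow> 'a set" where
  "piece i m = Q ` {w \<in> L. in_chart i w \<and> piece_index i w = m}"

lemma Q_in_piece_iff: "w \<in> L \<Longrightarrow> Q w \<in> piece i m \<longleftrightarrow> in_chart i w \<and> piece_index i w = m"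
proof
  assume w: "w \<in> L" and "Q w \<in> piece i m"
  then obtain v where v: "v \<in> L" "in_chart i v" "piece_index i v = m" "Q w = Q v" by (auto simp: piece_def)
  then show "in_chart i w \<and> piece_index i w = m"
    using in_chart_invariant[OF w v(1,4)] piece_index_invariant[OF w v(1,4)] by simp
qed (auto simp: piece_def)

lemma open_piece:
  assumes "i \<noteq> Cell" shows "openin (top_of_set S) (piece i m)"
proof -
  have sub: "piece i m \<subseteq> S - {q 0}" using Q_in Q_not_centre by (auto simp: piece_def)
  have "{w \<in> L. Q w \<in> piece i m} = L \<inter> {w. in_chart i w \<and> in_chart i w \<and> (if i = Edges then side_class (sector i w) else 0) = m}"
    using Q_in_piece_iff by (auto simp: piece_index_def)
  moreover have "open {w. in_chart i w \<and> in_chart i w \<and> (if i = Edges then side_class (sector i w) else 0) = m}"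
    by (rule open_in_chart_sectors)
  ultimately show ?thesis unfolding openin_iff_Q[OF sub] by (simp add: openin_open_Int)
qed

lemma piece_subset_chart: "i \<noteq> Cell \<Longrightarrow> piece i m \<subseteq> V i"
  by (auto simp: piece_def V_def)

lemma rim_mod: "rim (of_int n + u) = rim (real (nat (n mod int (4 * g))) + u)"
proof -
  have "of_int n + u = real (nat (n mod int (4 * g))) + u + of_int (n div int (4 * g)) * real (4 * g)"
  proof -
    have "n = n mod int (4 * g) + (n div int (4 * g)) * int (4 * g)"
      by (rule mod_div_mult_eq[symmetric])
    then have "real_of_int n = of_int (n mod int (4 * g)) + of_int (n div int (4 * g)) * real (4 * g)"
      by (metis of_int_add of_int_mult of_int_of_nat_eq)
    moreover have "0 \<le> n mod int (4 * g)" using g_pos by simp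
    ultimately show ?thesis by simp
  qed
  then show ?thesis
    unfolding rim_def wrap_eq_iff
    by (intro exI[of _ "n div int (4 * g)"]) (simp add: period_def algebra_simps)
qed

end

context based_polygon
begin

lemma gluing_loop_cong: "rim u = rim v \<Longrightarrow> rim u' = rim v' \<Longrightarrow> gluing_loop u u' = gluing_loop v v'"
  by (simp add: gluing_loop_def)

lemma crossing_generated:
  assumes K: "subgroup K \<pi>" "\<And>j. j < g \<Longrightarrow> gen_a j \<in> K \<and> gen_b j \<in> K" and k: "base_side k"
  shows "crossing k \<in> K"
proof -
  define j where "j = k div 4"
  have j: "j < g" using k by (simp add: base_side_def j_def less_mult_imp_div_less)
  have "k mod 4 < 2" using k by (simp add: base_side_def)
  then have "k = 4 * j \<or> k = 4 * j + 1" unfolding j_def by presburger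
  then show ?thesis
  proof
    assume "k = 4 * j"
    then show ?thesis using K(2)[OF j] by (simp add: gen_a_def)
  next
    assume kj: "k = 4 * j + 1"
    have "inv\<^bsub>\<pi>\<^esub> gen_b j = crossing k" using crossing_closed[OF k] by (simp add: gen_b_def kj)
    then show ?thesis using K(2)[OF j] subgroup.m_inv_closed[OF K(1)] by metis
  qed
qed

lemma gluing_loop_edge_midpoints:
  assumes K: "subgroup K \<pi>" "\<And>j. j < g \<Longrightarrow> gen_a j \<in> K \<and> gen_b j \<in> K"
    and same: "side_class n = side_class n'"
  shows "q (rim (of_int n + 1 / 2)) = q (rim (real (side_class n) + 1 / 2))"
    and "gluing_loop (of_int n + 1 / 2) (of_int n' + 1 / 2) \<in> K"
proof -
  define k where "k = side_class n"
  have *: "base_side (side_class n) \<and> (rim (of_int n + 1 / 2) = rim (real (side_class n) + 1 / 2) \<or>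
      rim (of_int n + 1 / 2) = rim (real (side_class n) + 3 - 1 / 2))" for n
  proof -
    define r where "r = nat (n mod int (4 * g))"
    have r: "r < 4 * g" using g_pos by (simp add: r_def nat_less_iff)
    have rim: "rim (of_int n + 1 / 2) = rim (real r + 1 / 2)" unfolding r_def by (rule rim_mod)
    have sc: "side_class n = (if r mod 4 < 2 then r else r - 2)"
      unfolding side_class_def r_def Let_def by (rule refl)
    show ?thesis
    proof (cases "r mod 4 < 2")
      case True
      then show ?thesis using r rim by (simp add: sc base_side_def)
    next
      case False
      then have "r = 4 * (r div 4) + 2 \<or> r = 4 * (r div 4) + 3" by presburger
      have l: "2 \<le> r" using False mod_less_eq_dividend[of r 4] by linarith
      have "r - 2 = (r mod 4 - 2) + 4 * (r div 4)" using False div_mult_mod_eq[of r 4] by linarith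
      then have "(r - 2) mod 4 = (r mod 4 - 2) mod 4" by simp
      then have l': "(r - 2) mod 4 < 2" by simp
      from l have "real (r - 2) + 3 - 1 / 2 = real r + 1 / 2" by (simp add: of_nat_diff)
      then have "rim (of_int n + 1 / 2) = rim (real (r - 2) + 3 - 1 / 2)" using rim by metis
      moreover have "base_side (r - 2)" using l l' r by (simp add: base_side_def)
      moreover have "side_class n = r - 2" using False by (simp add: sc)
      ultimately show ?thesis by simp
    qed
  qed
  have k: "base_side k" using * by (simp add: k_def)
  have glue: "q (rim (real k + 1 / 2)) = q (rim (real k + 3 - 1 / 2))" using q_glue[OF k, of "1/2"] by simp
  show "q (rim (of_int n + 1 / 2)) = q (rim (real (side_class n) + 1 / 2))"
    using *[of n] glue by (auto simp: k_def)
  have crossing: "crossing k \<in> K" by (rule crossing_generated[OF K k])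
  have "gluing_loop (real k + 3 - 1 / 2) (real k + 1 / 2) = inv\<^bsub>\<pi>\<^esub> crossing k" using gluing_loop_inv[OF glue] by (simp add: crossing_def)
  then have X': "gluing_loop (real k + 3 - 1 / 2) (real k + 1 / 2) \<in> K" using crossing subgroup.m_inv_closed[OF K(1)] by simp
  have one: "gluing_loop u u \<in> K" for u using gluing_loop_refl subgroup.one_closed[OF K(1)] by simp
  from *[of n] *[of n'] same
  consider "rim (of_int n + 1 / 2) = rim (real k + 1 / 2)" "rim (of_int n' + 1 / 2) = rim (real k + 1 / 2)"
    | "rim (of_int n + 1 / 2) = rim (real k + 1 / 2)" "rim (of_int n' + 1 / 2) = rim (real k + 3 - 1 / 2)"
    | "rim (of_int n + 1 / 2) = rim (real k + 3 - 1 / 2)" "rim (of_int n' + 1 / 2) = rim (real k + 1 / 2)"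
    | "rim (of_int n + 1 / 2) = rim (real k + 3 - 1 / 2)" "rim (of_int n' + 1 / 2) = rim (real k + 3 - 1 / 2)"
    by (auto simp: k_def)
  then show "gluing_loop (of_int n + 1 / 2) (of_int n' + 1 / 2) \<in> K"
  proof cases
    case 1 then show ?thesis using gluing_loop_cong one by metis
  next
    case 2 then show ?thesis using gluing_loop_cong crossing unfolding crossing_def by metis
  next
    case 3 then show ?thesis using gluing_loop_cong X' by metis
  next
    case 4 then show ?thesis using gluing_loop_cong one by metis
  qed
qed

lemma gluing_loop_vertex_corners:
  assumes K: "subgroup K \<pi>" "\<And>j. j < g \<Longrightarrow> gen_a j \<in> K \<and> gen_b j \<in> K"
  shows "q (rim (of_int n)) = q (rim 0)" and "gluing_loop (of_int n) (of_int n') \<in> K"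
proof -
  have *: "q (rim (of_int n)) = q (rim 0) \<and> gluing_loop 0 (of_int n) \<in> K" for n
  proof -
    define r where "r = nat (n mod int (4 * g))"
    define j where "j = r div 4"
    have r: "r < 4 * g" using g_pos by (simp add: r_def nat_less_iff)
    then have j: "j < g" by (simp add: j_def less_mult_imp_div_less)
    have rim: "rim (of_int n) = rim (real r)" unfolding r_def using rim_mod[of n 0] by simp
    note v = vertices_glued[OF j] and v0 = vertex_multiple_of_4[of j]
    have m: "x \<otimes>\<^bsub>\<pi>\<^esub> y \<in> K" if "x \<in> K" "y \<in> K" for x y using subgroup.m_closed[OF K(1) that] .
    have i: "inv\<^bsub>\<pi>\<^esub> x \<in> K" if "x \<in> K" for x using subgroup.m_inv_closed[OF K(1) that] .
    have base: "gluing_loop 0 (real (4 * j)) \<in> K"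
    proof -
      have "surface_word \<pi> gen_a gen_b js \<in> K" if "\<forall>j\<in>set js. j < g" for js
        using that by (induction js) (auto intro!: m i simp: K(2) subgroup.one_closed[OF K(1)])
      from this[of "[0..<j]"] show ?thesis using gluing_loop_surface_word[of j] j by simp
    qed
    have step: "q (rim (real (4 * j) + u)) = q (rim 0) \<and> gluing_loop 0 (real (4 * j) + u) \<in> K"
      if "q (rim (real (4 * j))) = q (rim (real (4 * j) + u))" "gluing_loop (real (4 * j)) (real (4 * j) + u) \<in> K" for u
      using that v0 j m[OF base that(2)] gluing_loop_mult[of 0 "real (4 * j)" "real (4 * j) + u"] by simp
    have cases: "r = 4 * j \<or> r = 4 * j + 1 \<or> r = 4 * j + 2 \<or> r = 4 * j + 3" unfolding j_def by presburger
    have "gluing_loop (real (4 * j)) (real (4 * j) + 1) \<in> K" "gluing_loop (real (4 * j)) (real (4 * j) + 2) \<in> K"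
      "gluing_loop (real (4 * j)) (real (4 * j) + 3) \<in> K"
      using K(2)[OF j] by (simp_all only: gluing_loop_vertices[OF j] m i)
    then have steps: "\<And>u. u \<in> {1, 2, 3} \<Longrightarrow> q (rim (real (4 * j) + u)) = q (rim 0) \<and> gluing_loop 0 (real (4 * j) + u) \<in> K"
      using step[OF trans[OF trans[OF v(1) v(4)[symmetric]] v(2)[symmetric]]]
        step[OF trans[OF v(1) v(4)[symmetric]]] step[OF v(1)] by auto
    from cases have "q (rim (real r)) = q (rim 0) \<and> gluing_loop 0 (real r) \<in> K"
    proof (elim disjE)
      assume "r = 4 * j"
      then show ?thesis using base v0 j by simp
    qed (use steps[of 1] steps[of 2] steps[of 3] in \<open>simp_all add: add_ac\<close>)
    then show ?thesis using rim gluing_loop_cong[OF refl rim] by simp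
  qed
  show "q (rim (of_int n)) = q (rim 0)" using * by simp
  have "gluing_loop (of_int n) (of_int n') = inv\<^bsub>\<pi>\<^esub> gluing_loop 0 (of_int n) \<otimes>\<^bsub>\<pi>\<^esub> gluing_loop 0 (of_int n')"
    using *[of n] *[of n'] by (simp add: gluing_loop_inv gluing_loop_mult)
  then show "gluing_loop (of_int n) (of_int n') \<in> K"
    using *[of n] *[of n'] K(1) by (simp add: subgroup.m_closed subgroup.m_inv_closed)
qed

lemma lasso_in_piece:
  assumes K: "subgroup K \<pi>" "\<And>j. j < g \<Longrightarrow> gen_a j \<in> K \<and> gen_b j \<in> K"
    and i: "i \<noteq> Cell" and z: "z \<in> cball 0 1" "z' \<in> cball 0 1"
    and p: "path p" "path_image p \<subseteq> piece i m" "pathstart p = q z" "pathfinish p = q z'"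
  shows "lasso (spoke z +++ p) (spoke z') \<in> K"
proof -
  have "q 0 \<notin> piece i m" using piece_subset_chart[OF i] centre_in_chart_iff i by blast
  then have "z \<noteq> 0" "z' \<noteq> 0"
    using p pathstart_in_path_image[of p] pathfinish_in_path_image[of p] by auto
  then obtain w w' where w: "z = wrap w" "z' = wrap w'" using wrap_surj by metis
  then have L: "w \<in> L" "w' \<in> L" using z wrap_in_disc by auto
  have ends: "pathstart p = Q w" "pathfinish p = Q w'" using p w by (simp_all add: Q_def)
  have V: "path_image p \<subseteq> V i" using p piece_subset_chart[OF i] by blast
  have cls: "piece_index i w = m" "piece_index i w' = m"
    using Q_in_piece_iff L ends p pathstart_in_path_image[of p] pathfinish_in_path_image[of p] by auto
  have *: "lasso (spoke (wrap w) +++ p) (spoke (wrap w')) = gluing_loop (centre i w) (centre i w')"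
  proof (rule lasso_in_chart[OF i L p(1) V ends, where y = "if i = Edges then q (rim (real m + 1 / 2)) else q (rim 0)"])
    fix w assume "w \<in> L" "Q w \<in> path_image p"
    then have "piece_index i w = m" using p Q_in_piece_iff by blast
    then show "q (rim (centre i w)) = (if i = Edges then q (rim (real m + 1 / 2)) else q (rim 0))"
      using gluing_loop_edge_midpoints(1)[OF K, of "sector i w" "sector i w"] gluing_loop_vertex_corners(1)[OF K] i
      by (cases i) (auto simp: centre_def piece_index_def)
  qed
  have "gluing_loop (centre i w) (centre i w') \<in> K"
  proof (cases i)
    case Edges
    then show ?thesis using gluing_loop_edge_midpoints(2)[OF K, of "sector i w" "sector i w'"] cls
      by (simp add: centre_def piece_index_def)
  next
    case Vertices
    then show ?thesis using gluing_loop_vertex_corners(2)[OF K, of "sector i w" "sector i w'"]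
      by (simp add: centre_def)
  qed (use i in simp)
  then show ?thesis using * w by simp
qed

text \<open>
  By Bolzano's principle it suffices to treat short subpaths, which stay in the cell or in one piece of a
  boundary chart; the loop closed up by two spokes is then trivial or a gluing loop between centres.
\<close>
theorem generators_generate:
  assumes K: "subgroup K \<pi>" "\<And>j. j < g \<Longrightarrow> gen_a j \<in> K \<and> gen_b j \<in> K"
  shows "carrier \<pi> \<subseteq> K"
proof
  fix A assume "A \<in> carrier \<pi>"
  then obtain p where "p \<in> loops_at S (q z0)" and A: "A = path_class S p" by (auto simp: fundamental_group_def)
  then have p: "path p" "path_image p \<subseteq> S" "p 0 = q z0" "p 1 = q z0"
    by (auto simp: loops_at_def pathstart_def pathfinish_def)
  define P where "P = (\<lambda>s t. 0 \<le> s \<and> s \<le> t \<and> t \<le> 1 \<longrightarrow>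
    (\<forall>z\<in>cball 0 1. \<forall>z'\<in>cball 0 1. q z = p s \<longrightarrow> q z' = p t \<longrightarrow> lasso (spoke z +++ (p \<circ> linepath s t)) (spoke z') \<in> K))"
  have sub: "path (p \<circ> linepath s t)" "path_image (p \<circ> linepath s t) \<subseteq> p ` {s..t}" "path_image (p \<circ> linepath s t) \<subseteq> S"
    "pathstart (p \<circ> linepath s t) = p s" "pathfinish (p \<circ> linepath s t) = p t" if "0 \<le> s" "s \<le> t" "t \<le> 1" for s t
  proof -
    have seg: "path_image (linepath s t) = {s..t}" using that by (simp add: closed_segment_eq_real_ivl)
    have "continuous_on {s..t} p" using continuous_on_subset[of "{0..1}" p "{s..t}"] p(1) that by (auto simp: path_def)
    then show "path (p \<circ> linepath s t)" by (intro path_continuous_image) (simp_all add: seg del: path_image_linepath)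
    have "{s..t} \<subseteq> {0..1}" using that by auto
    then show "path_image (p \<circ> linepath s t) \<subseteq> p ` {s..t}" "path_image (p \<circ> linepath s t) \<subseteq> S"
      using p(2) by (auto simp: path_image_compose seg path_image_def[of p] simp del: path_image_linepath)
  qed (simp_all add: pathstart_compose pathfinish_compose)
  have "P 0 1"
  proof (rule Bolzano[of 0 1 P])
    fix a b d assume ab: "P a b" and rim: "P b d" and "a \<le> b" "b \<le> d"
    show "P a d"
      unfolding P_def
    proof (intro impI ballI)
      fix z z' assume I: "0 \<le> a \<and> a \<le> d \<and> d \<le> 1" and z: "z \<in> cball 0 1" "z' \<in> cball 0 1" "q z = p a" "q z' = p d"
      note sab = sub[of a b] and sbd = sub[of b d] and sad = sub[of a d]
      have "p b \<in> S" using p(2) I \<open>a \<le> b\<close> \<open>b \<le> d\<close> by (auto simp: path_image_def)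
      then obtain y where y: "y \<in> cball 0 1" "q y = p b" using q_surj by (metis imageE)
      have 1: "lasso (spoke z +++ (p \<circ> linepath a b)) (spoke y) \<in> K" "lasso (spoke y +++ (p \<circ> linepath b d)) (spoke z') \<in> K"
        using ab rim I \<open>a \<le> b\<close> \<open>b \<le> d\<close> z y by (auto simp: P_def)
      note arcs = arc_spoke[OF z(1)] arc_spoke[OF y(1)] arc_spoke[OF z(2)]
      have arc: "arc_from_base (spoke z +++ (p \<circ> linepath a b))" "arc_from_base (spoke y +++ (p \<circ> linepath b d))"
        "arc_from_base ((spoke z +++ (p \<circ> linepath a b)) +++ (p \<circ> linepath b d))"
        using arcs sab sbd I \<open>a \<le> b\<close> \<open>b \<le> d\<close> z y by (auto intro!: arc_from_base_join)
      have "homotopic_paths S (spoke z +++ ((p \<circ> linepath a b) +++ (p \<circ> linepath b d))) ((spoke z +++ (p \<circ> linepath a b)) +++ (p \<circ> linepath b d))"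
        using arcs sab sbd I \<open>a \<le> b\<close> \<open>b \<le> d\<close> z by (intro homotopic_paths_assoc) (auto simp: arc_from_base_def)
      moreover have "homotopic_paths S ((p \<circ> linepath a b) +++ (p \<circ> linepath b d)) ((p \<circ> linepath a d))"
        unfolding path_compose_join[symmetric]
        using I \<open>a \<le> b\<close> \<open>b \<le> d\<close>
        by (intro homotopic_reparametrizations[OF p(1,2)]) (auto simp: path_image_join closed_segment_eq_real_ivl)
      then have "homotopic_paths S (spoke z +++ ((p \<circ> linepath a b) +++ (p \<circ> linepath b d))) (spoke z +++ (p \<circ> linepath a d))"
        using arcs sab sbd I \<open>a \<le> b\<close> \<open>b \<le> d\<close> z
        by (intro homotopic_paths_join) (auto simp: homotopic_paths_refl arc_from_base_def)
      ultimately have "homotopic_paths S (spoke z +++ (p \<circ> linepath a d)) ((spoke z +++ (p \<circ> linepath a b)) +++ (p \<circ> linepath b d))"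
        using homotopic_paths_sym homotopic_paths_trans by blast
      then have "lasso (spoke z +++ (p \<circ> linepath a d)) (spoke z') = lasso ((spoke z +++ (p \<circ> linepath a b)) +++ (p \<circ> linepath b d)) (spoke z')"
        using arcs sad I z by (intro lasso_cong) (auto simp: homotopic_paths_refl arc_from_base_def)
      also have "\<dots> = lasso ((spoke z +++ (p \<circ> linepath a b)) +++ (p \<circ> linepath b d)) (spoke y +++ (p \<circ> linepath b d)) \<otimes>\<^bsub>\<pi>\<^esub>
          lasso (spoke y +++ (p \<circ> linepath b d)) (spoke z')"
        using sbd I \<open>a \<le> b\<close> \<open>b \<le> d\<close> z by (intro lasso_mult[symmetric] arc arcs) auto
      also have "lasso ((spoke z +++ (p \<circ> linepath a b)) +++ (p \<circ> linepath b d)) (spoke y +++ (p \<circ> linepath b d)) =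
          lasso (spoke z +++ (p \<circ> linepath a b)) (spoke y)"
        using sab sbd I \<open>a \<le> b\<close> \<open>b \<le> d\<close> y by (intro lasso_extend arc arcs) auto
      finally show "lasso (spoke z +++ (p \<circ> linepath a d)) (spoke z') \<in> K"
        using subgroup.m_closed[OF K(1) 1] by (simp only:)
    qed
  next
    fix t0 :: real assume t0: "0 \<le> t0" "t0 \<le> 1"
    then have "p t0 \<in> S" using p(2) by (auto simp: path_image_def)
    then obtain i where i: "p t0 \<in> V i" using charts_cover_surface by blast
    obtain U where U: "openin (top_of_set S) U" "p t0 \<in> U" and
      U_K: "\<And>z z' r. z \<in> cball 0 1 \<Longrightarrow> z' \<in> cball 0 1 \<Longrightarrow> path r \<Longrightarrow> path_image r \<subseteq> U \<Longrightarrow> pathstart r = q z \<Longrightarrow>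
        pathfinish r = q z' \<Longrightarrow> lasso (spoke z +++ r) (spoke z') \<in> K"
    proof (cases "i = Cell")
      case True
      then show ?thesis
        using that[of "V Cell"] open_chart i lasso_in_cell subgroup.one_closed[OF K(1)] by metis
    next
      case False
      then obtain w where "w \<in> L" "p t0 = Q w" "in_chart i w" using chart_cases[OF i] by blast
      then have "p t0 \<in> piece i (piece_index i w)" using Q_in_piece_iff by simp
      then show ?thesis
        using that[of "piece i (piece_index i w)"] open_piece[OF False] lasso_in_piece[OF K False] by metis
    qed
    obtain W where W: "open W" "U = S \<inter> W" using U(1) by (auto simp: openin_open)
    have "\<exists>d>0. \<forall>t\<in>{0..1}. \<bar>t - t0\<bar> < d \<longrightarrow> p t \<in> W"
    proof -
      have "(p \<longlongrightarrow> p t0) (at t0 within {0..1})" using p(1) t0 by (simp add: path_def continuous_on_def)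
      then have "\<forall>\<^sub>F t in at t0 within {0..1}. p t \<in> W" using W U by (auto dest: topological_tendstoD)
      then obtain d where "d > 0" "\<forall>t\<in>{0..1}. t \<noteq> t0 \<and> dist t t0 < d \<longrightarrow> p t \<in> W"
        unfolding eventually_at by blast
      then show ?thesis using W U by (metis IntD2 dist_real_def)
    qed
    then obtain d where d: "d > 0" "\<And>t. t \<in> {0..1} \<Longrightarrow> \<bar>t - t0\<bar> < d \<Longrightarrow> p t \<in> W" by blast
    have "P a b" if ab: "a \<le> t0" "t0 \<le> b" "b - a < d" for a b
      unfolding P_def
    proof (intro impI ballI)
      fix z z' assume I: "0 \<le> a \<and> a \<le> b \<and> b \<le> 1" and z: "z \<in> cball 0 1" "z' \<in> cball 0 1" "q z = p a" "q z' = p b"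
      have "p ` {a..b} \<subseteq> U"
        using d(2) ab I p(2) W(2) by (fastforce simp: path_image_def abs_if)
      then have "path_image ((p \<circ> linepath a b)) \<subseteq> U" using sub(2)[of a b] I by blast
      then show "lasso (spoke z +++ (p \<circ> linepath a b)) (spoke z') \<in> K"
        using sub[of a b] I z by (intro U_K) auto
    qed
    then show "\<exists>d>0. \<forall>a b. a \<le> t0 \<and> t0 \<le> b \<and> b - a < d \<longrightarrow> P a b" using d(1) by blast
  qed simp
  then have in_K: "lasso (spoke z0 +++ p) (spoke z0) \<in> K"
    using z0 p by (simp add: P_def compose_linepath_01)
  have const: "homotopic_paths S (spoke z0) (q \<circ> linepath z0 z0)"
    unfolding spoke_def using spoke_base_path[OF z0] z0 disc_segment by (intro q_path_homotopic) auto
  have lin: "q \<circ> linepath z0 z0 = (\<lambda>_. q z0)" by (auto simp: linepath_def)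
  have ends: "pathstart p = q z0" "pathfinish p = q z0" using p by (simp_all add: pathstart_def pathfinish_def)
  have cp: "homotopic_paths S ((\<lambda>_. q z0) +++ p) p"
    using homotopic_const_join(1)[OF p(1,2)] ends by simp
  have "homotopic_paths S (spoke z0 +++ p) ((\<lambda>_. q z0) +++ p)"
    using const p ends unfolding lin by (intro homotopic_paths_join) (auto simp: homotopic_paths_refl)
  then have "homotopic_paths S (spoke z0 +++ p) p" using cp homotopic_paths_trans by blast
  then have "lasso (spoke z0 +++ p) (spoke z0) = lasso p (\<lambda>_. q z0)"
    using const ends unfolding lin by (intro lasso_cong) simp_all
  also have "\<dots> = path_class S (p +++ (\<lambda>_. q z0))" by (simp add: lasso_def reversepath_def)
  also have "\<dots> = A" unfolding A using homotopic_const_join(2)[OF p(1,2)] ends by (intro path_class_eq) simp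
  finally show "A \<in> K" using in_K by simp
qed

end

section \<open>The universal property\<close>

text \<open>
  Values of a flat section of the bundle to be constructed, relative to the cell: \<open>e k\<close> next to the side \<open>k\<close> and
  \<open>v k\<close> at the corner \<open>k\<close>. The two compatibility conditions say that near both ends of a side the passage from the
  edge chart to the vertex chart is the same on the two sides that are glued.
\<close>
locale labelled_polygon = glued_polygon g S q + group H
  for g :: nat and S :: "'a::topological_space set" and q :: "complex \<Rightarrow> 'a" and H (structure) +
  fixes e v :: "nat \<Rightarrow> 'b"
  assumes e_closed: "e k \<in> carrier H" and v_closed: "v k \<in> carrier H"
    and e_base: "base_side k \<Longrightarrow> e k = \<one>"
    and v_start: "base_side k \<Longrightarrow> v k = inv (e (k + 2)) \<otimes> v (k + 3)"
    and v_end: "base_side k \<Longrightarrow> v (k + 1) = inv (e (k + 2)) \<otimes> v (k + 2)"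
    and v_periodic: "v (4 * g) = v 0"
begin

definition label :: "chart \<Rightarrow> int \<Rightarrow> 'b" where
  "label i n = (let k = nat (n mod int (4 * g)) in case i of Cell \<Rightarrow> \<one> | Edges \<Rightarrow> e k | Vertices \<Rightarrow> v k)"

definition transition :: "chart \<Rightarrow> chart \<Rightarrow> complex \<Rightarrow> 'b" where
  "transition i j w = inv (label i (sector i w)) \<otimes> label j (sector j w)"

text \<open>
  The centre lies in the cell only, so the only transition there is the trivial one; elsewhere the
  choice of a preimage in the half-plane does not matter.
\<close>
definition c :: "chart \<Rightarrow> chart \<Rightarrow> 'a \<Rightarrow> 'b" where
  "c i j x = (if x = q 0 then \<one> else transition i j (SOME w. w \<in> L \<and> Q w = x))"

lemma label_closed [simp]: "label i n \<in> carrier H"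
  using e_closed v_closed by (cases i) (auto simp: label_def Let_def)

lemma transition_closed [simp]: "transition i j w \<in> carrier H"
  by (simp add: transition_def)

lemma transition_refl: "transition i i w = \<one>"
  by (simp add: transition_def)

lemma transition_mult: "transition i j w \<otimes> transition j k w = transition i k w"
  by (simp add: transition_def m_assoc mult_inv_cancel)

lemma transition_swap: "transition j i w = inv (transition i j w)"
  by (simp add: transition_def inv_mult_group)

lemma label_Vertices: "k \<le> 4 * g \<Longrightarrow> label Vertices (int k) = v k"
  using v_periodic by (cases "k = 4 * g") (simp_all add: label_def Let_def flip: of_nat_mod zmod_int)

lemma label_Edges: "k < 4 * g \<Longrightarrow> label Edges (int k) = e k"
  by (simp add: label_def Let_def flip: of_nat_mod zmod_int)

text \<open>
  Only transitions between the edge and the vertex chart meet the rim, where a half-side next to corner \<open>k\<close> or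
  \<open>k + 1\<close> is glued to one next to corner \<open>k + 3\<close> or \<open>k + 2\<close>; there the compatibility conditions apply.
\<close>
lemma transition_invariant:
  assumes "w \<in> L" "w' \<in> L" "Q w = Q w'" "in_chart i w" "in_chart j w"
  shows "transition i j w = transition i j w'"
proof -
  define J where "J = (\<lambda>w. if in_chart i w \<and> in_chart j w then transition i j w else undefined)"
  have per: "sector l (w + period) = sector l w + (if l = Cell then 0 else 4 * int g)" for l w
  proof -
    have "\<lfloor>Im w + offset l + of_int (4 * int g)\<rfloor> = \<lfloor>Im w + offset l\<rfloor> + 4 * int g"
      by (rule floor_add_int[symmetric])
    then show ?thesis by (simp add: sector_def add_ac)
  qed
  have lab: "label l (sector l (w + period)) = label l (sector l w)" for l w
    unfolding per by (cases l) (simp_all add: label_def)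
  have gper: "in_chart l (w + period) = in_chart l w" if "w \<in> L" for l w
    using that by (intro in_chart_invariant) (auto simp: Q_def wrap_eq_iff intro!: arg_cong[of _ _ q] exI[of _ "1::int"])
  have EV: "transition Edges Vertices (\<i> * of_real (real k + s)) = transition Edges Vertices (\<i> * of_real (real k + 3 - s))"
    if k: "base_side k" and s: "s \<in> {0..1}" and nice: "in_chart Edges (\<i> * of_real (real k + s))" "in_chart Vertices (\<i> * of_real (real k + s))" for k s
  proof -
    have "s \<noteq> 1 / 2"
    proof
      assume "s = 1 / 2"
      then have "Im (\<i> * of_real (real k + s)) + offset Vertices = of_nat (k + 1)" by simp
      then show False using nice(2) unfolding in_chart_def by (metis Ints_of_nat chart.distinct(3))
    qed
    have "s \<noteq> 0" "s \<noteq> 1" using nice by (auto simp: in_chart_def)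
    have lab_k: "label Edges (int k) = e k" "label Edges (int (k + 2)) = e (k + 2)"
      "label Vertices (int k) = v k" "label Vertices (int (k + 1)) = v (k + 1)"
      "label Vertices (int (k + 2)) = v (k + 2)" "label Vertices (int (k + 3)) = v (k + 3)"
      using base_side_bound[OF k] by (intro label_Edges label_Vertices, linarith)+
    from \<open>s \<noteq> 1 / 2\<close> \<open>s \<noteq> 0\<close> \<open>s \<noteq> 1\<close> consider "0 < s" "s < 1 / 2" | "1 / 2 < s" "s < 1" using s by fastforce
    then show ?thesis
    proof cases
      case 1
      have idx: "sector Edges (\<i> * of_real (real k + s)) = int k" "sector Vertices (\<i> * of_real (real k + s)) = int k"
        "sector Edges (\<i> * of_real (real k + 3 - s)) = int (k + 2)" "sector Vertices (\<i> * of_real (real k + 3 - s)) = int (k + 3)"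
        using 1 by (simp_all add: sector_def floor_eq_iff)
      then show ?thesis
        unfolding transition_def idx using e_base[OF k] v_start[OF k] v_closed base_side_bound[OF k]
        by (simp only: lab_k) (simp add: v_closed e_closed)
    next
      case 2
      have idx: "sector Edges (\<i> * of_real (real k + s)) = int k" "sector Vertices (\<i> * of_real (real k + s)) = int (k + 1)"
        "sector Edges (\<i> * of_real (real k + 3 - s)) = int (k + 2)" "sector Vertices (\<i> * of_real (real k + 3 - s)) = int (k + 2)"
        using 2 by (simp_all add: sector_def floor_eq_iff)
      then show ?thesis
        unfolding transition_def idx using e_base[OF k] v_end[OF k] v_closed base_side_bound[OF k]
        by (simp only: lab_k) (simp add: v_closed e_closed)
    qed
  qed
  have "J w = J w'"
  proof (rule Q_invariant[of J, OF _ _ assms(1-3)])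
    show "J (w + period) = J w" if "w \<in> L" for w
      using that by (simp add: J_def gper transition_def lab)
  next
    fix k s assume k: "base_side k" and s: "s \<in> {0..1::real}"
    let ?w = "\<i> * of_real (real k + s)" and ?w' = "\<i> * of_real (real k + 3 - s)"
    have "Q ?w = Q ?w'" using q_glue[OF k s] by (simp add: rim_def Q_def)
    then have g: "in_chart l ?w' = in_chart l ?w" for l by (intro in_chart_invariant) auto
    have "transition i j ?w = transition i j ?w'" if "in_chart i ?w" "in_chart j ?w"
    proof -
      have "i \<noteq> Cell" "j \<noteq> Cell" using that by (auto simp: in_chart_def)
      then consider "i = j" | "i = Edges" "j = Vertices" | "i = Vertices" "j = Edges"
        by (metis chart.exhaust)
      then show ?thesis
      proof cases
        case 3
        then show ?thesis using EV[OF k s] that by (simp add: transition_swap[of Vertices Edges])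
      qed (use EV[OF k s] that in \<open>simp_all add: transition_refl\<close>)
    qed
    then show "J ?w = J ?w'" unfolding J_def g by simp
  qed
  then show ?thesis using assms in_chart_invariant[OF assms(1-3)] by (simp add: J_def)
qed

lemma c_Q:
  assumes "w \<in> L" "in_chart i w" "in_chart j w"
  shows "c i j (Q w) = transition i j w"
proof -
  let ?w = "SOME w'. w' \<in> L \<and> Q w' = Q w"
  have "?w \<in> L \<and> Q ?w = Q w"
    using assms(1) by (intro someI[of "\<lambda>w'. w' \<in> L \<and> Q w' = Q w" w]) simp
  then show ?thesis
    using transition_invariant[of w ?w i j] assms Q_not_centre by (simp add: c_def)
qed

sublocale cech_cocycle H S V c
proof
  show "openin (top_of_set S) (V i)" for i by (rule open_chart)
  show "\<exists>i. x \<in> V i" if "x \<in> S" for x using that by (rule charts_cover_surface)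
  show "c i j x \<in> carrier H" for i j x by (simp add: c_def)
  show "c i j x \<otimes> c j k x = c i k x" if x: "x \<in> V i" "x \<in> V j" "x \<in> V k" for i j k x
  proof (cases "x = q 0")
    case True
    then show ?thesis by (simp add: c_def)
  next
    case False
    then obtain w where w: "w \<in> L" "x = Q w" "in_chart i w" using chart_cases[OF x(1)] by blast
    then have "in_chart j w" "in_chart k w" using x Q_in_chart_iff by auto
    then show ?thesis using w by (simp add: c_Q transition_mult)
  qed
  show "\<exists>U. openin (top_of_set S) U \<and> x \<in> U \<and> (\<forall>y\<in>U. y \<in> V i \<longrightarrow> y \<in> V j \<longrightarrow> c i j y = c i j x)"
    if x: "x \<in> V i" "x \<in> V j" for i j x
  proof (cases "x = q 0")
    case True
    then have ij: "i = Cell" "j = Cell" using x centre_in_chart_iff by auto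
    have "c Cell Cell y = \<one>" for y by (simp add: c_def transition_refl)
    then show ?thesis using x open_chart[of Cell] ij by (intro exI[of _ "V Cell"]) simp
  next
    case False
    then obtain w where w: "w \<in> L" "x = Q w" "in_chart i w" using chart_cases[OF x(1)] by blast
    then have "in_chart j w" using x Q_in_chart_iff by auto
    define U where "U = {y \<in> S - {q 0}. y \<in> V i \<and> y \<in> V j \<and> c i j y = c i j x}"
    have "{w' \<in> L. Q w' \<in> U} = L \<inter> {w'. in_chart i w' \<and> in_chart j w' \<and> inv (label i (sector i w')) \<otimes> label j (sector j w') = c i j x}"
      using Q_in Q_not_centre by (auto simp: U_def Q_in_chart_iff c_Q transition_def)
    moreover have "U \<subseteq> S - {q 0}" by (auto simp: U_def)
    ultimately have "openin (top_of_set S) U"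
      using open_in_chart_sectors[of i j "\<lambda>n m. inv (label i n) \<otimes> label j m = c i j x"]
      by (simp add: openin_iff_Q openin_open_Int)
    moreover have "x \<in> U" using x False w Q_in by (auto simp: U_def)
    ultimately show ?thesis by (auto simp: U_def)
  qed
qed

end

context labelled_polygon
begin

text \<open>
  The first half of the radius lies in the cell, the second half in the boundary chart.
\<close>
lemma hol_radius:
  assumes i: "i \<noteq> Cell" and in_chart: "in_chart i (\<i> * of_real u)"
  shows "hol (q \<circ> linepath 0 (rim u)) Cell i = label i (sector i (\<i> * of_real u))"
proof -
  let ?m = "rim u / 2"
  have m: "?m \<in> cball 0 1" by (simp add: norm_divide)
  have seg: "path_image (linepath 0 ?m) \<subseteq> ball 0 1" "path_image (linepath ?m (rim u)) \<subseteq> cball 0 1"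
    unfolding path_image_linepath by (intro closed_segment_subset; simp add: norm_divide)+
  have outer: "\<exists>w\<in>L. linepath ?m (rim u) t = wrap w \<and> in_chart i w \<and> sector i w = sector i (\<i> * of_real u)" if t: "t \<in> {0..1}" for t
  proof -
    define r where "r = (1 + t) / 2"
    \<comment> \<open>all points of a radius have the same imaginary part in the unrolled coordinate\<close>
    define w where "w = of_real (ln r / \<kappa>) + \<i> * of_real u"
    have r: "0 < r" "r \<le> 1" using t by (simp_all add: r_def)
    have "linepath ?m (rim u) t = of_real r * rim u"
      by (simp add: linepath_def scaleR_conv_of_real r_def field_simps)
    also have "\<dots> = wrap w"
      using r \<kappa>_pos by (simp add: w_def wrap_def rim_def distrib_left exp_add exp_of_real)
    finally have "linepath ?m (rim u) t = wrap w" .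
    moreover have "w \<in> L" using r \<kappa>_pos by (simp add: w_def divide_le_0_iff)
    moreover have "in_chart i w" "sector i w = sector i (\<i> * of_real u)"
      using in_chart i by (simp_all add: in_chart_def sector_def w_def)
    ultimately show ?thesis by blast
  qed
  have outer_in_chart: "path_image (q \<circ> linepath ?m (rim u)) \<subseteq> V i"
  proof
    fix x assume "x \<in> path_image (q \<circ> linepath ?m (rim u))"
    then obtain t where "t \<in> {0..1}" "x = q (linepath ?m (rim u) t)" by (auto simp: path_image_def)
    then show "x \<in> V i" using outer[of t] Q_in_chart_iff unfolding Q_def by metis
  qed
  have in_cell: "path_image (q \<circ> linepath 0 ?m) \<subseteq> V Cell"
    unfolding path_image_compose V_def using seg(1) by auto
  have paths: "path (q \<circ> linepath 0 ?m)" "path (q \<circ> linepath ?m (rim u))"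
    using seg by (intro path_continuous_image continuous_on_subset[OF continuous_on_q]; force)+
  have VS: "V j \<subseteq> S" for j using openin_imp_subset[OF open_chart] .
  obtain w where w: "w \<in> L" "?m = wrap w" "in_chart i w" "sector i w = sector i (\<i> * of_real u)"
    using outer[of 0] by (auto simp: linepath_def)
  have "norm (wrap w) < 1" unfolding w(2)[symmetric] by (simp add: norm_divide)
  then have cell: "in_chart Cell w" by (simp add: in_chart_def norm_wrap_less_1)
  have end1: "(q \<circ> linepath 0 ?m) 1 = Q w" using w by (simp add: linepath_def Q_def)
  have "homotopic_paths S (q \<circ> linepath 0 (rim u)) (q \<circ> (linepath 0 ?m +++ linepath ?m (rim u)))"
  proof (rule homotopic_images_of_convex[OF _ continuous_on_q])
    show "path_image (linepath 0 (rim u)) \<subseteq> cball 0 1"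
      unfolding path_image_linepath by (rule closed_segment_subset) auto
    have "path_image (linepath 0 ?m) \<subseteq> cball 0 1" using seg(1) ball_subset_cball by blast
    then show "path_image (linepath 0 ?m +++ linepath ?m (rim u)) \<subseteq> cball 0 1"
      using seg(2) by (subst path_image_join) auto
  qed (auto simp: q_surj)
  then have "hol (q \<circ> linepath 0 (rim u)) Cell i = hol ((q \<circ> linepath 0 ?m) +++ (q \<circ> linepath ?m (rim u))) Cell i"
    unfolding path_compose_join
  proof (rule hol_homotopic)
    show "(q \<circ> linepath 0 (rim u)) 0 \<in> V Cell" using centre_in_chart_iff by (simp add: linepath_def)
    show "(q \<circ> linepath 0 (rim u)) 1 \<in> V i"
      using Q_in_chart_iff[of "\<i> * of_real u" i] in_chart by (simp add: linepath_def Q_boundary)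
  qed
  also have "\<dots> = hol (q \<circ> linepath 0 ?m) Cell i \<otimes> hol (q \<circ> linepath ?m (rim u)) i i"
  proof (rule hol_join)
    show "(q \<circ> linepath 0 ?m) 0 \<in> V Cell" using centre_in_chart_iff by (simp add: linepath_def)
    show "(q \<circ> linepath 0 ?m) 1 \<in> V i" using end1 Q_in_chart_iff w by simp
    show "(q \<circ> linepath ?m (rim u)) 1 \<in> V i"
      using Q_in_chart_iff[of "\<i> * of_real u" i] in_chart by (simp add: linepath_def Q_boundary)
    show "(q \<circ> linepath 0 ?m) 1 = (q \<circ> linepath ?m (rim u)) 0" by (simp add: linepath_def)
  qed (use in_cell outer_in_chart VS paths in blast)+
  also have "hol (q \<circ> linepath ?m (rim u)) i i = \<one>"
    using hol_in_chart[OF paths(2) outer_in_chart, of i] outer_in_chart pathfinish_in_path_image[of "q \<circ> linepath ?m (rim u)"]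
    by (auto simp: pathfinish_def cocycle_refl)
  also have "hol (q \<circ> linepath 0 ?m) Cell i = c Cell i (Q w)"
    using hol_in_chart[OF paths(1) in_cell, of i] end1 Q_in_chart_iff w by simp
  also have "c Cell i (Q w) = label i (sector i (\<i> * of_real u))"
    using c_Q[OF w(1) cell w(3)] w(4) by (simp add: transition_def label_def[of Cell])
  finally show ?thesis by (simp only: r_one[OF label_closed])
qed

end

locale based_labelled_polygon = labelled_polygon g S q H e v + based_polygon g S q z0
  for g :: nat and S :: "'a::topological_space set" and q :: "complex \<Rightarrow> 'a" and H (structure)
    and e v :: "nat \<Rightarrow> 'b" and z0 :: complex
begin

lemma hol_gluing_loop:
  assumes i: "i \<noteq> Cell" and in_chart: "in_chart i (\<i> * of_real u)" "in_chart i (\<i> * of_real u')"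
    and glued: "q (rim u) = q (rim u')" and i0: "q z0 \<in> V i0"
  defines "d \<equiv> hol (q \<circ> linepath z0 0) i0 Cell"
  shows "d \<in> carrier H"
    and "hol (spoke (rim u) +++ reversepath (spoke (rim u'))) i0 i0 =
      d \<otimes> (label i (sector i (\<i> * of_real u)) \<otimes> inv (label i (sector i (\<i> * of_real u')))) \<otimes> inv d"
proof -
  have seg: "path (q \<circ> linepath a b)" "path_image (q \<circ> linepath a b) \<subseteq> S" if "a \<in> cball 0 1" "b \<in> cball 0 1" for a b
    using q_path[OF path_linepath disc_segment[OF that]] q_path_image[OF disc_segment[OF that]] .
  have centre: "q 0 \<in> V Cell" using centre_in_chart_iff by simp
  show d: "d \<in> carrier H" unfolding d_def
    using seg[OF z0, of 0] i0 centre by (intro hol_closed) (auto simp: linepath_def)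
  have chart: "q (rim v) \<in> V i" if "in_chart i (\<i> * of_real v)" for v
    using Q_in_chart_iff[of "\<i> * of_real v" i] that by (simp add: Q_boundary)
  have spoke: "hol (spoke (rim v)) i0 i = d \<otimes> label i (sector i (\<i> * of_real v))" if "in_chart i (\<i> * of_real v)" for v
  proof -
    have "hol (spoke (rim v)) i0 i = d \<otimes> hol (q \<circ> linepath 0 (rim v)) Cell i"
      unfolding spoke_def path_compose_join d_def
      using seg[OF z0, of 0] seg[of 0 "rim v"] i0 centre chart[OF that]
      by (intro hol_join) (auto simp: linepath_def)
    then show ?thesis using hol_radius[OF i that] by simp
  qed
  have sp: "path (spoke (rim v))" "path_image (spoke (rim v)) \<subseteq> S" "spoke (rim v) 0 = q z0" "spoke (rim v) 1 = q (rim v)" for v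
    using arc_spoke[of "rim v"] pathfinish_spoke[of "rim v"] by (auto simp: arc_from_base_def pathstart_def pathfinish_def)
  have rev: "reversepath (spoke (rim u')) 0 = q (rim u')" "reversepath (spoke (rim u')) 1 = q z0"
    by (simp_all add: reversepath_def sp)
  have "hol (spoke (rim u) +++ reversepath (spoke (rim u'))) i0 i0 =
      hol (spoke (rim u)) i0 i \<otimes> hol (reversepath (spoke (rim u'))) i i0"
    using sp[of u] sp[of u'] i0 chart[OF in_chart(1)] glued by (intro hol_join) (simp_all add: rev)
  also have "hol (reversepath (spoke (rim u'))) i i0 = inv (hol (spoke (rim u')) i0 i)"
    using sp[of u'] i0 chart[OF in_chart(2)] by (intro hol_reversepath) auto
  finally show "hol (spoke (rim u) +++ reversepath (spoke (rim u'))) i0 i0 =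
      d \<otimes> (label i (sector i (\<i> * of_real u)) \<otimes> inv (label i (sector i (\<i> * of_real u')))) \<otimes> inv d"
    using d by (simp add: spoke in_chart inv_mult_group m_assoc)
qed

text \<open>
  Conjugating by the transport \<open>d\<close> from the base point to the centre removes the dependence on the base point.
\<close>
proposition labels_give_representation:
  "\<exists>\<phi>\<in>hom (fundamental_group S (q z0)) H. \<forall>k. base_side k \<longrightarrow> \<phi> (crossing k) = inv (e (k + 2))"
proof -
  obtain i0 where i0: "q z0 \<in> V i0" using charts_cover_surface q_in[OF z0] by blast
  obtain \<Phi> where \<Phi>: "\<Phi> \<in> hom (fundamental_group S (q z0)) H"
    and \<Phi>_hol: "\<forall>p\<in>loops_at S (q z0). \<Phi> (path_class S p) = hol p i0 i0"
    using holonomy_representation[OF i0] by blast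
  define d where "d = hol (q \<circ> linepath z0 0) i0 Cell"
  define \<phi> where "\<phi> = (\<lambda>x. inv d \<otimes> \<Phi> x \<otimes> d)"
  have in_chart: "in_chart Edges (\<i> * of_real (real k + 1 / 2))" "in_chart Edges (\<i> * of_real (real k + 3 - 1 / 2))"
    and idx: "sector Edges (\<i> * of_real (real k + 1 / 2)) = int k" "sector Edges (\<i> * of_real (real k + 3 - 1 / 2)) = int (k + 2)" for k
  proof -
    have "of_int n + 1 / 2 \<notin> (\<int> :: real set)" for n
    proof
      assume "of_int n + 1 / 2 \<in> (\<int> :: real set)"
      then obtain m where "of_int n + 1 / 2 = (of_int m :: real)" by (auto simp: Ints_def)
      then have "of_int (2 * n + 1) = (of_int (2 * m) :: real)" by simp
      then have "2 * n + 1 = 2 * m" by (simp only: of_int_eq_iff)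
      then show False by presburger
    qed
    from this[of "int k"] this[of "int k + 2"]
    show "in_chart Edges (\<i> * of_real (real k + 1 / 2))" "in_chart Edges (\<i> * of_real (real k + 3 - 1 / 2))"
      by (simp_all add: in_chart_def add_ac)
    show "sector Edges (\<i> * of_real (real k + 1 / 2)) = int k" "sector Edges (\<i> * of_real (real k + 3 - 1 / 2)) = int (k + 2)"
      by (simp_all add: sector_def floor_eq_iff)
  qed
  have dH: "d \<in> carrier H" and val: "\<Phi> (crossing k) = d \<otimes> inv (e (k + 2)) \<otimes> inv d" if k: "base_side k" for k
  proof -
    have glued: "q (rim (real k + 1 / 2)) = q (rim (real k + 3 - 1 / 2))" using q_glue[OF k, of "1/2"] by simp
    note h = hol_gluing_loop[OF _ in_chart(1)[of k] in_chart(2)[of k] glued i0, folded d_def]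
    show d: "d \<in> carrier H" by (rule h(1)) simp
    have loop: "spoke (rim (real k + 1 / 2)) +++ reversepath (spoke (rim (real k + 3 - 1 / 2))) \<in> loops_at S (q z0)"
      using glued by (intro lasso_loop arc_spoke) auto
    have "k + 2 < 4 * g" "k < 4 * g" using base_side_bound[OF k] by simp_all
    then have lab: "label Edges (int k) = \<one>" "label Edges (int (k + 2)) = e (k + 2)"
      using label_Edges e_base[OF k] by (simp_all only:)
    have "\<Phi> (crossing k) = d \<otimes> (label Edges (int k) \<otimes> inv (label Edges (int (k + 2)))) \<otimes> inv d"
      unfolding crossing_def gluing_loop_def lasso_def using \<Phi>_hol loop h(2) by (simp only: idx) simp
    then show "\<Phi> (crossing k) = d \<otimes> inv (e (k + 2)) \<otimes> inv d" unfolding lab using e_closed by simp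
  qed
  have "base_side 0" using g_pos by (simp add: base_side_def)
  note dH = dH[OF this]
  have \<Phi>c: "\<Phi> x \<in> carrier H" if "x \<in> carrier (fundamental_group S (q z0))" for x using \<Phi> that by (auto simp: hom_def)
  have "\<phi> \<in> hom (fundamental_group S (q z0)) H"
    using \<Phi> dH \<Phi>c unfolding hom_def \<phi>_def
    by (auto simp: m_assoc mult_inv_cancel)
  moreover have "\<phi> (crossing k) = inv (e (k + 2))" if "base_side k" for k
    using val[OF that] dH e_closed by (simp add: \<phi>_def m_assoc mult_inv_cancel)
  ultimately show ?thesis by blast
qed

end

definition edge_label :: "('b, 'm) monoid_scheme \<Rightarrow> nat \<Rightarrow> (nat \<Rightarrow> 'b) \<Rightarrow> (nat \<Rightarrow> 'b) \<Rightarrow> nat \<Rightarrow> 'b" where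
  "edge_label H g a b k = (let j = k div 4 in
    if g \<le> j \<or> k mod 4 < 2 then \<one>\<^bsub>H\<^esub> else if k mod 4 = 2 then inv\<^bsub>H\<^esub> (a j) else b j)"

text \<open>
  Solving the compatibility conditions corner by corner, starting from \<open>\<one>\<close> at the corner \<open>0\<close>, gives the inverse of the
  partial relator at the corner \<open>4 j\<close>; consistency at the corner \<open>4 g\<close> is the surface relation.
\<close>
definition vertex_label :: "('b, 'm) monoid_scheme \<Rightarrow> nat \<Rightarrow> (nat \<Rightarrow> 'b) \<Rightarrow> (nat \<Rightarrow> 'b) \<Rightarrow> nat \<Rightarrow> 'b" where
  "vertex_label H g a b k = (let j = k div 4; W = inv\<^bsub>H\<^esub> (surface_word H a b [0..<j]) in
    if g < j then \<one>\<^bsub>H\<^esub>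
    else if k mod 4 = 0 then W
    else if g = j then \<one>\<^bsub>H\<^esub>
    else if k mod 4 = 1 then a j \<otimes>\<^bsub>H\<^esub> inv\<^bsub>H\<^esub> (b j) \<otimes>\<^bsub>H\<^esub> inv\<^bsub>H\<^esub> (a j) \<otimes>\<^bsub>H\<^esub> W
    else if k mod 4 = 2 then inv\<^bsub>H\<^esub> (b j) \<otimes>\<^bsub>H\<^esub> inv\<^bsub>H\<^esub> (a j) \<otimes>\<^bsub>H\<^esub> W
    else inv\<^bsub>H\<^esub> (a j) \<otimes>\<^bsub>H\<^esub> W)"

lemma edge_label_eq:
  "r < 4 \<Longrightarrow> edge_label H g a b (4 * j + r) =
    (if g \<le> j \<or> r < 2 then \<one>\<^bsub>H\<^esub> else if r = 2 then inv\<^bsub>H\<^esub> (a j) else b j)"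
  by (simp add: edge_label_def)

lemma vertex_label_eq:
  "r < 4 \<Longrightarrow> j < g \<Longrightarrow> vertex_label H g a b (4 * j + r) = (let W = inv\<^bsub>H\<^esub> (surface_word H a b [0..<j]) in
    if r = 0 then W
    else if r = 1 then a j \<otimes>\<^bsub>H\<^esub> inv\<^bsub>H\<^esub> (b j) \<otimes>\<^bsub>H\<^esub> inv\<^bsub>H\<^esub> (a j) \<otimes>\<^bsub>H\<^esub> W
    else if r = 2 then inv\<^bsub>H\<^esub> (b j) \<otimes>\<^bsub>H\<^esub> inv\<^bsub>H\<^esub> (a j) \<otimes>\<^bsub>H\<^esub> W
    else inv\<^bsub>H\<^esub> (a j) \<otimes>\<^bsub>H\<^esub> W)"
  by (simp add: vertex_label_def Let_def)

lemma (in group) surface_word_closed: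
  "\<forall>j\<in>set js. a j \<in> carrier G \<and> b j \<in> carrier G \<Longrightarrow> surface_word G a b js \<in> carrier G"
  by (induction js) auto

context based_polygon
begin

lemma labelled_from_relation:
  assumes "group H" and ab: "\<And>j. j < g \<Longrightarrow> a j \<in> carrier H \<and> b j \<in> carrier H"
    and rel: "surface_word H a b [0..<g] = \<one>\<^bsub>H\<^esub>"
  shows "labelled_polygon g S q H (edge_label H g a b) (vertex_label H g a b)"
proof -
  interpret H: group H by fact
  have W: "surface_word H a b [0..<j] \<in> carrier H" if "j \<le> g" for j
    using ab that by (intro H.surface_word_closed) auto
  have W_Suc: "surface_word H a b [0..<Suc j] = surface_word H a b [0..<j] \<otimes>\<^bsub>H\<^esub>
      (a j \<otimes>\<^bsub>H\<^esub> b j \<otimes>\<^bsub>H\<^esub> inv\<^bsub>H\<^esub> (a j) \<otimes>\<^bsub>H\<^esub> inv\<^bsub>H\<^esub> (b j))" if "j < g" for j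
    using H.surface_word_snoc[of j "[0..<j]" a b] ab that by simp
  have base: "\<exists>j<g. k = 4 * j \<or> k = 4 * j + 1" if "base_side k" for k
  proof -
    have "k div 4 < g" "k mod 4 < 2" using that by (auto simp: base_side_def less_mult_imp_div_less)
    moreover from this have "k = 4 * (k div 4) \<or> k = 4 * (k div 4) + 1" by presburger
    ultimately show ?thesis by blast
  qed
  have e: "edge_label H g a b (4 * j) = \<one>\<^bsub>H\<^esub>" "edge_label H g a b (4 * j + 1) = \<one>\<^bsub>H\<^esub>"
    "edge_label H g a b (4 * j + 2) = inv\<^bsub>H\<^esub> (a j)" "edge_label H g a b (4 * j + 3) = b j" if "j < g" for j
    using that edge_label_eq[of 0 H g a b j] edge_label_eq[of 1 H g a b j] edge_label_eq[of 2 H g a b j]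
      edge_label_eq[of 3 H g a b j] by simp_all
  have v: "vertex_label H g a b (4 * j) = inv\<^bsub>H\<^esub> (surface_word H a b [0..<j])" if "j \<le> g" for j
    using that by (simp add: vertex_label_def Let_def)
  have v': "vertex_label H g a b (4 * j + 1) = a j \<otimes>\<^bsub>H\<^esub> inv\<^bsub>H\<^esub> (b j) \<otimes>\<^bsub>H\<^esub> inv\<^bsub>H\<^esub> (a j) \<otimes>\<^bsub>H\<^esub> inv\<^bsub>H\<^esub> (surface_word H a b [0..<j])"
    "vertex_label H g a b (4 * j + 2) = inv\<^bsub>H\<^esub> (b j) \<otimes>\<^bsub>H\<^esub> inv\<^bsub>H\<^esub> (a j) \<otimes>\<^bsub>H\<^esub> inv\<^bsub>H\<^esub> (surface_word H a b [0..<j])"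
    "vertex_label H g a b (4 * j + 3) = inv\<^bsub>H\<^esub> (a j) \<otimes>\<^bsub>H\<^esub> inv\<^bsub>H\<^esub> (surface_word H a b [0..<j])" if "j < g" for j
    using that vertex_label_eq[of 1 j g H a b] vertex_label_eq[of 2 j g H a b]
      vertex_label_eq[of 3 j g H a b] by simp_all
  have v4: "vertex_label H g a b (4 * j + 4) = b j \<otimes>\<^bsub>H\<^esub> a j \<otimes>\<^bsub>H\<^esub> inv\<^bsub>H\<^esub> (b j) \<otimes>\<^bsub>H\<^esub> inv\<^bsub>H\<^esub> (a j) \<otimes>\<^bsub>H\<^esub>
      inv\<^bsub>H\<^esub> (surface_word H a b [0..<j])" if j: "j < g" for j
  proof -
    have "vertex_label H g a b (4 * j + 4) = inv\<^bsub>H\<^esub> (surface_word H a b [0..<Suc j])"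
      using v[of "Suc j"] j by (simp add: add.commute del: upt_Suc)
    also have "\<dots> = b j \<otimes>\<^bsub>H\<^esub> a j \<otimes>\<^bsub>H\<^esub> inv\<^bsub>H\<^esub> (b j) \<otimes>\<^bsub>H\<^esub> inv\<^bsub>H\<^esub> (a j) \<otimes>\<^bsub>H\<^esub> inv\<^bsub>H\<^esub> (surface_word H a b [0..<j])"
      unfolding W_Suc[OF j] using ab[OF j] W[of j] j by (simp add: H.inv_mult_group H.m_assoc)
    finally show ?thesis .
  qed
  show ?thesis
  proof unfold_locales
    show "edge_label H g a b k \<in> carrier H" for k
      using ab by (simp add: edge_label_def Let_def)
    show "vertex_label H g a b k \<in> carrier H" for k
      using ab W by (simp add: vertex_label_def Let_def)
    show "edge_label H g a b k = \<one>\<^bsub>H\<^esub>" if "base_side k" for k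
      using base[OF that] e by auto
    show "vertex_label H g a b k = inv\<^bsub>H\<^esub> edge_label H g a b (k + 2) \<otimes>\<^bsub>H\<^esub> vertex_label H g a b (k + 3)"
      if "base_side k" for k
    proof -
      obtain j where j: "j < g" "k = 4 * j \<or> k = 4 * j + 1" using base[OF \<open>base_side k\<close>] by blast
      note c = ab[OF j(1)] W[of j]
      from j(2) show ?thesis
      proof
        assume "k = 4 * j"
        then show ?thesis using e(3)[OF j(1)] v[of j] v'(3)[OF j(1)] c j by (simp add: H.mult_inv_cancel)
      next
        assume "k = 4 * j + 1"
        then have k: "k = 4 * j + 1" "k + 2 = 4 * j + 3" "k + 3 = 4 * j + 4" by simp_all
        show ?thesis unfolding k(2,3) unfolding k(1) e(4)[OF j(1)] v'(1)[OF j(1)] v4[OF j(1)]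
          using c j by (simp add: H.mult_inv_cancel H.m_assoc)
      qed
    qed
    show "vertex_label H g a b (k + 1) = inv\<^bsub>H\<^esub> edge_label H g a b (k + 2) \<otimes>\<^bsub>H\<^esub> vertex_label H g a b (k + 2)"
      if "base_side k" for k
    proof -
      obtain j where j: "j < g" "k = 4 * j \<or> k = 4 * j + 1" using base[OF \<open>base_side k\<close>] by blast
      note c = ab[OF j(1)] W[of j]
      from j(2) show ?thesis
      proof
        assume k: "k = 4 * j"
        show ?thesis unfolding k e(3)[OF j(1)] v'(1)[OF j(1)] v'(2)[OF j(1)]
          using c j by (simp add: H.m_assoc)
      next
        assume "k = 4 * j + 1"
        then have k: "k + 1 = 4 * j + 2" "k + 2 = 4 * j + 3" by simp_all
        show ?thesis unfolding k e(4)[OF j(1)] v'(2)[OF j(1)] v'(3)[OF j(1)]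
          using c j by (simp add: H.m_assoc)
      qed
    qed
    show "vertex_label H g a b (4 * g) = vertex_label H g a b 0"
      using v[of g] v[of 0] rel by simp
  qed
qed

theorem universal_property:
  assumes H: "group H" and ab: "\<And>j. j < g \<Longrightarrow> a j \<in> carrier H \<and> b j \<in> carrier H"
    and rel: "surface_word H a b [0..<g] = \<one>\<^bsub>H\<^esub>"
  shows "\<exists>\<phi>\<in>hom \<pi> H. \<forall>j<g. \<phi> (gen_a j) = a j \<and> \<phi> (gen_b j) = b j"
proof -
  interpret H: group H by fact
  interpret P: labelled_polygon g S q H "edge_label H g a b" "vertex_label H g a b"
    by (rule labelled_from_relation[OF H ab rel])
  interpret P: based_labelled_polygon g S q H "edge_label H g a b" "vertex_label H g a b" z0
    by unfold_locales
  obtain \<phi> where \<phi>: "\<phi> \<in> hom \<pi> H" "\<And>k. base_side k \<Longrightarrow> \<phi> (crossing k) = inv\<^bsub>H\<^esub> edge_label H g a b (k + 2)"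
    using P.labels_give_representation by blast
  interpret \<phi>: group_hom \<pi> H \<phi>
    using \<phi>(1) by (simp add: group_hom_def group_hom_axioms_def H \<pi>.is_group)
  have "\<phi> (gen_a j) = a j \<and> \<phi> (gen_b j) = b j" if j: "j < g" for j
    using \<phi>(2)[OF base_sides(1)[OF j]] \<phi>(2)[OF base_sides(2)[OF j]] crossing_closed[OF base_sides(2)[OF j]] ab[OF j] j
      edge_label_eq[of 2 H g a b j] edge_label_eq[of 3 H g a b j]
    by (simp add: gen_a_def gen_b_def numeral_3_eq_3)
  then show ?thesis using \<phi>(1) by blast
qed

theorem surface_group: "surface_group \<pi> g gen_a gen_b"
proof unfold_locales
  show "\<exists>\<phi>\<in>hom \<pi> Homeo_plus. \<forall>j<g. \<phi> (gen_a j) = a j \<and> \<phi> (gen_b j) = b j"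
    if "\<And>j. j < g \<Longrightarrow> a j \<in> carrier Homeo_plus \<and> b j \<in> carrier Homeo_plus"
      "surface_word Homeo_plus a b [0..<g] = \<one>\<^bsub>Homeo_plus\<^esub>" for a b
    using universal_property[OF group_Homeo_plus that] .
  show "carrier \<pi> \<subseteq> K" if "subgroup K \<pi>" "\<And>j. j < g \<Longrightarrow> gen_a j \<in> K \<and> gen_b j \<in> K" for K
    by (rule generators_generate[OF that])
qed (simp_all add: gen_closed relation)

end

section \<open>Connectedness\<close>

theorem corollary1p5:
  fixes \<Sigma> :: "'a::topological_space set" and x0 :: 'a and g :: nat
  assumes "g \<ge> 2"
    and "closed_orientable_surface g \<Sigma>"
    and "x0 \<in> \<Sigma>"
  shows "connected_space (Rep_sharp_topology (fundamental_group \<Sigma> x0))"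
proof -
  obtain q where q: "quotient_map (top_of_set (cball 0 1)) (top_of_set \<Sigma>) q"
    "\<forall>z\<in>cball 0 1. \<forall>w\<in>cball 0 1. q z = q w \<longleftrightarrow> equivclp (side_pairing g) z w"
    using assms(2) unfolding closed_orientable_surface_def by blast
  have "q ` cball 0 1 = \<Sigma>" using q(1) by (simp add: quotient_map_def)
  then obtain y0 where y0: "y0 \<in> cball 0 1" "x0 = q y0" using assms(3) by blast
  interpret based_polygon g \<Sigma> q y0
    using assms(1) q y0 by unfold_locales auto
  show ?thesis
    unfolding y0(2) by (rule surface_group.connected_Rep_sharp[OF surface_group assms(1)])
qed

end
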